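(* Assume that $h$ is non-decreasing, that $\Phi$ is non-increasing, and that there is no discounting, i.e. $L_T=\sum_{i=1}^{H_T}f(\eta_i)$ and $K_T=\sum_{i=1}^{H_T}g(\eta_i,\vartheta_i)$. Let $C_2:=\left(\int_0^T\Psi_1(t)dt\right)^2$, with $\Psi_1$ the solution of $\Psi_1(t)=1+\int_0^t\Phi(t-s)\Psi_1(s)ds$ on $[0,T]$, and $C_1:=\int_0^T\Psi_2(t)dt$, with $\Psi_2$ the solution of $\Psi_2(t)=(\Psi_1(t))^2+\int_0^t\Phi(s)\Psi_2(t-s)ds$ on $[0,T]$. For $n\ge1$ let $c_n:=(\mu+n\Phi(0))C_1+(\mu+n\Phi(0))^2C_2$ and $$\begin{aligned} \beta_n:=\;&e^{-T(\mu+n\Phi(0))}\,\mathbb E\left[g(\bar\eta_1,\bar\vartheta_1)\,\mathbb E\left[h\left(\sum_{k=1}^nf(\bar\eta_k)\right)\Big|\,\bar\eta_1\right]\right]\\ &+\sum_{p=1}^{+\infty}\frac{c_n}{p^2}\,\mathbb E\left[g(\bar\eta_1,\bar\vartheta_1)\,\mathbb E\left[h\left(\sum_{k=1}^nf(\bar\eta_k)+\sum_{i=1}^pf(\eta_i)\right)\Big|\,\bar\eta_1\right]\right]. \end{aligned}$$ Then $$\mathbb E[K_Th(L_T)]\le\mu\sum_{n=1}^{+\infty}m_\Phi(\Delta^n)\,\beta_n,$$ where $m_\Phi(\Delta^1):=T$ and, for $n\ge2$, $m_\Phi(\Delta^n):=\int_0^T\int_0^{v_1}\cdots\int_0^{v_{n-1}}\prod_{i=2}^n\Phi(v_{i-1}-v_i)\,dv_n\cdots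 dv_1$.
   Context: Fix $T>0$, $\mu>0$ and a bounded (measurable) function $\Phi:[0,T]\to\mathbb R_+$ with $\|\Phi\|_1=\int_0^T\Phi(s)ds<1$. Let $N$ be a Poisson random measure on $[0,T]\times\mathbb R_+$ with intensity $dt\otimes d\theta$, with natural filtration $\mathbb F^N$. $(H,\Lambda)$ is the unique $\mathbb F^N$-adapted solution of $$H_t=\int_{(0,t]}\int_{\mathbb R_+}\mathbf 1_{\{\theta\le\Lambda_s\}}N(ds,d\theta),\qquad\Lambda_t=\mu+\int_{(0,t)}\Phi(t-u)\,dH_u,\quad t\in[0,T],$$ a standard Hawkes process. Claims: $(\eta_1,\vartheta_1)$ is an $\mathbb R_+^2$-valued random variable, and $(\eta_i,\vartheta_i)_{i\ge2}$ and $(\bar\eta_i,\bar\vartheta_i)_{i\ge1}$ are independent copies of it (all these pairs are mutually independent), all independent of $N$ (hence of $H$). $f:\mathbb R_+\to\mathbb R_+$, $g:\mathbb R_+^2\to\mathbb R_+$, $h:\mathbb R_+\to\mathbb R_+$ are bounded (measurable) deterministic functions. *)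

theory Defs
  imports "HOL-Probability.Probability"
begin

section \<open>Poisson random measures and the Hawkes process\<close>

text \<open>The law is required only on sets of finite intensity. It is written out because
  \<^const>\<open>poisson_pmf\<close> is meaningful for positive rates only; here the rate may be 0, in which case
  \<open>0 ^ 0 = 1\<close> gives the point mass at 0.\<close>

definition poisson_random_measure :: "'a measure \<Rightarrow> 'b measure \<Rightarrow> ('a \<Rightarrow> 'b measure) \<Rightarrow> bool" where
  "poisson_random_measure M \<nu> N \<longleftrightarrow>
     (\<forall>\<omega>\<in>space M. sets (N \<omega>) = sets \<nu>) \<and>
     (\<forall>A\<in>sets \<nu>. (\<lambda>\<omega>. emeasure (N \<omega>) A) \<in> borel_measurable M) \<and>
     (\<forall>A\<in>sets \<nu>. emeasure \<nu> A < \<infinity> \<longrightarrow>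
        (\<forall>k::nat. measure M {\<omega> \<in> space M. emeasure (N \<omega>) A = of_nat k}
                  = exp (- measure \<nu> A) * measure \<nu> A ^ k / fact k)) \<and>
     (\<forall>(I::nat set) A. finite I \<longrightarrow> (\<forall>i\<in>I. A i \<in> sets \<nu>) \<longrightarrow> disjoint_family_on A I \<longrightarrow>
        prob_space.indep_vars M (\<lambda>_. borel) (\<lambda>i \<omega>. emeasure (N \<omega>) (A i)) I)"

definition strip_intensity :: "real \<Rightarrow> (real \<times> real) measure" where
  "strip_intensity T = restrict_space lborel {0..T} \<Otimes>\<^sub>M restrict_space lborel {0..}"

definition natural_filtration ::
    "'a measure \<Rightarrow> real \<Rightarrow> ('a \<Rightarrow> (real \<times> real) measure) \<Rightarrow> real \<Rightarrow> 'a measure" where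
  "natural_filtration M T N t =
     sigma (space M)
       {(\<lambda>\<omega>. emeasure (N \<omega>) A) -` B \<inter> space M | A B.
          A \<in> sets (strip_intensity T) \<and> A \<subseteq> {0..t} \<times> {0..} \<and> B \<in> sets borel}"

text \<open>The Stieltjes measure \<open>dH\<close> of a counting path on \<open>[0,T]\<close>. The path is extended by constants
  outside \<open>[0,T]\<close>, which adds no mass to the open intervals \<open>(0,t)\<close> with \<open>t \<le> T\<close>.\<close>

definition path_measure :: "real \<Rightarrow> (real \<Rightarrow> nat) \<Rightarrow> real measure" where
  "path_measure T X = interval_measure (\<lambda>u. real (X (max 0 (min T u))))"

text \<open>Both equations hold almost surely, simultaneously for all \<open>t\<close>. The first one is
  an equation in the extended nonnegative reals, so it includes that \<open>H\<close> is finite.\<close>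

definition hawkes_solution ::
    "'a measure \<Rightarrow> real \<Rightarrow> real \<Rightarrow> (real \<Rightarrow> real) \<Rightarrow> ('a \<Rightarrow> (real \<times> real) measure) \<Rightarrow>
     (real \<Rightarrow> 'a \<Rightarrow> nat) \<Rightarrow> (real \<Rightarrow> 'a \<Rightarrow> real) \<Rightarrow> bool" where
  "hawkes_solution M T \<mu> \<Phi> N H \<Lambda> \<longleftrightarrow>
     (\<forall>t\<in>{0..T}. H t \<in> measurable (natural_filtration M T N t) (count_space UNIV)) \<and>
     (\<forall>t\<in>{0..T}. \<Lambda> t \<in> borel_measurable (natural_filtration M T N t)) \<and>
     (AE \<omega> in M. \<forall>t\<in>{0..T}.
        of_nat (H t \<omega>) =
          (\<integral>\<^sup>+ p \<in> {0<..t} \<times> {0..}. indicator {\<theta>. \<theta> \<le> \<Lambda> (fst p) \<omega>} (snd p) \<partial>N \<omega>) \<and>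
        \<Lambda> t \<omega> = \<mu> + (LINT u:{0<..<t}|path_measure T (\<lambda>s. H s \<omega>). \<Phi> (t - u)))"

section \<open>Claims\<close>

text \<open>The pairs \<open>(\<eta>\<^sub>i, \<theta>\<^sub>i)\<close> and their barred copies as a single family, the barred
  ones carrying the tag \<^const>\<open>Inr\<close>. Only the indices \<open>i \<ge> 1\<close> are used.\<close>

definition claim_family ::
    "(nat \<Rightarrow> 'a \<Rightarrow> real) \<Rightarrow> (nat \<Rightarrow> 'a \<Rightarrow> real) \<Rightarrow> (nat \<Rightarrow> 'a \<Rightarrow> real) \<Rightarrow> (nat \<Rightarrow> 'a \<Rightarrow> real) \<Rightarrow>
     nat + nat \<Rightarrow> 'a \<Rightarrow> real \<times> real" where
  "claim_family \<eta> \<theta> \<eta>b \<theta>b j =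
     (case j of Inl i \<Rightarrow> (\<lambda>\<omega>. (\<eta> i \<omega>, \<theta> i \<omega>)) | Inr i \<Rightarrow> (\<lambda>\<omega>. (\<eta>b i \<omega>, \<theta>b i \<omega>)))"

definition claim_indices :: "(nat + nat) set" where
  "claim_indices = {1..} <+> {1..}"

definition iid_claims ::
    "'a measure \<Rightarrow> real \<Rightarrow> ('a \<Rightarrow> (real \<times> real) measure) \<Rightarrow>
     (nat \<Rightarrow> 'a \<Rightarrow> real) \<Rightarrow> (nat \<Rightarrow> 'a \<Rightarrow> real) \<Rightarrow> (nat \<Rightarrow> 'a \<Rightarrow> real) \<Rightarrow> (nat \<Rightarrow> 'a \<Rightarrow> real) \<Rightarrow> bool" where
  "iid_claims M T N \<eta> \<theta> \<eta>b \<theta>b \<longleftrightarrow>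
     (let Z = claim_family \<eta> \<theta> \<eta>b \<theta>b in
       (\<forall>j\<in>claim_indices. \<forall>\<omega>\<in>space M. Z j \<omega> \<in> {0..} \<times> {0..}) \<and>
       (\<forall>j\<in>claim_indices. distr M borel (Z j) = distr M borel (Z (Inl 1))) \<and>
       prob_space.indep_vars M (\<lambda>_. borel) Z claim_indices \<and>
       prob_space.indep_set M
         (sets (natural_filtration M T N T))
         (sigma_sets (space M) (\<Union>j\<in>claim_indices. {Z j -` A \<inter> space M | A. A \<in> sets borel})))"

section \<open>Quantities in the bound\<close>

text \<open>\<open>iter_simplex_integral k F u\<close> is the iterated integral
  \<open>\<integral>\<^sub>0\<^sup>u \<integral>\<^sub>0\<^sup>v\<^sup>1 \<dots> F [v\<^sub>1, \<dots>, v\<^sub>k] dv\<^sub>k \<dots> dv\<^sub>1\<close>, the \<open>j\<close>-th upper limit being \<open>v\<^sub>j\<^sub>-\<^sub>1\<close>.\<close>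

fun iter_simplex_integral :: "nat \<Rightarrow> (real list \<Rightarrow> real) \<Rightarrow> real \<Rightarrow> real" where
  "iter_simplex_integral 0 F u = F []"
| "iter_simplex_integral (Suc k) F u =
     (LBINT v:{0..u}. iter_simplex_integral k (\<lambda>vs. F (v # vs)) v)"

text \<open>List positions start at 0, so \<open>v\<^sub>i\<close> is \<open>vs ! (i - 1)\<close>.\<close>

definition simplex_mass :: "real \<Rightarrow> (real \<Rightarrow> real) \<Rightarrow> nat \<Rightarrow> real" where
  "simplex_mass T \<Phi> n =
     (if n = 1 then T
      else iter_simplex_integral n (\<lambda>vs. \<Prod>i=2..n. \<Phi> (vs ! (i - 2) - vs ! (i - 1))) T)"

text \<open>The expectation
  \<open>E[g(\<eta>b\<^sub>1, \<theta>b\<^sub>1) E[h(\<Sum>\<^sub>k\<^sub>\<le>\<^sub>n f(\<eta>b\<^sub>k) + \<Sum>\<^sub>i\<^sub>\<le>\<^sub>p f(\<eta>\<^sub>i)) | \<eta>b\<^sub>1]]\<close>;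
  the second sum is absent for \<open>p = 0\<close>.\<close>

definition claim_term ::
    "'a measure \<Rightarrow> (real \<Rightarrow> real) \<Rightarrow> (real \<Rightarrow> real \<Rightarrow> real) \<Rightarrow> (real \<Rightarrow> real) \<Rightarrow>
     (nat \<Rightarrow> 'a \<Rightarrow> real) \<Rightarrow> (nat \<Rightarrow> 'a \<Rightarrow> real) \<Rightarrow> (nat \<Rightarrow> 'a \<Rightarrow> real) \<Rightarrow> nat \<Rightarrow> nat \<Rightarrow> real" where
  "claim_term M f g h \<eta> \<eta>b \<theta>b n p =
     (\<integral>\<omega>. g (\<eta>b 1 \<omega>) (\<theta>b 1 \<omega>) *
        real_cond_exp M (vimage_algebra (space M) (\<eta>b 1) borel)
          (\<lambda>\<omega>'. h ((\<Sum>k=1..n. f (\<eta>b k \<omega>')) + (\<Sum>i=1..p. f (\<eta> i \<omega>')))) \<omega> \<partial>M)"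

end

theory Submission
  imports Defs
begin

text \<open>
  Let \<open>a m\<close> be the mean of \<open>g(\<eta>\<^sub>1, \<theta>\<^sub>1) h(f(\<eta>\<^sub>1) + \<dots> + f(\<eta>\<^sub>m))\<close>, a non-decreasing bounded sequence.
  The claims are exchangeable and independent of the Hawkes process, so the left-hand side is the
  mean of \<open>X * a X\<close> with \<open>X = H T\<close>, and the conditional expectations in \<open>\<beta>\<^sub>n\<close> are the numbers
  \<open>a (n + p)\<close>. Put \<open>s = (\<Sum>p\<ge>1. (a (p + 1) - a 1) / p\<^sup>2)\<close>. Since \<open>(\<Sum>p\<ge>k. 1 / p\<^sup>2) \<ge> 1 / k\<close>, monotonicity gives
  \<open>m * a m \<le> m * a 1 + m * (m - 1) * s\<close>. Hence the first two factorial moments of \<open>X\<close> suffice,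
  namely \<open>E X \<le> \<mu> * I\<close> and \<open>E (X * (X - 1)) \<le> (\<mu> * I)\<^sup>2 + \<mu> * \<Phi> 0 * I * C1\<close> with \<open>I\<close> the integral of \<open>\<Psi>1\<close>.
  They match the right-hand side because the simplex masses sum to \<open>I\<close> (Neumann series).

  For the moments, \<open>X\<close> is truncated at a level \<open>K\<close> and \<open>[0, T]\<close> is divided into \<open>n\<close> cells. As \<open>\<Phi>\<close> is
  non-increasing, the intensity up to the next jump after a grid point is at most a quantity
  depending on the increments over earlier cells only, so that a jump in a cell forces a point of
  the Poisson measure in a strip of known height, up to an event of probability \<open>O(1 / n\<^sup>2)\<close>. The moments of the
  resulting discrete self-exciting chain are computed with the martingale obtained from the
  resolvent of the discretised kernel, and the discretised resolvents are compared with \<open>\<Psi>1\<close>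
  and \<open>\<Psi>2\<close> through cell averages.
\<close>

section \<open>Discrete Volterra equations\<close>

text \<open>The truncation at \<open>K\<close> is forced by the unbounded intensity: only below
  level \<open>K\<close> is it at most \<open>\<mu> + \<Phi> 0 * K\<close>, so that two points in
  the strip over one cell have probability of order \<open>1 / n^2\<close> and \<open>n\<close> such
  errors vanish in the limit. The level is released by monotone convergence once the truncated
  moments are bounded uniformly in \<open>K\<close>. The discretisation must err upwards. The index
  \<open>k - 1 - l\<close> measures the gap from the end of cell \<open>l\<close> to the start of
  cell \<open>k\<close>, the smallest possible lag, where a non-increasing kernel is largest. The
  continuous equations are compared with the largest lag, \<open>k + 1 - l\<close>. As
  \<open>\<Phi>\<close> may be discontinuous, only monotonicity controls the difference of the two
  kernels: it telescopes and costs \<open>O(1 / n)\<close>. The final comparison is made term by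
  term: a single number bounds every \<open>\<beta> n\<close> from below, which needs
  \<open>T \<le> I \<le> C1\<close> as well as \<open>exp (- x) \<ge> 1 - x\<close>, and the simplex
  masses are then summed separately.\<close>

fun volterra :: "(nat \<Rightarrow> real) \<Rightarrow> (nat \<Rightarrow> real) \<Rightarrow> nat \<Rightarrow> real" where
  "volterra \<phi> a k = a k + (\<Sum>l<k. \<phi> (k - 1 - l) * volterra \<phi> a l)"

declare volterra.simps [simp del]

lemma volterra_ge:
  assumes "\<And>i. i < n \<Longrightarrow> 0 \<le> \<phi> i" "\<And>i. i < n \<Longrightarrow> 0 \<le> a i" "k < n"
  shows "a k \<le> volterra \<phi> a k"
  using \<open>k < n\<close>
proof (induction k rule: less_induct)
  case (less k)
  have "0 \<le> \<phi> (k - 1 - l) * volterra \<phi> a l" if "l < k" for l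
    using that less.IH[of l] less.prems assms(1)[of "k - 1 - l"] assms(2)[of l]
    by (intro mult_nonneg_nonneg) auto
  then show ?case
    by (subst volterra.simps) (auto intro!: sum_nonneg)
qed

text \<open>Discrete Gronwall inequality: the extremal case is the constant kernel \<open>b\<close>
  with constant data \<open>A\<close>, whose solution is exactly \<open>A * (1 + b) ^ k\<close> by
  the geometric sum.\<close>

lemma volterra_le_power:
  assumes \<phi>: "\<And>i. i < n \<Longrightarrow> 0 \<le> \<phi> i" "\<And>i. i < n \<Longrightarrow> \<phi> i \<le> b"
    and a: "\<And>i. i < n \<Longrightarrow> 0 \<le> a i" "\<And>i. i < n \<Longrightarrow> a i \<le> A" and "k < n"
  shows "volterra \<phi> a k \<le> A * (1 + b) ^ k"
  using \<open>k < n\<close>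
proof (induction k rule: less_induct)
  case (less k)
  have b: "0 \<le> b" using \<phi>[of 0] less.prems by simp
  have A: "0 \<le> A" using a[of 0] less.prems by simp
  have "\<phi> (k - 1 - l) * volterra \<phi> a l \<le> b * (A * (1 + b) ^ l)" if "l < k" for l
  proof -
    have "0 \<le> volterra \<phi> a l"
      using volterra_ge[of n \<phi> a l] \<phi> a that less.prems by (smt (verit) order.strict_trans)
    moreover have "volterra \<phi> a l \<le> A * (1 + b) ^ l" using less that by auto
    ultimately show ?thesis using \<phi>[of "k - 1 - l"] that less.prems b by (intro mult_mono) auto
  qed
  then have "volterra \<phi> a k \<le> A + (\<Sum>l<k. b * (A * (1 + b) ^ l))"
    using a(2)[OF less.prems] by (subst volterra.simps) (intro add_mono sum_mono, auto)
  also have "\<dots> = A + A * (b * (\<Sum>l<k. (1 + b) ^ l))"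
    by (simp add: sum_distrib_left mult_ac)
  also have "b * (\<Sum>l<k. (1 + b) ^ l) = (1 + b) ^ k - 1"
    using power_diff_1_eq[of "1 + b" k] by simp
  finally show ?case by (simp add: algebra_simps)
qed

text \<open>The exponential form is stable under refinement: with \<open>b = d * \<Phi> 0\<close>
  and \<open>n * d = T\<close> the exponent is the fixed number \<open>T * \<Phi> 0\<close>.\<close>

lemma volterra_le_exp:
  assumes \<phi>: "\<And>i. i < n \<Longrightarrow> 0 \<le> \<phi> i" "\<And>i. i < n \<Longrightarrow> \<phi> i \<le> b"
    and a: "\<And>i. i < n \<Longrightarrow> 0 \<le> a i" "\<And>i. i < n \<Longrightarrow> a i \<le> A" and "k < n"
  shows "volterra \<phi> a k \<le> A * exp (real n * b)"
proof -
  have b: "0 \<le> b" and A: "0 \<le> A" using \<phi>[of 0] a[of 0] \<open>k < n\<close> by auto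
  have "(1 + b) ^ k \<le> exp b ^ k" using b by (intro power_mono) (auto simp: exp_ge_add_one_self)
  also have "\<dots> = exp (real k * b)" by (simp add: exp_of_nat_mult)
  also have "\<dots> \<le> exp (real n * b)" using b \<open>k < n\<close> by (simp add: mult_right_mono)
  finally show ?thesis
    using volterra_le_power[of n \<phi> b a A k, OF \<phi> a \<open>k < n\<close>] A by (meson mult_left_mono order.trans)
qed

text \<open>For points of two cells \<open>l < k\<close> the lag lies between
  \<open>k - 1 - l\<close> and \<open>k + 1 - l\<close> cell lengths; the sum is the total gap
  between the two extreme kernels. After reversal of the index it telescopes with step two, so four
  boundary values survive.\<close>

lemma telescope_two:
  fixes \<phi> :: "nat \<Rightarrow> real"
  shows "(\<Sum>l<k. \<phi> (k - 1 - l) - \<phi> (k + 1 - l)) = \<phi> 0 + \<phi> 1 - \<phi> k - \<phi> (k + 1)"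
proof -
  have "(\<Sum>l<k. \<phi> (k - 1 - l) - \<phi> (k + 1 - l)) = (\<Sum>j<k. \<phi> j - \<phi> (j + 2))"
    by (rule sum.reindex_bij_witness[of _ "\<lambda>j. k - 1 - j" "\<lambda>l. k - 1 - l"]) (auto simp: Suc_diff_Suc Suc_diff_le numeral_2_eq_2)
  also have "\<dots> = \<phi> 0 + \<phi> 1 - \<phi> k - \<phi> (k + 1)"
    by (induction k) (auto simp: numeral_2_eq_2)
  finally show ?thesis .
qed

text \<open>Moving the kernel by two grid steps costs only \<open>2 B \<phi> 0\<close> because the kernel is non-increasing
  and the differences telescope.\<close>

lemma volterra_le_supersolution:
  assumes \<phi>0: "\<And>i. i \<le> n \<Longrightarrow> 0 \<le> \<phi> i"
    and \<phi>_anti: "\<And>i j. i \<le> j \<Longrightarrow> j \<le> n \<Longrightarrow> \<phi> j \<le> \<phi> i"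
    and w: "\<And>k. k < n \<Longrightarrow> 0 \<le> volterra \<phi> a k" "\<And>k. k < n \<Longrightarrow> volterra \<phi> a k \<le> B"
    and \<psi>: "\<And>k. k < n \<Longrightarrow> b k + (\<Sum>l<k. \<phi> (k + 1 - l) * \<psi> l) \<le> \<psi> k"
    and ab: "\<And>k. k < n \<Longrightarrow> a k + 2 * B * \<phi> 0 \<le> b k"
    and "k < n"
  shows "volterra \<phi> a k \<le> \<psi> k"
  using \<open>k < n\<close>
proof (induction k rule: less_induct)
  case (less k)
  let ?w = "volterra \<phi> a"
  have "0 \<le> B" using w[OF less.prems] by simp
  have "(\<phi> (k - 1 - l) - \<phi> (k + 1 - l)) * ?w l \<le> (\<phi> (k - 1 - l) - \<phi> (k + 1 - l)) * B"
    if "l < k" for l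
    using w[of l] \<phi>_anti[of "k - 1 - l" "k + 1 - l"] that less.prems
    by (intro mult_left_mono) auto
  then have "(\<Sum>l<k. (\<phi> (k - 1 - l) - \<phi> (k + 1 - l)) * ?w l)
      \<le> (\<Sum>l<k. \<phi> (k - 1 - l) - \<phi> (k + 1 - l)) * B"
    unfolding sum_distrib_right by (intro sum_mono) auto
  also have "\<dots> \<le> (2 * \<phi> 0) * B"
    unfolding telescope_two
    using \<phi>_anti[of 0 1] \<phi>0[of k] \<phi>0[of "k + 1"] less.prems \<open>0 \<le> B\<close>
    by (intro mult_right_mono) auto
  finally have 1: "(\<Sum>l<k. (\<phi> (k - 1 - l) - \<phi> (k + 1 - l)) * ?w l) \<le> 2 * B * \<phi> 0"
    by (simp add: mult_ac)
  have 2: "(\<Sum>l<k. \<phi> (k + 1 - l) * ?w l) \<le> (\<Sum>l<k. \<phi> (k + 1 - l) * \<psi> l)"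
    using less \<phi>0 by (intro sum_mono mult_left_mono) auto
  \<comment> \<open>The kernel is split into the shifted one, to which the induction hypothesis
    applies, and the defect, which uses only the a priori bound \<open>B\<close> and is paid for by
    the larger forcing term \<open>b\<close>.\<close>
  have "?w k = a k + (\<Sum>l<k. (\<phi> (k - 1 - l) - \<phi> (k + 1 - l)) * ?w l) + (\<Sum>l<k. \<phi> (k + 1 - l) * ?w l)"
    by (subst volterra.simps) (simp add: algebra_simps sum.distrib sum_subtractf)
  also have "\<dots> \<le> \<psi> k" using 1 2 \<psi>[OF less.prems] ab[OF less.prems] by linarith
  finally show ?case .
qed

lemma sum_less_swap:
  fixes F :: "nat \<Rightarrow> nat \<Rightarrow> real"
  shows "(\<Sum>k<n. \<Sum>l<k. F k l) = (\<Sum>l<n. \<Sum>k=Suc l..<n. F k l)"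
proof -
  have "(\<Sum>k<n. \<Sum>l<k. F k l) = (\<Sum>k<n. \<Sum>l<n. if l < k then F k l else 0)"
  proof (rule sum.cong)
    fix k assume "k \<in> {..<n}"
    then show "(\<Sum>l<k. F k l) = (\<Sum>l<n. if l < k then F k l else 0)"
      by (intro sum.mono_neutral_cong_left) auto
  qed simp
  also have "\<dots> = (\<Sum>l<n. \<Sum>k<n. if l < k then F k l else 0)" by (rule sum.swap)
  also have "\<dots> = (\<Sum>l<n. \<Sum>k=Suc l..<n. F k l)"
  proof (rule sum.cong)
    fix l assume "l \<in> {..<n}"
    show "(\<Sum>k<n. if l < k then F k l else 0) = (\<Sum>k=Suc l..<n. F k l)"
      by (intro sum.mono_neutral_cong_right) auto
  qed simp
  finally show ?thesis .
qed

text \<open>This serves the second moment, where the excess of \<open>u\<close> over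
  \<open>v\<close> has to be of first order in the kernel. The forcing excess is
  \<open>(v - 1) * (v + 1)\<close>: the first factor is at most \<open>b\<close> times the past sum
  of \<open>v\<close>, the second at most \<open>2 * v\<close>. The remainder of
  \<open>u - v\<close> solves the same recursion and reproduces itself with the factor
  \<open>b\<close>.\<close>

lemma volterra_sum_diff_le:
  assumes \<phi>: "\<And>i. i < n \<Longrightarrow> 0 \<le> \<phi> i" "\<And>i. i < n \<Longrightarrow> \<phi> i \<le> b"
  defines "v \<equiv> volterra \<phi> (\<lambda>_. 1)"
  defines "u \<equiv> volterra \<phi> (\<lambda>k. (v k)\<^sup>2)"
  shows "(\<Sum>k<n. u k) - (\<Sum>k<n. v k) \<le> b * (\<Sum>k<n. v k) * (\<Sum>k<n. u k)"
proof (cases "n = 0")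
  case False
  have b: "0 \<le> b" using \<phi>[of 0] False by simp
  have v1: "1 \<le> v k" if "k < n" for k
    using volterra_ge[of n \<phi> "\<lambda>_. 1" k] \<phi> that by (simp add: v_def)
  have uv: "(v k)\<^sup>2 \<le> u k" if "k < n" for k
    using volterra_ge[of n \<phi> "\<lambda>k. (v k)\<^sup>2" k] \<phi> that by (simp add: u_def)
  have vu: "v k \<le> u k" if "k < n" for k
    using v1[OF that] uv[OF that] self_le_power[of "v k" 2] by linarith
  have v_eq: "v k = 1 + (\<Sum>l<k. \<phi> (k - 1 - l) * v l)" for k
    unfolding v_def by (subst volterra.simps) simp
  have u_eq: "u k = (v k)\<^sup>2 + (\<Sum>l<k. \<phi> (k - 1 - l) * u l)" for k
    unfolding u_def by (subst volterra.simps) simp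
  define I where "I = (\<Sum>k<n. v k)"
  define \<Delta> where "\<Delta> = (\<Sum>k<n. u k - v k)"
  define P where "P = (\<Sum>k<n. \<Sum>l<k. v l * v k)"
  have "\<Delta> \<ge> 0" unfolding \<Delta>_def using vu by (intro sum_nonneg) auto
  \<comment> \<open>As \<open>v\<close> is at least 1, its sum dominates the number of cells; this
    later turns a factor \<open>n\<close> into the factor \<open>I\<close> of the claim.\<close>
  have nI: "real n \<le> I" unfolding I_def using sum_mono[of "{..<n}" "\<lambda>_. 1" v] v1 by simp
  have "I\<^sup>2 = (\<Sum>k<n. \<Sum>l<n. v l * v k)"
    unfolding I_def power2_eq_square sum_product by (simp add: mult.commute)
  also have "\<dots> = (\<Sum>k<n. (\<Sum>l<k. v l * v k) + v k * v k + (\<Sum>l=Suc k..<n. v l * v k))"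
  proof (rule sum.cong)
    fix k assume "k \<in> {..<n}"
    then have "{..<n} = {..<k} \<union> insert k {Suc k..<n}" by auto
    moreover have "(\<Sum>l\<in>{..<k} \<union> insert k {Suc k..<n}. v l * v k)
        = (\<Sum>l<k. v l * v k) + (\<Sum>l\<in>insert k {Suc k..<n}. v l * v k)"
      by (rule sum.union_disjoint) auto
    ultimately show "(\<Sum>l<n. v l * v k) = (\<Sum>l<k. v l * v k) + v k * v k + (\<Sum>l=Suc k..<n. v l * v k)"
      by simp
  qed simp
  also have "\<dots> = P + (\<Sum>k<n. v k * v k) + P"
    unfolding sum.distrib P_def
    by (subst (3) sum_less_swap) (simp add: mult.commute)
  \<comment> \<open>\<open>P\<close> is the strictly triangular part of the squared sum, which
    occurs twice by symmetry; the diagonal is dropped.\<close>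
  finally have P2: "2 * P \<le> I\<^sup>2" using sum_nonneg[of "{..<n}" "\<lambda>k. v k * v k"] by simp
  have vm1: "v k - 1 \<le> b * (\<Sum>l<k. v l)" if "k < n" for k
  proof -
    have "(\<Sum>l<k. \<phi> (k - 1 - l) * v l) \<le> (\<Sum>l<k. b * v l)"
      using v1 that \<phi> by (intro sum_mono mult_right_mono) (auto intro: order.trans[of 0 1])
    then show ?thesis by (subst v_eq) (simp add: sum_distrib_left)
  qed
  have "(v k)\<^sup>2 - 1 \<le> 2 * (b * (\<Sum>l<k. v l * v k))" if k: "k < n" for k
  proof -
    have "(v k - 1) * (v k + 1) \<le> (b * (\<Sum>l<k. v l)) * (2 * v k)"
    proof (rule mult_mono)
      show "0 \<le> b * (\<Sum>l<k. v l)"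
        using v1 k b by (intro mult_nonneg_nonneg sum_nonneg) (auto intro: order.trans[of 0 1])
    qed (use vm1[OF k] v1[OF k] in auto)
    then show ?thesis
      by (simp add: power2_eq_square algebra_simps sum_distrib_left sum_distrib_right)
  qed
  then have "(\<Sum>k<n. (v k)\<^sup>2 - 1) \<le> (\<Sum>k<n. 2 * (b * (\<Sum>l<k. v l * v k)))"
    by (intro sum_mono) auto
  also have "\<dots> = b * (2 * P)" by (simp add: P_def sum_distrib_left mult_ac)
  also have "\<dots> \<le> b * I\<^sup>2" using P2 b by (intro mult_left_mono)
  finally have A: "(\<Sum>k<n. (v k)\<^sup>2 - 1) \<le> b * I\<^sup>2" .
  have "(\<Sum>k<n. \<Sum>l<k. \<phi> (k - 1 - l) * (u l - v l)) \<le> (\<Sum>k<n. b * \<Delta>)"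
  proof (rule sum_mono)
    fix k assume k: "k \<in> {..<n}"
    have "(\<Sum>l<k. \<phi> (k - 1 - l) * (u l - v l)) \<le> (\<Sum>l<k. b * (u l - v l))"
      using vu k \<phi> by (intro sum_mono mult_right_mono) auto
    also have "\<dots> \<le> (\<Sum>l<n. b * (u l - v l))" using k vu b by (intro sum_mono2) auto
    finally show "(\<Sum>l<k. \<phi> (k - 1 - l) * (u l - v l)) \<le> b * \<Delta>"
      by (simp add: \<Delta>_def sum_distrib_left)
  qed
  also have "\<dots> \<le> b * (I * \<Delta>)"
  proof -
    have "b * (real n * \<Delta>) \<le> b * (I * \<Delta>)"
      using nI \<open>\<Delta> \<ge> 0\<close> b by (intro mult_left_mono mult_right_mono)
    then show ?thesis by (simp add: mult_ac)
  qed
  finally have B: "(\<Sum>k<n. \<Sum>l<k. \<phi> (k - 1 - l) * (u l - v l)) \<le> b * (I * \<Delta>)" .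
  have "u k - v k = ((v k)\<^sup>2 - 1) + (\<Sum>l<k. \<phi> (k - 1 - l) * (u l - v l))" for k
    using u_eq[of k] v_eq[of k] by (simp add: algebra_simps sum_subtractf)
  then have "\<Delta> = (\<Sum>k<n. (v k)\<^sup>2 - 1) + (\<Sum>k<n. \<Sum>l<k. \<phi> (k - 1 - l) * (u l - v l))"
    unfolding \<Delta>_def sum.distrib[symmetric] by (intro sum.cong refl)
  also have "\<dots> \<le> b * I\<^sup>2 + b * (I * \<Delta>)" using A B by simp
  also have "\<dots> = b * I * (\<Sum>k<n. u k)"
    by (simp add: \<Delta>_def I_def sum_subtractf power2_eq_square algebra_simps)
  finally show ?thesis by (simp add: \<Delta>_def I_def sum_subtractf)
qed simp

text \<open>Transposition: the backward solution \<open>U (n - 1 - i)\<close> is the adjoint of the forward recursion.\<close>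

lemma volterra_duality:
  fixes x :: "nat \<Rightarrow> real"
  assumes \<phi>: "\<And>i. i < n \<Longrightarrow> 0 \<le> \<phi> i" and a: "\<And>i. i < n \<Longrightarrow> 0 \<le> a i"
    and x: "\<And>i. i < n \<Longrightarrow> x i \<le> m + (\<Sum>j<i. \<phi> (i - 1 - j) * x j)"
  shows "(\<Sum>i<n. a (n - 1 - i) * x i) \<le> m * (\<Sum>k<n. volterra \<phi> a k)"
proof -
  define U where "U i = volterra \<phi> a (n - 1 - i)" for i
  have U0: "0 \<le> U i" if "i < n" for i
  proof -
    have "n - 1 - i < n" using that by simp
    then show ?thesis
      using volterra_ge[of n \<phi> a "n - 1 - i", OF \<phi> a] a[of "n - 1 - i"] unfolding U_def by linarith
  qed
  have U: "a (n - 1 - i) = U i - (\<Sum>l=Suc i..<n. \<phi> (l - 1 - i) * U l)" if "i < n" for i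
  proof -
    have "(\<Sum>l<n - 1 - i. \<phi> (n - 1 - i - 1 - l) * volterra \<phi> a l) = (\<Sum>l=Suc i..<n. \<phi> (l - 1 - i) * U l)"
      by (rule sum.reindex_bij_witness[of _ "\<lambda>l. n - 1 - l" "\<lambda>l. n - 1 - l"])
        (use that in \<open>auto simp: U_def intro!: arg_cong[of _ _ \<phi>]\<close>)
    then show ?thesis unfolding U_def by (subst volterra.simps) simp
  qed
  have "(\<Sum>i<n. a (n - 1 - i) * x i) = (\<Sum>i<n. U i * x i) - (\<Sum>i<n. \<Sum>l=Suc i..<n. \<phi> (l - 1 - i) * U l * x i)"
    unfolding sum_subtractf[symmetric]
  proof (rule sum.cong)
    fix i assume "i \<in> {..<n}"
    then have "a (n - 1 - i) * x i = (U i - (\<Sum>l=Suc i..<n. \<phi> (l - 1 - i) * U l)) * x i"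
      using U by simp
    then show "a (n - 1 - i) * x i = U i * x i - (\<Sum>l=Suc i..<n. \<phi> (l - 1 - i) * U l * x i)"
      by (simp only: left_diff_distrib sum_distrib_right)
  qed simp
  also have "\<dots> = (\<Sum>i<n. U i * x i) - (\<Sum>l<n. \<Sum>i<l. \<phi> (l - 1 - i) * U l * x i)"
    by (subst sum_less_swap) simp
  also have "\<dots> = (\<Sum>i<n. U i * (x i - (\<Sum>j<i. \<phi> (i - 1 - j) * x j)))"
    by (simp add: sum_subtractf[symmetric] algebra_simps sum_distrib_left)
  also have "\<dots> \<le> (\<Sum>i<n. U i * m)"
    using U0 x by (intro sum_mono mult_left_mono) (auto simp: algebra_simps)
  also have "\<dots> = m * (\<Sum>i<n. U i)" by (simp add: sum_distrib_left mult.commute)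
  also have "(\<Sum>i<n. U i) = (\<Sum>k<n. volterra \<phi> a k)"
    unfolding U_def using sum.nat_diff_reindex[of "volterra \<phi> a" n] by simp
  finally show ?thesis .
qed

section \<open>Moments of a discretised self-exciting counter\<close>

text \<open>The increments \<open>D i\<close> are dominated, off a rare event \<open>B i\<close>, by the indicator of an event \<open>P i\<close>
  whose conditional probability given the past is at most \<open>l i\<close>.\<close>

locale discrete_hawkes = prob_space M for M :: "'a measure" +
  fixes n :: nat and K m r Lmax :: real and \<phi> :: "nat \<Rightarrow> real" and F :: "nat \<Rightarrow> 'a measure"
    and D :: "nat \<Rightarrow> 'a \<Rightarrow> real" and P B :: "nat \<Rightarrow> 'a set"
  assumes subalg: "\<And>i. i \<le> n \<Longrightarrow> subalgebra M (F i)"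
    and D_meas: "\<And>i j. j < i \<Longrightarrow> i \<le> n \<Longrightarrow> D j \<in> borel_measurable (F i)"
    and D_nonneg: "\<And>i \<omega>. 0 \<le> D i \<omega>" and D_le: "\<And>i \<omega>. D i \<omega> \<le> K"
    and K1: "1 \<le> K" and m0: "0 \<le> m" and r0: "0 \<le> r"
    and \<phi>_nonneg: "\<And>i. i < n \<Longrightarrow> 0 \<le> \<phi> i"
    and \<phi>_le: "\<And>i. i < n \<Longrightarrow> \<phi> i \<le> \<phi> 0"
    and PB: "\<And>i. i < n \<Longrightarrow> P i \<in> events" "\<And>i. i < n \<Longrightarrow> B i \<in> events"
    and total: "AE \<omega> in M. \<forall>i\<le>n. (\<Sum>j<i. D j \<omega>) \<le> K"
    and step: "AE \<omega> in M. \<forall>i<n. \<omega> \<notin> B i \<longrightarrow>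
       D i \<omega> = 0 \<or> D i \<omega> = 1 \<and> \<omega> \<in> P i \<and> (\<Sum>j<i. D j \<omega>) < K"
    and P_le: "\<And>i W b. i < n \<Longrightarrow> W \<in> borel_measurable (F i) \<Longrightarrow> (\<And>\<omega>. 0 \<le> W \<omega>) \<Longrightarrow> (\<And>\<omega>. W \<omega> \<le> b) \<Longrightarrow>
       (\<integral>\<omega>. W \<omega> * indicator (P i) \<omega> \<partial>M) \<le> (\<integral>\<omega>. W \<omega> * (m + (\<Sum>j<i. \<phi> (i - 1 - j) * D j \<omega>)) \<partial>M)"
    and B_le: "\<And>i. i < n \<Longrightarrow> prob (B i) \<le> r"
    and l_le: "AE \<omega> in M. \<forall>i<n. m + (\<Sum>j<i. \<phi> (i - 1 - j) * D j \<omega>) \<le> Lmax"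
begin

definition l :: "nat \<Rightarrow> 'a \<Rightarrow> real" where
  "l i \<omega> = m + (\<Sum>j<i. \<phi> (i - 1 - j) * D j \<omega>)"

definition G :: "nat \<Rightarrow> 'a \<Rightarrow> real" where
  "G i \<omega> = (\<Sum>j<i. D j \<omega>)"

text \<open>\<open>v\<close> and \<open>u\<close> are the discrete analogues of \<Psi>1 and \<Psi>2,
  both driven by the upper kernel.\<close>

definition v :: "nat \<Rightarrow> real" where
  "v = volterra \<phi> (\<lambda>_. 1)"

definition u :: "nat \<Rightarrow> real" where
  "u = volterra \<phi> (\<lambda>k. (v k)\<^sup>2)"

text \<open>Time reversal of \<open>v\<close>: the recursion \<open>V_eq\<close> identifies
  \<open>V i\<close> as the mean size, up to the horizon, of the cluster started by one jump in cell
  \<open>i\<close>, that jump included.\<close>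

definition V :: "nat \<Rightarrow> real" where
  "V i = v (n - 1 - i)"

text \<open>\<open>Z i\<close> plays the role of the conditional expectation of \<open>G n\<close> given the past of \<open>i\<close>.\<close>

definition Z :: "nat \<Rightarrow> 'a \<Rightarrow> real" where
  "Z i \<omega> = m * (\<Sum>k=i..<n. V k) + (\<Sum>j<i. D j \<omega> * (1 + (\<Sum>k=i..<n. \<phi> (k - 1 - j) * V k)))"

lemma v_ge_1: "k < n \<Longrightarrow> 1 \<le> v k"
  unfolding v_def using volterra_ge[of n \<phi> "\<lambda>_. 1" k] \<phi>_nonneg by simp

lemma V_ge_1: "i < n \<Longrightarrow> 1 \<le> V i"
  unfolding V_def by (intro v_ge_1) auto

lemma V_nonneg: "i < n \<Longrightarrow> 0 \<le> V i"
  using V_ge_1[of i] by simp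

lemma V_eq: "i < n \<Longrightarrow> V i = 1 + (\<Sum>k=Suc i..<n. \<phi> (k - 1 - i) * V k)"
proof -
  assume i: "i < n"
  have "(\<Sum>k<n - 1 - i. \<phi> (n - 1 - i - 1 - k) * volterra \<phi> (\<lambda>_. 1) k) = (\<Sum>k=Suc i..<n. \<phi> (k - 1 - i) * V k)"
    by (rule sum.reindex_bij_witness[of _ "\<lambda>l. n - 1 - l" "\<lambda>l. n - 1 - l"])
      (use i in \<open>auto simp: V_def v_def intro!: arg_cong[of _ _ \<phi>]\<close>)
  then show ?thesis unfolding V_def v_def by (subst volterra.simps) simp
qed

text \<open>The coefficient of \<open>D j\<close> in \<open>Z i\<close> is the expansion of
  \<open>V j\<close> from \<open>V_eq\<close> with only the terms \<open>k \<ge> i\<close> kept: the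
  jump itself and the clusters of those of its children that are still to come.\<close>

lemma coeff_bounds:
  assumes "j < i" "i \<le> n"
  shows "1 \<le> 1 + (\<Sum>k=i..<n. \<phi> (k - 1 - j) * V k)" "1 + (\<Sum>k=i..<n. \<phi> (k - 1 - j) * V k) \<le> V j"
proof -
  have nn: "0 \<le> \<phi> (k - 1 - j) * V k" if "k < n" for k
    using that \<phi>_nonneg V_nonneg by (intro mult_nonneg_nonneg) auto
  then have "0 \<le> (\<Sum>k=i..<n. \<phi> (k - 1 - j) * V k)" by (intro sum_nonneg) simp
  then show "1 \<le> 1 + (\<Sum>k=i..<n. \<phi> (k - 1 - j) * V k)" by linarith
  show "1 + (\<Sum>k=i..<n. \<phi> (k - 1 - j) * V k) \<le> V j"
  proof -
    have "(\<Sum>k=i..<n. \<phi> (k - 1 - j) * V k) \<le> (\<Sum>k=Suc j..<n. \<phi> (k - 1 - j) * V k)"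
      using assms by (intro sum_mono2 nn) auto
    then show ?thesis using V_eq[of j] assms by linarith
  qed
qed

lemma l_nonneg: "i < n \<Longrightarrow> 0 \<le> l i \<omega>"
  unfolding l_def
  by (rule add_nonneg_nonneg[OF m0], rule sum_nonneg, rule mult_nonneg_nonneg[OF \<phi>_nonneg D_nonneg]) simp

lemma Z_nonneg: "i \<le> n \<Longrightarrow> 0 \<le> Z i \<omega>"
proof -
  assume i: "i \<le> n"
  have "0 \<le> m * (\<Sum>k=i..<n. V k)"
    by (rule mult_nonneg_nonneg[OF m0], rule sum_nonneg, rule V_nonneg) simp
  moreover have "0 \<le> (\<Sum>j<i. D j \<omega> * (1 + (\<Sum>k=i..<n. \<phi> (k - 1 - j) * V k)))"
  proof (rule sum_nonneg, rule mult_nonneg_nonneg[OF D_nonneg])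
    fix j assume "j \<in> {..<i}"
    then show "0 \<le> 1 + (\<Sum>k=i..<n. \<phi> (k - 1 - j) * V k)"
      using coeff_bounds(1)[OF _ i, of j] by (intro order.trans[OF zero_le_one]) simp
  qed
  ultimately show ?thesis unfolding Z_def by (rule add_nonneg_nonneg)
qed

lemma G_le_Z: "i \<le> n \<Longrightarrow> G i \<omega> \<le> Z i \<omega>"
proof -
  assume i: "i \<le> n"
  have "G i \<omega> \<le> (\<Sum>j<i. D j \<omega> * (1 + (\<Sum>k=i..<n. \<phi> (k - 1 - j) * V k)))"
    unfolding G_def
  proof (rule sum_mono)
    fix j assume "j \<in> {..<i}"
    then have "D j \<omega> * 1 \<le> D j \<omega> * (1 + (\<Sum>k=i..<n. \<phi> (k - 1 - j) * V k))"
      using i by (intro mult_left_mono D_nonneg coeff_bounds(1)) auto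
    then show "D j \<omega> \<le> D j \<omega> * (1 + (\<Sum>k=i..<n. \<phi> (k - 1 - j) * V k))" by simp
  qed
  moreover have "0 \<le> m * (\<Sum>k=i..<n. V k)"
    using m0 V_nonneg by (intro mult_nonneg_nonneg sum_nonneg) auto
  ultimately show ?thesis unfolding Z_def by linarith
qed

lemma Z_n: "Z n \<omega> = G n \<omega>"
  unfolding Z_def G_def by simp

lemma Z_0: "Z 0 \<omega> = m * (\<Sum>k<n. v k)"
proof -
  have "(\<Sum>k<n. V k) = (\<Sum>k<n. v k)"
    using sum.nat_diff_reindex[of v n] by (simp add: V_def)
  then show ?thesis unfolding Z_def by (simp add: atLeast0LessThan)
qed

text \<open>The martingale increment is \<open>V i\<close> times the compensated jump. Passing to
  \<open>Suc i\<close> removes the summand \<open>k = i\<close> everywhere, in total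
  \<open>V i * l i\<close>, and adds \<open>D i\<close> with a coefficient that \<open>V_eq\<close>
  collapses to \<open>V i\<close>.\<close>

lemma Z_Suc:
  assumes i: "i < n"
  shows "Z (Suc i) \<omega> = Z i \<omega> + V i * (D i \<omega> - l i \<omega>)"
proof -
  have split: "{i..<n} = insert i {Suc i..<n}" using i by auto
  have "Z i \<omega> = m * (V i + (\<Sum>k=Suc i..<n. V k)) +
    (\<Sum>j<i. D j \<omega> * (1 + (\<phi> (i - 1 - j) * V i + (\<Sum>k=Suc i..<n. \<phi> (k - 1 - j) * V k))))"
    unfolding Z_def split by simp
  also have "\<dots> = m * (\<Sum>k=Suc i..<n. V k) + (\<Sum>j<i. D j \<omega> * (1 + (\<Sum>k=Suc i..<n. \<phi> (k - 1 - j) * V k)))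
     + V i * l i \<omega>"
    unfolding l_def by (simp add: algebra_simps sum.distrib sum_distrib_left)
  finally show ?thesis
    unfolding Z_def using V_eq[OF i] by (simp add: algebra_simps del: diff_diff_left)
qed

text \<open>In the application \<open>n * \<phi> 0 = T * \<Phi> 0\<close> and
  \<open>n * m = \<mu> * T\<close>, so \<open>Vmax\<close> and the bound \<open>Zmax\<close> built
  from it do not depend on the number of cells.\<close>

definition Vmax :: real where
  "Vmax = exp (real n * \<phi> 0)"

lemma V_le: "i < n \<Longrightarrow> V i \<le> Vmax"
  unfolding V_def v_def Vmax_def
  using volterra_le_exp[of n \<phi> "\<phi> 0" "\<lambda>_. 1" 1 "n - 1 - i"] \<phi>_nonneg \<phi>_le by simp

lemma Vmax_ge_1: "1 \<le> Vmax"
  unfolding Vmax_def using \<phi>_nonneg[of 0] by (cases n) auto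

definition Zmax :: real where
  "Zmax = m * (real n * Vmax) + K * Vmax"

lemma Z_le: "AE \<omega> in M. \<forall>i\<le>n. Z i \<omega> \<le> Zmax"
  using total
proof eventually_elim
  case (elim \<omega>)
  show ?case
  proof (intro allI impI)
    fix i assume i: "i \<le> n"
    have "(\<Sum>k=i..<n. V k) \<le> (\<Sum>k=i..<n. Vmax)" using V_le by (intro sum_mono) auto
    also have "\<dots> \<le> real n * Vmax" using Vmax_ge_1 by (simp add: mult_right_mono)
    finally have 1: "m * (\<Sum>k=i..<n. V k) \<le> m * (real n * Vmax)" using m0 by (rule mult_left_mono)
    have "(\<Sum>j<i. D j \<omega> * (1 + (\<Sum>k=i..<n. \<phi> (k - 1 - j) * V k))) \<le> (\<Sum>j<i. D j \<omega> * Vmax)"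
    proof (intro sum_mono mult_left_mono D_nonneg)
      fix j assume "j \<in> {..<i}"
      then show "1 + (\<Sum>k=i..<n. \<phi> (k - 1 - j) * V k) \<le> Vmax"
        using coeff_bounds(2)[of j i] V_le[of j] i by simp
    qed
    also have "\<dots> = (\<Sum>j<i. D j \<omega>) * Vmax" by (simp add: sum_distrib_right)
    also have "\<dots> \<le> K * Vmax" using elim i Vmax_ge_1 by (intro mult_right_mono) auto
    finally show "Z i \<omega> \<le> Zmax" unfolding Zmax_def Z_def using 1 by linarith
  qed
qed

text \<open>A companion of \<open>Z_le\<close>: a cruder bound, but valid at every sample point, as
  \<open>P_le\<close> demands of its test functions.\<close>

lemma Z_bdd: assumes "i \<le> n" shows "\<exists>b. \<forall>\<omega>. Z i \<omega> \<le> b"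
proof -
  have "Z i \<omega> \<le> m * (\<Sum>k=i..<n. V k) + (\<Sum>j<i. K * (1 + (\<Sum>k=i..<n. \<phi> (k - 1 - j) * V k)))" for \<omega>
    unfolding Z_def using coeff_bounds(1)[OF _ assms] D_le
    by (intro add_left_mono sum_mono mult_right_mono) (auto intro: order.trans[of 0 1])
  then show ?thesis by blast
qed

lemma l_bdd: assumes "i < n" shows "\<exists>b. \<forall>\<omega>. l i \<omega> \<le> b"
proof -
  have "l i \<omega> \<le> m + (\<Sum>j<i. \<phi> (i - 1 - j) * K)" for \<omega>
    unfolding l_def using D_le \<phi>_nonneg assms by (intro add_left_mono sum_mono mult_left_mono) auto
  then show ?thesis by blast
qed

lemma l_meas_F: "i \<le> n \<Longrightarrow> l i \<in> borel_measurable (F i)"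
  unfolding l_def by (intro borel_measurable_add borel_measurable_sum borel_measurable_times) (auto intro: D_meas)

lemma G_meas_F: "i \<le> n \<Longrightarrow> G i \<in> borel_measurable (F i)"
  unfolding G_def by (intro borel_measurable_sum) (auto intro: D_meas)

lemma Z_meas_F: "i \<le> n \<Longrightarrow> Z i \<in> borel_measurable (F i)"
  unfolding Z_def by (intro borel_measurable_add borel_measurable_sum borel_measurable_times) (auto intro: D_meas)

lemma D_measM: "i < n \<Longrightarrow> D i \<in> borel_measurable M"
  using measurable_from_subalg[OF subalg D_meas, of n i] by simp

lemma l_measM: "i \<le> n \<Longrightarrow> l i \<in> borel_measurable M"
  using measurable_from_subalg[OF subalg l_meas_F] by simp

lemma G_measM: "i \<le> n \<Longrightarrow> G i \<in> borel_measurable M"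
  using measurable_from_subalg[OF subalg G_meas_F] by simp

lemma Z_measM: "i \<le> n \<Longrightarrow> Z i \<in> borel_measurable M"
  using measurable_from_subalg[OF subalg Z_meas_F] by simp

lemma integrable_D: "i < n \<Longrightarrow> integrable M (D i)"
  using D_nonneg D_le by (intro integrable_const_bound[of _ K] D_measM) auto

lemma integrable_l: "i < n \<Longrightarrow> integrable M (l i)"
proof -
  assume i: "i < n"
  obtain b where "\<And>\<omega>. l i \<omega> \<le> b" using l_bdd[OF i] by blast
  then show ?thesis using l_nonneg[OF i] i by (intro integrable_const_bound[of _ b] l_measM) auto
qed

lemma integrable_indicator_event: "A \<in> events \<Longrightarrow> integrable M (indicator A :: 'a \<Rightarrow> real)"
  by (simp add: less_top[symmetric])

lemma expectation_D_le: "i < n \<Longrightarrow> expectation (D i) \<le> expectation (l i) + K * r"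
proof -
  assume i: "i < n"
  have "expectation (D i) \<le> expectation (\<lambda>\<omega>. 1 * indicator (P i) \<omega> + K * indicator (B i) \<omega>)"
  proof (rule integral_mono_AE)
    show "AE \<omega> in M. D i \<omega> \<le> 1 * indicator (P i) \<omega> + K * indicator (B i) \<omega>"
      using step
    proof eventually_elim
      case (elim \<omega>)
      then show ?case using D_le[of i \<omega>] K1 i by (auto split: split_indicator)
    qed
  qed (use i PB integrable_D integrable_indicator_event in \<open>auto intro!: Bochner_Integration.integrable_add integrable_mult_right\<close>)
  also have "\<dots> = expectation (\<lambda>\<omega>. 1 * indicator (P i) \<omega>) + K * prob (B i)"
    using i PB integrable_indicator_event by (subst Bochner_Integration.integral_add) auto
  also have "expectation (\<lambda>\<omega>. 1 * indicator (P i) \<omega>) \<le> expectation (l i)"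
    using P_le[OF i, of "\<lambda>_. 1" 1] by (simp add: l_def[abs_def])
  also have "K * prob (B i) \<le> K * r" using B_le[OF i] K1 by (intro mult_left_mono) auto
  finally show ?thesis by simp
qed

text \<open>A forward Volterra inequality for the mean intensities; each of the at most
  \<open>n\<close> earlier cells adds an error \<open>\<phi> 0 * (K * r)\<close> from its rare
  event.\<close>

lemma expectation_l_le:
  "i < n \<Longrightarrow> expectation (l i) \<le> (m + real n * (\<phi> 0 * (K * r))) + (\<Sum>j<i. \<phi> (i - 1 - j) * expectation (l j))"
proof -
  assume i: "i < n"
  have "expectation (l i) = m + (\<Sum>j<i. \<phi> (i - 1 - j) * expectation (D j))"
    unfolding l_def using i integrable_D
    by (subst Bochner_Integration.integral_add) (auto simp: prob_space)
  also have "\<dots> \<le> m + (\<Sum>j<i. \<phi> (i - 1 - j) * (expectation (l j) + K * r))"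
    using i \<phi>_nonneg expectation_D_le by (intro add_left_mono sum_mono mult_left_mono) auto
  also have "\<dots> = m + (\<Sum>j<i. \<phi> (i - 1 - j) * (K * r)) + (\<Sum>j<i. \<phi> (i - 1 - j) * expectation (l j))"
    by (simp add: algebra_simps sum.distrib)
  also have "(\<Sum>j<i. \<phi> (i - 1 - j) * (K * r)) \<le> (\<Sum>j<i. \<phi> 0 * (K * r))"
    using i \<phi>_le K1 r0 by (intro sum_mono mult_right_mono) auto
  also have "\<dots> \<le> real n * (\<phi> 0 * (K * r))"
    using i K1 r0 \<phi>_nonneg[of 0] by (auto intro!: mult_right_mono)
  finally show ?thesis by simp
qed

lemma expectation_G_le:
  "expectation (G n) \<le> (m + real n * (\<phi> 0 * (K * r))) * (\<Sum>k<n. v k) + real n * (K * r)"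
proof -
  have "expectation (G n) = (\<Sum>i<n. expectation (D i))"
    unfolding G_def using integrable_D by (subst Bochner_Integration.integral_sum) auto
  also have "\<dots> \<le> (\<Sum>i<n. 1 * expectation (l i)) + real n * (K * r)"
    using sum_mono[of "{..<n}" "\<lambda>i. expectation (D i)" "\<lambda>i. expectation (l i) + K * r"] expectation_D_le
    by (simp add: sum.distrib)
  \<comment> \<open>Duality with unit weights replaces solving the forward inequality; the explicit
    factor 1 is that weight.\<close>
  also have "(\<Sum>i<n. 1 * expectation (l i)) \<le> (m + real n * (\<phi> 0 * (K * r))) * (\<Sum>k<n. v k)"
    unfolding v_def using volterra_duality[of n \<phi> "\<lambda>_. 1" "\<lambda>i. expectation (l i)"] \<phi>_nonneg expectation_l_le
    by simp
  finally show ?thesis by simp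
qed

text \<open>Error of one cell in the second moment: the first summand comes from the rare event, the
  second from the squared compensator. In the application \<open>r\<close> and the square of
  \<open>Lmax\<close> both equal \<open>(d * C)^2\<close>, so \<open>n * R\<close> tends to 0 with
  \<open>d\<close>.\<close>

definition R :: real where
  "R = (2 * Zmax + Vmax) * (Vmax * K\<^sup>2) * r + Vmax\<^sup>2 * Lmax\<^sup>2"

lemma Zmax_nonneg: "0 \<le> Zmax"
  unfolding Zmax_def using m0 Vmax_ge_1 K1 by simp

text \<open>Using \<open>Z^2 - Z\<close> instead of \<open>Z^2\<close> makes the final value, where
  \<open>Z n = G n\<close> is the count, a factorial moment. The terms linear in the compensated
  jump balance in mean and leave the conditional variance. Since the jump probability is only
  bounded from above, all terms containing the jump are first collected in one nonnegative
  weight.\<close>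

lemma square_step:
  assumes i: "i < n"
  shows "expectation (\<lambda>\<omega>. (Z (Suc i) \<omega>)\<^sup>2 - Z (Suc i) \<omega>)
    \<le> expectation (\<lambda>\<omega>. (Z i \<omega>)\<^sup>2 - Z i \<omega>) + (V i)\<^sup>2 * expectation (l i) + R"
proof -
  \<comment> \<open>For a jump of size 0 or 1 the terms of the increment containing it add up to
    \<open>(2 * Z i - 1 + V i) * V i * D i\<close>. The weight is nonnegative because
    \<open>V i \<ge> 1\<close> offsets the \<open>- 1\<close>; the case distinction records that a
    jump off \<open>B i\<close> happens only below level \<open>K\<close>.\<close>
  define W where "W \<omega> = (2 * Z i \<omega> - 1 + V i) * V i * (if G i \<omega> < K then 1 else 0)" for \<omega>
  \<comment> \<open>Bound for the same terms on the rare event, where only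
    \<open>D i \<le> K\<close> is known; since \<open>K \<le> K * K\<close>, both terms can share
    the factor \<open>K\<^sup>2\<close>.\<close>
  define c where "c = (2 * Zmax + Vmax) * (Vmax * K\<^sup>2)"
  obtain bZ where bZ: "\<And>\<omega>. Z i \<omega> \<le> bZ" using Z_bdd[of i] i by auto
  obtain bZ' where bZ': "\<And>\<omega>. Z (Suc i) \<omega> \<le> bZ'" using Z_bdd[of "Suc i"] i by auto
  obtain bl where bl: "\<And>\<omega>. l i \<omega> \<le> bl" using l_bdd[OF i] by auto
  have Z0: "0 \<le> Z i \<omega>" "0 \<le> Z (Suc i) \<omega>" for \<omega> using Z_nonneg i by auto
  have V1: "1 \<le> V i" "V i \<le> Vmax" using V_ge_1 V_le i by auto
  have W0: "0 \<le> W \<omega>" for \<omega> unfolding W_def using Z0[of \<omega>] V1 by auto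
  have Wb: "W \<omega> \<le> (2 * bZ + V i) * V i" for \<omega>
  proof -
    have "(2 * Z i \<omega> - 1 + V i) * V i \<le> (2 * bZ + V i) * V i"
      using bZ[of \<omega>] V1 by (intro mult_right_mono) auto
    moreover have "0 \<le> (2 * bZ + V i) * V i" using bZ[of \<omega>] Z0[of \<omega>] V1 by auto
    ultimately show ?thesis unfolding W_def by auto
  qed
  have Wm: "W \<in> borel_measurable (F i)"
    unfolding W_def using Z_meas_F[of i] G_meas_F[of i] i by (intro measurable_If borel_measurable_times borel_measurable_add borel_measurable_diff) (auto intro!: measurable_If)
  have WmM: "W \<in> borel_measurable M" using measurable_from_subalg[OF subalg Wm] i by simp
  note [measurable] = WmM PB(1)[OF i] PB(2)[OF i] l_measM[of i, OF less_imp_le[OF i]]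
    Z_measM[of i, OF less_imp_le[OF i]] Z_measM[of "Suc i", OF Suc_leI[OF i]]
  have Zi: "integrable M (\<lambda>\<omega>. (Z i \<omega>)\<^sup>2 - Z i \<omega>)"
    using bZ Z0 by (intro Bochner_Integration.integrable_diff integrable_const_bound[of _ "bZ\<^sup>2"] integrable_const_bound[of _ bZ]) (auto intro!: power_mono AE_I2)
  have Zsi: "integrable M (\<lambda>\<omega>. (Z (Suc i) \<omega>)\<^sup>2 - Z (Suc i) \<omega>)"
    using bZ' Z0 by (intro Bochner_Integration.integrable_diff integrable_const_bound[of _ "bZ'\<^sup>2"] integrable_const_bound[of _ bZ']) (auto intro!: power_mono AE_I2)
  have WPi: "integrable M (\<lambda>\<omega>. W \<omega> * indicator (P i) \<omega>)"
    using W0 Wb by (intro integrable_const_bound[of _ "(2 * bZ + V i) * V i"]) (auto split: split_indicator intro: order.trans[OF W0 Wb])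
  have Bi: "integrable M (\<lambda>\<omega>. c * indicator (B i) \<omega>)"
    using integrable_indicator_event PB i by simp
  have Wli: "integrable M (\<lambda>\<omega>. W \<omega> * l i \<omega>)"
    using W0 Wb l_nonneg[OF i] bl
    by (intro integrable_const_bound[of _ "(2 * bZ + V i) * V i * bl"])
       (auto intro!: AE_I2 mult_mono simp: abs_mult intro: order.trans[OF W0 Wb])
  have Zli: "integrable M (\<lambda>\<omega>. (2 * Z i \<omega> - 1) * V i * l i \<omega>)"
  proof (rule integrable_const_bound[of _ "(2 * bZ + 1) * V i * bl"])
    show "AE \<omega> in M. norm ((2 * Z i \<omega> - 1) * V i * l i \<omega>) \<le> (2 * bZ + 1) * V i * bl"
    proof (rule AE_I2)
      fix \<omega>
      have "\<bar>2 * Z i \<omega> - 1\<bar> \<le> 2 * bZ + 1" using Z0[of \<omega>] bZ[of \<omega>] by auto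
      then show "norm ((2 * Z i \<omega> - 1) * V i * l i \<omega>) \<le> (2 * bZ + 1) * V i * bl"
        using V1 l_nonneg[OF i, of \<omega>] bl[of \<omega>] by (auto simp: abs_mult intro!: mult_mono)
    qed
  qed measurable
  have key: "AE \<omega> in M. ((Z (Suc i) \<omega>)\<^sup>2 - Z (Suc i) \<omega>) - ((Z i \<omega>)\<^sup>2 - Z i \<omega>)
      \<le> W \<omega> * indicator (P i) \<omega> + c * indicator (B i) \<omega> - (2 * Z i \<omega> - 1) * V i * l i \<omega> + Vmax\<^sup>2 * Lmax\<^sup>2"
    using step Z_le l_le
  proof eventually_elim
    case (elim \<omega>)
    have Dn: "0 \<le> D i \<omega>" "D i \<omega> \<le> K" by (rule D_nonneg, rule D_le)
    have ll: "0 \<le> l i \<omega>" "l i \<omega> \<le> Lmax" using l_nonneg[OF i] elim(3) i by (auto simp: l_def)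
    have Zm: "Z i \<omega> \<le> Zmax" using elim(2) i by simp
    have "(V i)\<^sup>2 * (l i \<omega>)\<^sup>2 \<le> Vmax\<^sup>2 * Lmax\<^sup>2"
      using V1 ll by (intro mult_mono power_mono) auto
    moreover have "0 \<le> (V i)\<^sup>2 * (D i \<omega> * l i \<omega>)" using Dn ll by simp
    \<comment> \<open>Exact expansion. The mixed term in \<open>D i * l i\<close> has a negative
      sign and is discarded, while the square of \<open>l i\<close> goes into the constant.\<close>
    moreover have "((Z (Suc i) \<omega>)\<^sup>2 - Z (Suc i) \<omega>) - ((Z i \<omega>)\<^sup>2 - Z i \<omega>) =
       (2 * Z i \<omega> - 1) * V i * D i \<omega> + (V i)\<^sup>2 * (D i \<omega>)\<^sup>2 - (2 * Z i \<omega> - 1) * V i * l i \<omega>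
       - 2 * ((V i)\<^sup>2 * (D i \<omega> * l i \<omega>)) + (V i)\<^sup>2 * (l i \<omega>)\<^sup>2"
      unfolding Z_Suc[OF i] by (simp add: power2_eq_square algebra_simps)
    moreover have "(2 * Z i \<omega> - 1) * V i * D i \<omega> + (V i)\<^sup>2 * (D i \<omega>)\<^sup>2
        \<le> W \<omega> * indicator (P i) \<omega> + c * indicator (B i) \<omega>"
    proof (cases "\<omega> \<in> B i")
      case True
      have "K * 1 \<le> K * K" using K1 by (intro mult_left_mono) auto
      then have "D i \<omega> \<le> K * K" using Dn by linarith
      have "(2 * Z i \<omega> - 1) * V i * D i \<omega> \<le> (2 * Zmax) * Vmax * K\<^sup>2"
      proof -
        have "(2 * Z i \<omega> - 1) * (V i * D i \<omega>) \<le> (2 * Zmax) * (V i * D i \<omega>)"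
          using Zm V1 Dn by (intro mult_right_mono) auto
        also have "\<dots> \<le> (2 * Zmax) * (Vmax * K\<^sup>2)"
          using Zmax_nonneg V1 Dn \<open>D i \<omega> \<le> K * K\<close> by (intro mult_left_mono mult_mono) (auto simp: power2_eq_square)
        finally show ?thesis by (simp add: mult_ac)
      qed
      moreover have "(V i)\<^sup>2 * (D i \<omega>)\<^sup>2 \<le> Vmax\<^sup>2 * K\<^sup>2"
        using V1 Dn by (intro mult_mono power_mono) auto
      moreover have "0 \<le> W \<omega> * indicator (P i) \<omega>" using W0 by simp
      moreover have "c = 2 * Zmax * Vmax * K\<^sup>2 + Vmax\<^sup>2 * K\<^sup>2"
        by (simp add: c_def power2_eq_square algebra_simps)
      ultimately show ?thesis using True by simp
    next
      case False
      then consider "D i \<omega> = 0" | "D i \<omega> = 1" "\<omega> \<in> P i" "G i \<omega> < K" using elim(1) i unfolding G_def by auto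
      then show ?thesis
      proof cases
        case 1
        then show ?thesis using W0[of \<omega>] False by simp
      next
        case 2
        then show ?thesis using False by (simp add: W_def power2_eq_square algebra_simps)
      qed
    qed
    ultimately show ?case by linarith
  qed
  have Wl: "AE \<omega> in M. W \<omega> * l i \<omega> - (2 * Z i \<omega> - 1) * V i * l i \<omega> \<le> (V i)\<^sup>2 * l i \<omega>"
  proof (rule AE_I2)
    fix \<omega>
    show "W \<omega> * l i \<omega> - (2 * Z i \<omega> - 1) * V i * l i \<omega> \<le> (V i)\<^sup>2 * l i \<omega>"
    proof (cases "G i \<omega> < K")
      case True
      then show ?thesis by (simp add: W_def power2_eq_square algebra_simps)
    next
      case False
      \<comment> \<open>At or above level \<open>K\<close> the weight vanishes and only
        \<open>- (2 * Z i - 1) * V i * l i\<close> is left, which has the right sign because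
        \<open>Z i \<ge> G i \<ge> K \<ge> 1\<close>.\<close>
      then have "1 \<le> Z i \<omega>" using G_le_Z[of i \<omega>] i K1 by simp
      then have "0 \<le> (2 * Z i \<omega> - 1) * V i * l i \<omega>" using V1 l_nonneg[OF i, of \<omega>] by simp
      moreover have "0 \<le> (V i)\<^sup>2 * l i \<omega>" using l_nonneg[OF i, of \<omega>] by simp
      ultimately show ?thesis using False by (simp add: W_def)
    qed
  qed
  have "expectation (\<lambda>\<omega>. (Z (Suc i) \<omega>)\<^sup>2 - Z (Suc i) \<omega>) - expectation (\<lambda>\<omega>. (Z i \<omega>)\<^sup>2 - Z i \<omega>)
     = expectation (\<lambda>\<omega>. ((Z (Suc i) \<omega>)\<^sup>2 - Z (Suc i) \<omega>) - ((Z i \<omega>)\<^sup>2 - Z i \<omega>))"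
    using Zi Zsi by (subst Bochner_Integration.integral_diff) auto
  also have "\<dots> \<le> expectation (\<lambda>\<omega>. W \<omega> * indicator (P i) \<omega> + c * indicator (B i) \<omega> - (2 * Z i \<omega> - 1) * V i * l i \<omega> + Vmax\<^sup>2 * Lmax\<^sup>2)"
    using key Zi Zsi WPi Bi Zli
    by (intro integral_mono_AE) (auto intro!: Bochner_Integration.integrable_add Bochner_Integration.integrable_diff)
  also have "\<dots> = expectation (\<lambda>\<omega>. W \<omega> * indicator (P i) \<omega>) + c * prob (B i) - expectation (\<lambda>\<omega>. (2 * Z i \<omega> - 1) * V i * l i \<omega>) + Vmax\<^sup>2 * Lmax\<^sup>2"
    using WPi Bi Zli
    by (simp add: Bochner_Integration.integral_add Bochner_Integration.integral_diff Bochner_Integration.integrable_add Bochner_Integration.integrable_diff prob_space)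
  also have "\<dots> \<le> expectation (\<lambda>\<omega>. W \<omega> * l i \<omega>) + c * r - expectation (\<lambda>\<omega>. (2 * Z i \<omega> - 1) * V i * l i \<omega>) + Vmax\<^sup>2 * Lmax\<^sup>2"
  proof -
    have "c * prob (B i) \<le> c * r"
      using B_le[OF i] Zmax_nonneg Vmax_ge_1 by (intro mult_left_mono) (auto simp: c_def)
    then show ?thesis using P_le[OF i Wm W0 Wb] by (simp add: l_def)
  qed
  also have "expectation (\<lambda>\<omega>. W \<omega> * l i \<omega>) - expectation (\<lambda>\<omega>. (2 * Z i \<omega> - 1) * V i * l i \<omega>)
      = expectation (\<lambda>\<omega>. W \<omega> * l i \<omega> - (2 * Z i \<omega> - 1) * V i * l i \<omega>)"
    using Wli Zli by simp
  then have "expectation (\<lambda>\<omega>. W \<omega> * l i \<omega>) + c * r - expectation (\<lambda>\<omega>. (2 * Z i \<omega> - 1) * V i * l i \<omega>) + Vmax\<^sup>2 * Lmax\<^sup>2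
      = expectation (\<lambda>\<omega>. W \<omega> * l i \<omega> - (2 * Z i \<omega> - 1) * V i * l i \<omega>) + R"
    by (simp add: R_def c_def)
  also have "expectation (\<lambda>\<omega>. W \<omega> * l i \<omega> - (2 * Z i \<omega> - 1) * V i * l i \<omega>) \<le> expectation (\<lambda>\<omega>. (V i)\<^sup>2 * l i \<omega>)"
    using Wl Wli Zli integrable_l[OF i] by (intro integral_mono_AE) auto
  finally show ?thesis by simp
qed

text \<open>With \<open>S\<close> the sum of \<open>v\<close>, the constant \<open>Z 0\<close>
  contributes \<open>(m * S)^2 - m * S\<close>, and summation of \<open>square_step\<close> leads to
  \<open>Z n = G n\<close>. Duality turns the conditional variances into \<open>m\<close> times the
  sum of \<open>u\<close>; together with the \<open>- m * S\<close> from the start this is the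
  difference that \<open>volterra_sum_diff_le\<close> controls.\<close>

lemma expectation_square_G_le:
  "expectation (\<lambda>\<omega>. (G n \<omega>)\<^sup>2 - G n \<omega>) \<le> (m * (\<Sum>k<n. v k))\<^sup>2
    + m * \<phi> 0 * (\<Sum>k<n. v k) * (\<Sum>k<n. u k)
    + real n * (\<phi> 0 * (K * r)) * (\<Sum>k<n. u k) + real n * R"
proof -
  let ?S = "\<Sum>k<n. v k" and ?U = "\<Sum>k<n. u k"
  have "i \<le> n \<Longrightarrow> expectation (\<lambda>\<omega>. (Z i \<omega>)\<^sup>2 - Z i \<omega>)
      \<le> (m * ?S)\<^sup>2 - m * ?S + (\<Sum>j<i. (V j)\<^sup>2 * expectation (l j)) + real i * R" for i
  proof (induction i)
    case 0
    then show ?case by (simp add: Z_0 prob_space)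
  next
    case (Suc i)
    then show ?case using square_step[of i] by (simp add: algebra_simps)
  qed
  from this[of n] have "expectation (\<lambda>\<omega>. (G n \<omega>)\<^sup>2 - G n \<omega>)
      \<le> (m * ?S)\<^sup>2 - m * ?S + (\<Sum>j<n. (V j)\<^sup>2 * expectation (l j)) + real n * R"
    by (simp add: Z_n)
  also have "(\<Sum>j<n. (V j)\<^sup>2 * expectation (l j)) \<le> (m + real n * (\<phi> 0 * (K * r))) * ?U"
    unfolding u_def V_def
    using volterra_duality[of n \<phi> "\<lambda>k. (v k)\<^sup>2" "\<lambda>i. expectation (l i)"] \<phi>_nonneg expectation_l_le
    by simp
  finally have 1: "expectation (\<lambda>\<omega>. (G n \<omega>)\<^sup>2 - G n \<omega>)
     \<le> (m * ?S)\<^sup>2 + m * (?U - ?S) + real n * (\<phi> 0 * (K * r)) * ?U + real n * R"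
    by (simp add: algebra_simps)
  have "m * (?U - ?S) \<le> m * (\<phi> 0 * ?S * ?U)"
    using volterra_sum_diff_le[of n \<phi> "\<phi> 0"] \<phi>_nonneg \<phi>_le m0
    unfolding u_def v_def by (intro mult_left_mono) auto
  then show ?thesis using 1 by (simp add: mult_ac)
qed

end

section \<open>Paths of the Hawkes process\<close>

text \<open>\<open>extend_measure\<close> falls back to the zero measure when no extension exists,
  so something can be said about an arbitrary \<open>F\<close>. This breaks a circle:
  right-continuity of a Hawkes path is derived from measurability of its intensity, which is itself
  an integral against the path measure.\<close>

lemma interval_measure_alternative:
  "(\<forall>a b. a \<le> b \<longrightarrow> emeasure (interval_measure F) {a<..b} = ennreal (F b - F a)) \<or>
   (\<forall>A. emeasure (interval_measure F) A = 0)"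
proof -
  let ?I = "{(a::real, b). a \<le> b}" and ?G = "\<lambda>(a::real, b). {a<..b}"
  let ?m = "\<lambda>(a, b). ennreal (F b - F a)"
  let ?Q = "\<lambda>\<mu>'. (\<forall>i\<in>?I. \<mu>' (?G i) = ?m i) \<and> measure_space UNIV (sigma_sets UNIV (?G ` ?I)) \<mu>'"
  show ?thesis
  proof (cases "(\<exists>\<mu>'. ?Q \<mu>') \<and> \<not> (\<forall>i\<in>?I. ?m i = 0)")
    case True
    then obtain \<mu>' where \<mu>': "?Q \<mu>'" by blast
    have sets: "sets (interval_measure F) = sigma_sets UNIV (?G ` ?I)"
      unfolding interval_measure_def by (rule sets_extend_measure) auto
    have pos: "positive (sets (interval_measure F)) \<mu>'" "countably_additive (sets (interval_measure F)) \<mu>'"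
      unfolding sets using \<mu>' by (simp_all add: measure_space_def)
    have "emeasure (interval_measure F) (?G i) = ?m i" if "i \<in> ?I" for i
      using \<mu>' that
      by (intro emeasure_extend_measure[OF interval_measure_def _ _ pos, where i=i]) auto
    from this[of "(a, b)" for a b] show ?thesis by auto
  next
    case False
    then have "interval_measure F = measure_of UNIV (?G ` ?I) (\<lambda>_. 0)"
      unfolding interval_measure_def extend_measure_def by (simp only: if_False)
    then show ?thesis by (simp add: emeasure_sigma)
  qed
qed

text \<open>The intervals \<open>{- n<..n}\<close> have finite mass in both cases of the
  alternative.\<close>

lemma sigma_finite_interval_measure_any: "sigma_finite_measure (interval_measure F)"
proof
  let ?A = "range (\<lambda>n. {- real n<..real n})"
  have "emeasure (interval_measure F) {- real n<..real n} \<noteq> \<infinity>" for n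
    using interval_measure_alternative[of F]
  proof
    assume "\<forall>a b. a \<le> b \<longrightarrow> emeasure (interval_measure F) {a<..b} = ennreal (F b - F a)"
    then have "emeasure (interval_measure F) {- real n<..real n} = ennreal (F (real n) - F (- real n))"
      by (metis neg_le_0_iff_le of_nat_0_le_iff order.trans)
    then show ?thesis by simp
  qed simp
  moreover have "\<Union>?A = UNIV"
  proof -
    have "\<exists>n. x \<in> {- real n<..real n}" for x
    proof -
      obtain n where "\<bar>x\<bar> < real n" using reals_Archimedean2 by blast
      then show ?thesis by (intro exI[of _ n]) auto
    qed
    then show ?thesis by blast
  qed
  ultimately show "\<exists>A. countable A \<and> A \<subseteq> sets (interval_measure F) \<and> \<Union>A = space (interval_measure F) \<and>
      (\<forall>a\<in>A. emeasure (interval_measure F) a \<noteq> \<infinity>)"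
    by (intro exI[of _ ?A]) auto
qed

section \<open>Boxes in the strip and their area\<close>

lemma space_strip: "space (strip_intensity T) = {0..T} \<times> {0..}"
  unfolding strip_intensity_def by (simp add: space_pair_measure space_restrict_space)

lemma fst_strip: "fst \<in> borel_measurable (strip_intensity T)"
proof -
  have "fst \<in> strip_intensity T \<rightarrow>\<^sub>M restrict_space lborel {0..T}"
    unfolding strip_intensity_def by measurable
  then show ?thesis by (simp add: measurable_restrict_space2_iff)
qed

lemma snd_strip: "snd \<in> borel_measurable (strip_intensity T)"
proof -
  have "snd \<in> strip_intensity T \<rightarrow>\<^sub>M restrict_space lborel {0..}"
    unfolding strip_intensity_def by measurable
  then show ?thesis by (simp add: measurable_restrict_space2_iff)
qed

lemma box_strip: "0 \<le> a \<Longrightarrow> b \<le> T \<Longrightarrow> {a<..b} \<times> {0..c} \<in> sets (strip_intensity T)"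
proof -
  assume ab: "0 \<le> a" "b \<le> T"
  note [measurable] = fst_strip snd_strip
  have "{p \<in> space (strip_intensity T). a < fst p \<and> fst p \<le> b \<and> 0 \<le> snd p \<and> snd p \<le> c} \<in> sets (strip_intensity T)"
    by measurable
  also have "{p \<in> space (strip_intensity T). a < fst p \<and> fst p \<le> b \<and> 0 \<le> snd p \<and> snd p \<le> c} = {a<..b} \<times> {0..c}"
    using ab by (auto simp: space_strip)
  finally show ?thesis .
qed

lemma emeasure_box_strip:
  assumes "0 \<le> a" "a \<le> b" "b \<le> T" "0 \<le> c"
  shows "emeasure (strip_intensity T) ({a<..b} \<times> {0..c}) = ennreal ((b - a) * c)"
proof -
  have A: "{a<..b} \<in> sets (restrict_space lborel {0..T})"
    using assms by (subst sets_restrict_space_iff) auto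
  have B: "{0..c} \<in> sets (restrict_space lborel {0..})"
    using assms by (subst sets_restrict_space_iff) auto
  have sf: "sigma_finite_measure (restrict_space lborel {0::real..})"
    by (intro sigma_finite_measure_restrict_space) (auto intro: sigma_finite_lborel)
  have "emeasure (strip_intensity T) ({a<..b} \<times> {0..c})
     = emeasure (restrict_space lborel {0..T}) {a<..b} * emeasure (restrict_space lborel {0..}) {0..c}"
    unfolding strip_intensity_def
    by (rule sigma_finite_measure.emeasure_pair_measure_Times[OF sf A B])
  also have "\<dots> = ennreal (b - a) * ennreal c"
    using assms by (subst (1 2) emeasure_restrict_space) auto
  also have "\<dots> = ennreal ((b - a) * c)" using assms by (simp add: ennreal_mult)
  finally show ?thesis .
qed

text \<open>The two equations at one fixed sample point, with \<open>Q\<close> the realised point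
  measure; everything in this context is deterministic.\<close>

locale hawkes_path =
  fixes T \<mu> :: real and \<Phi> :: "real \<Rightarrow> real" and Q :: "(real \<times> real) measure"
    and X :: "real \<Rightarrow> nat" and \<Lambda> :: "real \<Rightarrow> real"
  assumes T: "0 < T" and \<mu>: "0 \<le> \<mu>"
    and \<Phi>_meas: "(\<lambda>t. indicator {0..T} t * \<Phi> t) \<in> borel_measurable borel"
    and \<Phi>_nonneg: "\<And>t. t \<in> {0..T} \<Longrightarrow> 0 \<le> \<Phi> t"
    and \<Phi>_anti: "\<And>s t. 0 \<le> s \<Longrightarrow> s \<le> t \<Longrightarrow> t \<le> T \<Longrightarrow> \<Phi> t \<le> \<Phi> s"
    and setsQ: "sets Q = sets (strip_intensity T)"
    and X_eq: "\<And>t. t \<in> {0..T} \<Longrightarrow> of_nat (X t) =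
          (\<integral>\<^sup>+ p \<in> {0<..t} \<times> {0..}. indicator {\<theta>. \<theta> \<le> \<Lambda> (fst p)} (snd p) \<partial>Q)"
    and \<Lambda>_eq: "\<And>t. t \<in> {0..T} \<Longrightarrow> \<Lambda> t = \<mu> + (LINT u:{0<..<t}|path_measure T X. \<Phi> (t - u))"
begin

lemma X_mono: "0 \<le> s \<Longrightarrow> s \<le> t \<Longrightarrow> t \<le> T \<Longrightarrow> X s \<le> X t"
proof -
  assume st: "0 \<le> s" "s \<le> t" "t \<le> T"
  have "(of_nat (X s) :: ennreal) \<le> of_nat (X t)"
    using st by (subst (1 2) X_eq) (auto intro!: nn_integral_mono split: split_indicator)
  then show ?thesis by simp
qed

lemma X_0: "X 0 = 0"
  using X_eq[of 0] T by simp

definition F :: "real \<Rightarrow> real" where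
  "F u = real (X (max 0 (min T u)))"

lemma F_mono: "x \<le> y \<Longrightarrow> F x \<le> F y"
  unfolding F_def using T by (auto intro!: X_mono)

lemma F_eq: "u \<in> {0..T} \<Longrightarrow> F u = real (X u)"
  unfolding F_def by auto

abbreviation "pm \<equiv> path_measure T X"

lemma pm_F: "pm = interval_measure F"
  unfolding path_measure_def F_def ..

text \<open>Sigma-finiteness of the path measure makes the parameter integral Borel in
  \<open>t\<close>. Only a version agreeing on \<open>{0..T}\<close> is claimed, since the equation
  says nothing about \<open>\<Lambda>\<close> elsewhere.\<close>

lemma \<Lambda>_measurable: "\<exists>\<Lambda>' \<in> borel_measurable borel. \<forall>t\<in>{0..T}. \<Lambda>' t = \<Lambda> t"
proof -
  define \<Phi>' where "\<Phi>' t = indicator {0..T} t * \<Phi> t" for t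
  have [measurable]: "\<Phi>' \<in> borel_measurable borel" using \<Phi>_meas by (simp add: \<Phi>'_def[abs_def])
  interpret sigma_finite_measure pm unfolding pm_F by (rule sigma_finite_interval_measure_any)
  have [measurable_cong]: "sets pm = sets borel" by (simp add: pm_F)
  define L where "L t = \<mu> + (\<integral>u. (if 0 < u \<and> u < t then \<Phi>' (t - u) else 0) \<partial>pm)" for t
  have "L \<in> borel_measurable borel"
    unfolding L_def[abs_def]
    by (intro borel_measurable_add borel_measurable_const borel_measurable_lebesgue_integral) measurable
  moreover have "L t = \<Lambda> t" if "t \<in> {0..T}" for t
    unfolding L_def \<Lambda>_eq[OF that] set_lebesgue_integral_def
    using that by (intro arg_cong2[of _ _ _ _ "(+)"] Bochner_Integration.integral_cong refl)
      (auto simp: \<Phi>'_def split: split_indicator)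
  ultimately show ?thesis by blast
qed

definition E :: "real \<Rightarrow> (real \<times> real) set" where
  "E t = {p. 0 < fst p \<and> fst p \<le> t \<and> 0 \<le> snd p \<and> snd p \<le> \<Lambda> (fst p)}"

lemma E_sets: "t \<le> T \<Longrightarrow> E t \<in> sets Q"
proof -
  assume t: "t \<le> T"
  obtain \<Lambda>' where [measurable]: "\<Lambda>' \<in> borel_measurable borel" and \<Lambda>': "\<And>t. t \<in> {0..T} \<Longrightarrow> \<Lambda>' t = \<Lambda> t"
    using \<Lambda>_measurable by blast
  note [measurable] = fst_strip snd_strip
  have "{p \<in> space (strip_intensity T). 0 < fst p \<and> fst p \<le> t \<and> 0 \<le> snd p \<and> snd p \<le> \<Lambda>' (fst p)} \<in> sets (strip_intensity T)"
    by measurable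
  also have "{p \<in> space (strip_intensity T). 0 < fst p \<and> fst p \<le> t \<and> 0 \<le> snd p \<and> snd p \<le> \<Lambda>' (fst p)} = E t"
    using t by (auto simp: space_strip E_def \<Lambda>')
  finally show ?thesis by (simp add: setsQ)
qed

lemma X_E: "t \<in> {0..T} \<Longrightarrow> of_nat (X t) = emeasure Q (E t)"
proof -
  assume t: "t \<in> {0..T}"
  have "of_nat (X t) = (\<integral>\<^sup>+ p. indicator (E t) p \<partial>Q)"
    unfolding X_eq[OF t] by (intro nn_integral_cong) (auto simp: E_def split: split_indicator)
  then show ?thesis using E_sets[of t] t by simp
qed

text \<open>The regions \<open>E t\<close> decrease to \<open>E a\<close> as \<open>t\<close>
  decreases to \<open>a\<close> and have finite mass, so continuity from above applies; integer
  values turn convergence into equality shortly after \<open>a\<close>.\<close>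

lemma X_right:
  assumes "0 \<le> a" "a < T"
  shows "\<exists>\<epsilon>>0. a + \<epsilon> \<le> T \<and> X (a + \<epsilon>) = X a"
proof -
  define t where "t k = a + (T - a) / real (Suc k)" for k
  have t: "a < t k" "t k \<le> T" for k
  proof -
    show "a < t k" unfolding t_def using assms by simp
    have "(T - a) / real (Suc k) \<le> (T - a) / 1" using assms by (intro divide_left_mono) auto
    then show "t k \<le> T" unfolding t_def by simp
  qed
  have t_lim: "t \<longlonglongrightarrow> a"
  proof -
    have "(\<lambda>k. a + (T - a) * inverse (real (Suc k))) \<longlonglongrightarrow> a + (T - a) * 0"
      by (intro tendsto_intros LIMSEQ_inverse_real_of_nat)
    then show ?thesis by (simp add: t_def[abs_def] divide_inverse)
  qed
  have dec: "decseq (\<lambda>k. E (t k))"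
  proof (rule decseq_SucI)
    fix k
    have "(T - a) / real (Suc (Suc k)) \<le> (T - a) / real (Suc k)" using assms by (intro divide_left_mono) auto
    then show "E (t (Suc k)) \<subseteq> E (t k)" unfolding E_def t_def by auto
  qed
  have "(\<Inter>k. E (t k)) = E a"
  proof (intro equalityI subsetI)
    fix p assume p: "p \<in> (\<Inter>k. E (t k))"
    then have "\<And>k. fst p \<le> t k" by (auto simp: E_def)
    then have "fst p \<le> a" using t_lim by (intro LIMSEQ_le_const) auto
    then show "p \<in> E a" using p by (auto simp: E_def)
  next
    fix p assume "p \<in> E a"
    then have "fst p \<le> t k" for k using t(1)[of k] by (auto simp: E_def)
    then show "p \<in> (\<Inter>k. E (t k))" using \<open>p \<in> E a\<close> by (auto simp: E_def)
  qed
  moreover have "(\<lambda>k. emeasure Q (E (t k))) \<longlonglongrightarrow> emeasure Q (\<Inter>k. E (t k))"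
  proof (rule Lim_emeasure_decseq[OF _ dec])
    show "range (\<lambda>k. E (t k)) \<subseteq> sets Q" using E_sets t by auto
    show "emeasure Q (E (t k)) \<noteq> \<infinity>" for k
      using X_E[of "t k"] t[of k] assms by (simp flip: X_E)
  qed
  ultimately have "(\<lambda>k. of_nat (X (t k)) :: ennreal) \<longlonglongrightarrow> of_nat (X a)"
  proof -
    have "t k \<in> {0..T}" for k using t[of k] assms by auto
    moreover have "a \<in> {0..T}" using assms by auto
    ultimately show ?thesis
      using \<open>(\<lambda>k. emeasure Q (E (t k))) \<longlonglongrightarrow> emeasure Q (\<Inter>k. E (t k))\<close> \<open>(\<Inter>k. E (t k)) = E a\<close>
      by (simp add: X_E)
  qed
  moreover have "(of_nat (X a) :: ennreal) < of_nat (Suc (X a))" by (simp only: of_nat_less_iff)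
  ultimately have "\<forall>\<^sub>F k in sequentially. (of_nat (X (t k)) :: ennreal) < of_nat (Suc (X a))"
    by (rule order_tendstoD(2))
  then obtain k where "(of_nat (X (t k)) :: ennreal) < of_nat (Suc (X a))"
    by (auto simp: eventually_sequentially)
  then have "X (t k) < Suc (X a)" by (simp only: of_nat_less_iff)
  moreover have "X a \<le> X (t k)" using t[of k] assms by (intro X_mono) auto
  ultimately show ?thesis
    using t[of k] by (intro exI[of _ "t k - a"]) auto
qed

lemma F_right_cont: "continuous (at_right a) F"
proof -
  have "\<exists>b>a. F b = F a"
  proof (cases "0 \<le> a \<and> a < T")
    case True
    then obtain \<epsilon> where "\<epsilon> > 0" "a + \<epsilon> \<le> T" "X (a + \<epsilon>) = X a" using X_right by blast
    then show ?thesis using True by (intro exI[of _ "a + \<epsilon>"]) (auto simp: F_eq)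
  next
    case False
    show ?thesis
    proof (cases "a < 0")
      case True
      then show ?thesis using T by (intro exI[of _ 0]) (auto simp: F_def max_def min_def)
    next
      case a: False
      then show ?thesis using False T by (intro exI[of _ "a + 1"]) (auto simp: F_def max_def min_def)
    qed
  qed
  then obtain b where b: "a < b" "F b = F a" by blast
  have "\<forall>\<^sub>F x in at_right a. F x = F a"
    unfolding eventually_at_right[OF b(1)]
    using b F_mono by (intro exI[of _ b]) (auto intro!: antisym, metis less_imp_le)
  then show ?thesis
    unfolding continuous_within by (rule tendsto_eventually)
qed

lemma pm_Ioc: "0 \<le> a \<Longrightarrow> a \<le> b \<Longrightarrow> b \<le> T \<Longrightarrow> emeasure pm {a<..b} = ennreal (real (X b) - real (X a))"
  unfolding pm_F by (subst emeasure_interval_measure_Ioc) (auto simp: F_mono F_right_cont F_eq)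

lemma measure_pm_Ioc: "0 \<le> a \<Longrightarrow> a \<le> b \<Longrightarrow> b \<le> T \<Longrightarrow> measure pm {a<..b} = real (X b) - real (X a)"
  unfolding measure_def using X_mono[of a b] by (simp add: pm_Ioc)

text \<open>The open right end keeps a jump at \<open>s\<close> itself out of the count: exhaustion
  from the left uses \<open>X\<close> strictly before \<open>s\<close> only, which is all that the
  intensity at \<open>s\<close> may depend on.\<close>

lemma pm_Ioo_le:
  assumes "0 \<le> a" "a < s" "s \<le> T" and c: "\<And>t. a \<le> t \<Longrightarrow> t < s \<Longrightarrow> X t \<le> X a + c"
  shows "emeasure pm {a<..<s} \<le> of_nat c"
proof -
  define t where "t k = s - (s - a) / real (Suc k)" for k
  have t: "a \<le> t k" "t k < s" for k
  proof -
    show "t k < s" unfolding t_def using assms by simp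
    have "(s - a) / real (Suc k) \<le> (s - a) / 1" using assms by (intro divide_left_mono) auto
    then show "a \<le> t k" unfolding t_def by simp
  qed
  have t_lim: "t \<longlonglongrightarrow> s"
  proof -
    have "(\<lambda>k. s - (s - a) * inverse (real (Suc k))) \<longlonglongrightarrow> s - (s - a) * 0"
      by (intro tendsto_intros LIMSEQ_inverse_real_of_nat)
    then show ?thesis by (simp add: t_def[abs_def] divide_inverse)
  qed
  have inc: "incseq (\<lambda>k. {a<..t k})"
  proof (rule incseq_SucI)
    fix k
    have "(s - a) / real (Suc (Suc k)) \<le> (s - a) / real (Suc k)" using assms by (intro divide_left_mono) auto
    then show "{a<..t k} \<subseteq> {a<..t (Suc k)}" unfolding t_def by auto
  qed
  have "{a<..<s} = (\<Union>k. {a<..t k})"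
  proof (intro equalityI subsetI)
    fix x assume x: "x \<in> {a<..<s}"
    then have "\<forall>\<^sub>F k in sequentially. x < t k" using t_lim by (intro order_tendstoD) auto
    then obtain k where "x < t k" by (auto simp: eventually_sequentially)
    then show "x \<in> (\<Union>k. {a<..t k})" using x by (auto intro: less_imp_le)
  next
    fix x assume "x \<in> (\<Union>k. {a<..t k})"
    then show "x \<in> {a<..<s}" using t(2) by (auto intro: le_less_trans)
  qed
  then have "emeasure pm {a<..<s} = (SUP k. emeasure pm {a<..t k})"
    using inc by (simp add: SUP_emeasure_incseq pm_F image_subset_iff)
  also have "\<dots> \<le> of_nat c"
  proof (rule SUP_least)
    fix k
    have "emeasure pm {a<..t k} = ennreal (real (X (t k)) - real (X a))"
      using t[of k] assms by (intro pm_Ioc) auto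
    also have "\<dots> \<le> ennreal (real c)" using c[OF t[of k]] by (intro ennreal_leI) auto
    finally show "emeasure pm {a<..t k} \<le> of_nat c" by (simp add: ennreal_of_nat_eq_real_of_nat)
  qed
  finally show ?thesis .
qed

section \<open>Intensity bounds and the points they force into strips\<close>

lemma \<Lambda>_le_sup:
  assumes "0 < s" "s \<le> T" and c: "\<And>t. 0 \<le> t \<Longrightarrow> t < s \<Longrightarrow> X t \<le> c"
  shows "\<Lambda> s \<le> \<mu> + \<Phi> 0 * real c"
proof -
  have e: "emeasure pm {0<..<s} \<le> of_nat c" using assms by (intro pm_Ioo_le) (auto simp: X_0)
  then have fin: "emeasure pm {0<..<s} < \<infinity>" by (rule le_less_trans) (simp add: of_nat_less_top)
  have \<Phi>0: "0 \<le> \<Phi> 0" using \<Phi>_nonneg T by simp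
  have "(LINT u:{0<..<s}|pm. \<Phi> (s - u)) \<le> (\<integral>u. indicator {0<..<s} u * \<Phi> 0 \<partial>pm)"
    unfolding set_lebesgue_integral_def
  proof (rule integral_mono')
    show "integrable pm (\<lambda>u. indicator {0<..<s} u * \<Phi> 0)"
      using fin by (intro integrable_mult_left integrable_real_indicator) (auto simp: pm_F)
  qed (use assms \<Phi>0 in \<open>auto intro!: \<Phi>_anti split: split_indicator\<close>)
  also have "\<dots> = measure pm {0<..<s} * \<Phi> 0" by (simp add: pm_F)
  also have "\<dots> \<le> real c * \<Phi> 0"
  proof (rule mult_right_mono[OF _ \<Phi>0])
    show "measure pm {0<..<s} \<le> real c"
      unfolding measure_def using e enn2real_mono[OF e] by (simp add: ennreal_of_nat_eq_real_of_nat)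
  qed
  finally show ?thesis using \<Lambda>_eq[of s] assms by (simp add: mult.commute)
qed

text \<open>A jump in cell \<open>j\<close> precedes \<open>s\<close> by at least
  \<open>(i - 1 - j) * d\<close>, and the kernel is non-increasing. Without a jump between the last
  grid point and \<open>s\<close> only increments over complete earlier cells enter.\<close>

lemma \<Lambda>_le_grid:
  fixes d :: real
  assumes d: "0 < d" and s: "real i * d < s" "s \<le> T"
    and c: "\<And>t. real i * d \<le> t \<Longrightarrow> t < s \<Longrightarrow> X t = X (real i * d)"
  shows "\<Lambda> s \<le> \<mu> + (\<Sum>j<i. \<Phi> (real (i - 1 - j) * d) * (real (X (real (Suc j) * d)) - real (X (real j * d))))"
proof -
  let ?A = "\<lambda>j. {real j * d<..real (Suc j) * d}"
  let ?B = "{real i * d<..<s}"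
  have "0 \<le> real i * d" using d by simp
  have "emeasure pm ?B \<le> of_nat 0"
  proof (rule pm_Ioo_le[OF \<open>0 \<le> real i * d\<close> s])
    fix t assume "real i * d \<le> t" "t < s"
    from c[OF this] show "X t \<le> X (real i * d) + 0" by linarith
  qed
  then have B0: "emeasure pm ?B = 0" by simp
  have grid: "0 \<le> real j * d" "real (Suc j) * d \<le> real i * d" "real (Suc j) * d \<le> T" if "j < i" for j
  proof -
    show "0 \<le> real j * d" using d by simp
    show "real (Suc j) * d \<le> real i * d" using that d by (intro mult_right_mono) auto
    then show "real (Suc j) * d \<le> T" using s by linarith
  qed
  have ordj: "real j * d \<le> real (Suc j) * d" for j using d by (intro mult_right_mono) auto
  have fin: "emeasure pm (?A j) < \<infinity>" if "j < i" for j
    using pm_Ioc[of "real j * d" "real (Suc j) * d"] grid[OF that] ordj[of j] by simp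
  define g where "g u = (\<Sum>j<i. indicator (?A j) u * \<Phi> (real (i - 1 - j) * d)) + indicator ?B u * \<Phi> 0" for u
  have \<Phi>g: "0 \<le> \<Phi> (real (i - 1 - j) * d)" if "j < i" for j
  proof (rule \<Phi>_nonneg)
    have "real (i - 1 - j) * d \<le> real i * d" using d by (intro mult_right_mono) auto
    then have "real (i - 1 - j) * d \<le> T" using s by linarith
    then show "real (i - 1 - j) * d \<in> {0..T}" using d by simp
  qed
  have \<Phi>0: "0 \<le> \<Phi> 0" using \<Phi>_nonneg T by simp
  have g0: "0 \<le> g u" for u
    unfolding g_def using \<Phi>g \<Phi>0 by (intro add_nonneg_nonneg sum_nonneg mult_nonneg_nonneg) auto
  have intA: "integrable pm (\<lambda>u. indicator (?A j) u * \<Phi> (real (i - 1 - j) * d))" if "j \<in> {..<i}" for j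
    using fin[of j] that by (intro integrable_mult_left integrable_real_indicator) (auto simp: pm_F)
  have intB: "integrable pm (\<lambda>u. indicator ?B u * \<Phi> 0)"
    using B0 by (intro integrable_mult_left integrable_real_indicator) (auto simp: pm_F)
  have "(LINT u:{0<..<s}|pm. \<Phi> (s - u)) \<le> (\<integral>u. g u \<partial>pm)"
    unfolding set_lebesgue_integral_def
  proof (rule integral_mono')
    show "integrable pm g"
      unfolding g_def
      by (intro Bochner_Integration.integrable_add Bochner_Integration.integrable_sum intA intB)
    show "indicat_real {0<..<s} u *\<^sub>R \<Phi> (s - u) \<le> g u" for u
    proof (cases "0 < u \<and> u < s")
      case u: True
      show ?thesis
      proof (cases "u \<le> real i * d")
        case True
        \<comment> \<open>Cells are closed on the right here, so the index is the ceiling minus one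
          and not the floor.\<close>
        define j where "j = nat (\<lceil>u / d\<rceil> - 1)"
        have "0 < u / d" using u d by simp
        then have ceil: "real j = of_int \<lceil>u / d\<rceil> - 1" unfolding j_def by (simp add: less_ceiling_iff)
        have "real j < u / d" "u / d \<le> real j + 1" using ceil by linarith+
        then have uj: "u \<in> ?A j" using d by (auto simp: field_simps)
        have "real j * d < real i * d" using uj True by auto
        then have ji: "j < i" using d by simp
        have "real (i - 1 - j) * d = real i * d - real (Suc j) * d"
          using ji by (simp add: of_nat_diff algebra_simps)
        then have "real (i - 1 - j) * d \<le> s - u" using uj s by auto
        then have "\<Phi> (s - u) \<le> \<Phi> (real (i - 1 - j) * d)" using u s d by (intro \<Phi>_anti) auto
        also have "\<dots> = indicator (?A j) u * \<Phi> (real (i - 1 - j) * d)" using uj by simp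
        also have "\<dots> \<le> (\<Sum>j<i. indicator (?A j) u * \<Phi> (real (i - 1 - j) * d))"
          using ji \<Phi>g by (intro member_le_sum) auto
        also have "\<dots> \<le> g u" unfolding g_def using \<Phi>0 by simp
        finally show ?thesis using u by simp
      next
        case False
        have "\<Phi> (s - u) \<le> \<Phi> 0" using u s by (intro \<Phi>_anti) auto
        also have "\<dots> = indicator ?B u * \<Phi> 0" using u False by simp
        also have "\<dots> \<le> g u" unfolding g_def using \<Phi>g by (auto intro!: sum_nonneg)
        finally show ?thesis using u by simp
      qed
    qed (use g0[of u] in auto)
  qed (rule g0)
  also have "\<dots> = (\<Sum>j<i. measure pm (?A j) * \<Phi> (real (i - 1 - j) * d)) + measure pm ?B * \<Phi> 0"
    unfolding g_def
    by (subst Bochner_Integration.integral_add[OF Bochner_Integration.integrable_sum[OF intA] intB],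
        assumption, subst Bochner_Integration.integral_sum[OF intA]) (auto simp: pm_F)
  also have "measure pm ?B = 0" using B0 by (simp add: measure_def)
  also have "(\<Sum>j<i. measure pm (?A j) * \<Phi> (real (i - 1 - j) * d)) + 0 * \<Phi> 0
     = (\<Sum>j<i. \<Phi> (real (i - 1 - j) * d) * (real (X (real (Suc j) * d)) - real (X (real j * d))))"
    using grid ordj by (simp only: mult_zero_left add_0_right) (intro sum.cong refl, subst measure_pm_Ioc, auto)
  finally show ?thesis using \<Lambda>_eq[of s] s \<open>0 \<le> real i * d\<close> by simp
qed

text \<open>Up to and including the first time \<open>s\<close> at which \<open>k\<close> is
  reached, the intensity is determined by what happened strictly before. Hence the points accepted
  in \<open>{a<..s}\<close> lie below the height \<open>c\<close>, and there are at least
  \<open>k - X a\<close> of them.\<close>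

lemma strip_count:
  assumes ab: "0 \<le> a" "a < b" "b \<le> T" and k: "X a < k" "k \<le> X b"
    and c: "\<And>s. a < s \<Longrightarrow> s \<le> b \<Longrightarrow> (\<And>t. a \<le> t \<Longrightarrow> t < s \<Longrightarrow> X t < k) \<Longrightarrow> \<Lambda> s \<le> c"
  shows "of_nat (k - X a) \<le> emeasure Q ({a<..b} \<times> {0..c})"
proof -
  define S where "S = {t \<in> {a..b}. k \<le> X t}"
  define s where "s = Inf S"
  have bS: "b \<in> S" using ab k by (auto simp: S_def)
  have bdd: "bdd_below S" by (auto simp: S_def bdd_below_def)
  have sb: "s \<le> b" unfolding s_def using bS bdd by (rule cInf_lower)
  have as: "a \<le> s" unfolding s_def using bS by (intro cInf_greatest) (auto simp: S_def)
  have below: "X t < k" if "a \<le> t" "t < s" for t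
  proof (rule ccontr)
    assume "\<not> X t < k"
    then have "t \<in> S" using that sb by (simp add: S_def)
    then show False using cInf_lower[OF _ bdd, of t] that by (simp add: s_def)
  qed
  \<comment> \<open>By right-continuity the infimum is attained, so the jump that reaches
    \<open>k\<close> is already counted at \<open>s\<close>.\<close>
  have Xs: "k \<le> X s"
  proof (rule ccontr)
    assume "\<not> k \<le> X s"
    then have sk: "X s < k" by simp
    then have "s < b" using sb k by (cases "s = b") auto
    then obtain \<epsilon> where \<epsilon>: "\<epsilon> > 0" "s + \<epsilon> \<le> T" "X (s + \<epsilon>) = X s" using X_right[of s] as ab by auto
    have "s + \<epsilon> \<le> Inf S"
    proof (rule cInf_greatest)
      fix t assume t: "t \<in> S"
      show "s + \<epsilon> \<le> t"
      proof (rule ccontr)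
        assume "\<not> s + \<epsilon> \<le> t"
        then have "X t \<le> X (s + \<epsilon>)" using t ab \<epsilon> by (intro X_mono) (auto simp: S_def)
        then show False using t sk \<epsilon> by (auto simp: S_def)
      qed
    qed (use bS in auto)
    then show False using \<epsilon> by (simp add: s_def)
  qed
  have "a < s" using as Xs k by (cases "a = s") auto
  have "of_nat (X s) = emeasure Q (E s)" using as sb ab by (intro X_E) auto
  also have "\<dots> \<le> emeasure Q (E a \<union> {a<..b} \<times> {0..c})"
  proof (rule emeasure_mono)
    show "E s \<subseteq> E a \<union> {a<..b} \<times> {0..c}"
    proof
      fix p assume p: "p \<in> E s"
      show "p \<in> E a \<union> {a<..b} \<times> {0..c}"
      proof (cases "fst p \<le> a")
        case False
        have "\<Lambda> (fst p) \<le> c" using p False sb by (intro c below) (auto simp: E_def)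
        then show ?thesis using p False sb by (cases p) (auto simp: E_def)
      qed (use p in \<open>auto simp: E_def\<close>)
    qed
    show "E a \<union> {a<..b} \<times> {0..c} \<in> sets Q"
      using E_sets[of a] box_strip[of a b T c] ab by (auto simp: setsQ)
  qed
  also have "\<dots> \<le> emeasure Q (E a) + emeasure Q ({a<..b} \<times> {0..c})"
    using E_sets[of a] box_strip[of a b T c] ab by (intro emeasure_subadditive) (auto simp: setsQ)
  also have "emeasure Q (E a) = of_nat (X a)" using X_E[of a] ab by simp
  finally have "(of_nat (X s) :: ennreal) \<le> of_nat (X a) + emeasure Q ({a<..b} \<times> {0..c})" .
  moreover have "(of_nat (X a) :: ennreal) + of_nat (k - X a) \<le> of_nat (X s)"
    using Xs k unfolding of_nat_add[symmetric] of_nat_le_iff by simp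
  ultimately have "(of_nat (X a) :: ennreal) + of_nat (k - X a) \<le> of_nat (X a) + emeasure Q ({a<..b} \<times> {0..c})"
    by (rule order.trans[rotated])
  then show ?thesis by (simp add: ennreal_add_left_cancel_le)
qed

text \<open>Two target levels in \<open>strip_count\<close>. The truncated value at the right end,
  with the crude height, places all truncated jumps of the cell in one strip of fixed height. The
  value at the left end plus one looks at the first jump only, before which no jump of the current
  cell has entered the intensity.\<close>

lemma truncated_step:
  fixes d :: real and K :: nat
  assumes d: "0 < d" and i: "real (Suc i) * d \<le> T"
  defines "D \<equiv> \<lambda>j. min (X (real (Suc j) * d)) K - min (X (real j * d)) K"
  assumes pos: "0 < D i"
  shows "X (real i * d) < K"
    and "of_nat (D i) \<le> emeasure Q ({real i * d<..real (Suc i) * d} \<times> {0..\<mu> + \<Phi> 0 * real K})"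
    and "1 \<le> emeasure Q ({real i * d<..real (Suc i) * d} \<times>
              {0..\<mu> + (\<Sum>j<i. \<Phi> (real (i - 1 - j) * d) * real (D j))})"
proof -
  let ?a = "real i * d" and ?b = "real (Suc i) * d"
  have ab: "0 \<le> ?a" "?a < ?b" using d by (auto simp: mult_strict_right_mono)
  show aK: "X ?a < K" using pos by (auto simp: D_def min_def split: if_splits)
  have \<Phi>0: "0 \<le> \<Phi> 0" using \<Phi>_nonneg T by simp
  have Di: "D i = min (X ?b) K - X ?a" using aK by (simp add: D_def)
  show "of_nat (D i) \<le> emeasure Q ({?a<..?b} \<times> {0..\<mu> + \<Phi> 0 * real K})"
    unfolding Di
  proof (rule strip_count[OF ab i])
    show "X ?a < min (X ?b) K" using pos Di by simp
    fix s assume s: "?a < s" "s \<le> ?b" and below: "\<And>t. ?a \<le> t \<Longrightarrow> t < s \<Longrightarrow> X t < min (X ?b) K"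
    show "\<Lambda> s \<le> \<mu> + \<Phi> 0 * real K"
    proof (rule \<Lambda>_le_sup)
      fix t assume t: "0 \<le> t" "t < s"
      show "X t \<le> K"
      proof (cases "?a \<le> t")
        case True then show ?thesis using below[of t] t by simp
      next
        case False
        then have "X t \<le> X ?a" using t s i by (intro X_mono) auto
        then show ?thesis using aK by simp
      qed
    qed (use s ab i in auto)
  qed simp
  have "of_nat (Suc (X ?a) - X ?a) \<le> emeasure Q ({?a<..?b} \<times>
              {0..\<mu> + (\<Sum>j<i. \<Phi> (real (i - 1 - j) * d) * real (D j))})"
  proof (rule strip_count[OF ab i])
    show "Suc (X ?a) \<le> X ?b" using pos Di by simp
    fix s assume s: "?a < s" "s \<le> ?b" and below: "\<And>t. ?a \<le> t \<Longrightarrow> t < s \<Longrightarrow> X t < Suc (X ?a)"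
    have "\<Lambda> s \<le> \<mu> + (\<Sum>j<i. \<Phi> (real (i - 1 - j) * d) * (real (X (real (Suc j) * d)) - real (X (real j * d))))"
    proof (rule \<Lambda>_le_grid[OF d s(1)])
      fix t assume t: "?a \<le> t" "t < s"
      have "X ?a \<le> X t" using t ab s i by (intro X_mono) auto
      then show "X t = X ?a" using below[OF t] by simp
    qed (use s i in auto)
    \<comment> \<open>Since \<open>X\<close> at the left end is below \<open>K\<close>, the
      truncation has not acted on any earlier increment.\<close>
    also have "(\<Sum>j<i. \<Phi> (real (i - 1 - j) * d) * (real (X (real (Suc j) * d)) - real (X (real j * d))))
      = (\<Sum>j<i. \<Phi> (real (i - 1 - j) * d) * real (D j))"
    proof (rule sum.cong[OF refl])
      fix j assume "j \<in> {..<i}"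
      then have j: "real (Suc j) * d \<le> ?a" using d by (intro mult_right_mono) auto
      have 1: "X (real j * d) \<le> X (real (Suc j) * d)"
      proof (rule X_mono)
        show "real (Suc j) * d \<le> T" using ab i j by linarith
      qed (use d in \<open>auto intro!: mult_right_mono\<close>)
      have 2: "X (real (Suc j) * d) \<le> X ?a"
      proof (rule X_mono)
        show "?a \<le> T" using ab i by linarith
      qed (use d j in auto)
      show "\<Phi> (real (i - 1 - j) * d) * (real (X (real (Suc j) * d)) - real (X (real j * d)))
         = \<Phi> (real (i - 1 - j) * d) * real (D j)"
        using 1 2 aK by (simp add: D_def of_nat_diff)
    qed
    finally show "\<Lambda> s \<le> \<mu> + (\<Sum>j<i. \<Phi> (real (i - 1 - j) * d) * real (D j))" .
  qed simp
  then show "1 \<le> emeasure Q ({?a<..?b} \<times> {0..\<mu> + (\<Sum>j<i. \<Phi> (real (i - 1 - j) * d) * real (D j))})"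
    by simp
qed

end

section \<open>Renewal equations\<close>

locale volterra_kernel =
  fixes T :: real and \<Phi> :: "real \<Rightarrow> real"
  assumes T: "0 < T"
    and \<Phi>_meas: "(\<lambda>t. indicator {0..T} t * \<Phi> t) \<in> borel_measurable borel"
    and \<Phi>_nonneg: "\<And>t. t \<in> {0..T} \<Longrightarrow> 0 \<le> \<Phi> t"
    and \<Phi>_anti: "\<And>s t. 0 \<le> s \<Longrightarrow> s \<le> t \<Longrightarrow> t \<le> T \<Longrightarrow> \<Phi> t \<le> \<Phi> s"
    and \<Phi>_stable: "(LBINT s:{0..T}. \<Phi> s) < 1"
begin

section \<open>The convolution operator with kernel \<Phi>\<close>

definition \<Phi>' :: "real \<Rightarrow> real" where
  "\<Phi>' t = indicator {0..T} t * \<Phi> t"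

definition conv :: "(real \<Rightarrow> real) \<Rightarrow> real \<Rightarrow> real" where
  "conv w t = (LBINT s:{0..t}. \<Phi> (t - s) * w s)"

definition \<rho> :: real where
  "\<rho> = (LBINT s:{0..T}. \<Phi> s)"

lemma \<Phi>'_measurable [measurable]: "\<Phi>' \<in> borel_measurable borel"
  using \<Phi>_meas by (simp add: \<Phi>'_def[abs_def])

lemma \<Phi>'_bounds: "0 \<le> \<Phi>' t" "\<Phi>' t \<le> \<Phi> 0"
  using \<Phi>_nonneg[of t] \<Phi>_nonneg[of 0] \<Phi>_anti[of 0 t] T by (auto simp: \<Phi>'_def split: split_indicator)

lemma \<Phi>0: "0 \<le> \<Phi> 0"
  using \<Phi>_nonneg[of 0] T by simp

lemma integrable_const_Icc: "integrable lborel (\<lambda>t. indicator {0..T} t * (c::real))"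
  by (intro integrable_mult_left integrable_real_indicator) (auto simp: emeasure_lborel_Icc_eq)

lemma \<Phi>'_integrable: "integrable lborel \<Phi>'"
proof -
  show ?thesis
  proof (rule Bochner_Integration.integrable_bound[OF integrable_const_Icc[of "\<Phi> 0"]])
    have "norm (\<Phi>' t) \<le> norm (indicator {0..T} t * \<Phi> 0)" for t
    proof (cases "t \<in> {0..T}")
      case True
      then show ?thesis using \<Phi>'_bounds[of t] \<Phi>0 by simp
    qed (auto simp: \<Phi>'_def)
    then show "AE t in lborel. norm (\<Phi>' t) \<le> norm (indicator {0..T} t * \<Phi> 0)" by (rule AE_I2)
  qed simp
qed

lemma \<rho>_eq: "\<rho> = (\<integral>t. \<Phi>' t \<partial>lborel)"
  unfolding \<rho>_def \<Phi>'_def set_lebesgue_integral_def by simp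

lemma \<rho>_bounds: "0 \<le> \<rho>" "\<rho> < 1"
proof -
  show "0 \<le> \<rho>" unfolding \<rho>_eq using \<Phi>'_bounds(1) by (intro integral_nonneg_AE AE_I2)
  show "\<rho> < 1" unfolding \<rho>_def by (rule \<Phi>_stable)
qed

text \<open>The triangular domain becomes a jointly measurable factor and all functions are cut off
  to the whole line, the form suited to measurability in \<open>t\<close> and to Tonelli.\<close>

lemma conv_eq:
  assumes "t \<in> {0..T}"
  shows "conv w t = (\<integral>s. (if s \<le> t then 1 else 0) * (\<Phi>' (t - s) * (indicator {0..T} s * w s)) \<partial>lborel)"
  unfolding conv_def set_lebesgue_integral_def
  using assms by (intro Bochner_Integration.integral_cong) (auto simp: \<Phi>'_def split: split_indicator)

lemma conv_set_integrable:
  assumes w: "set_integrable lborel {0..T} w" and t: "t \<in> {0..T}"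
  shows "set_integrable lborel {0..t} (\<lambda>s. \<Phi> (t - s) * w s)"
proof -
  let ?w = "\<lambda>s. indicator {0..T} s * w s"
  have i: "integrable lborel ?w" using w by (simp add: set_integrable_def)
  have [measurable]: "?w \<in> borel_measurable borel" using borel_measurable_integrable[OF i] by simp
  have "integrable lborel (\<lambda>s. (if s \<le> t then 1 else 0) * (\<Phi>' (t - s) * ?w s))"
  proof (rule Bochner_Integration.integrable_bound[OF integrable_mult_right[OF i, of "\<Phi> 0"]])
    show "AE s in lborel. norm ((if s \<le> t then 1 else 0) * (\<Phi>' (t - s) * ?w s)) \<le> norm (\<Phi> 0 * ?w s)"
      using \<Phi>'_bounds \<Phi>0 by (intro AE_I2) (auto simp: abs_mult intro!: mult_right_mono)
  qed simp
  moreover have "(\<lambda>s. (if s \<le> t then 1 else 0) * (\<Phi>' (t - s) * ?w s)) = (\<lambda>s. indicator {0..t} s *\<^sub>R (\<Phi> (t - s) * w s))"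
    using t by (auto simp: \<Phi>'_def fun_eq_iff split: split_indicator)
  ultimately show ?thesis by (simp add: set_integrable_def)
qed

lemma conv_mono:
  assumes "set_integrable lborel {0..T} w" "set_integrable lborel {0..T} w'" "t \<in> {0..T}"
    and "\<And>s. s \<in> {0..T} \<Longrightarrow> w s \<le> w' s"
  shows "conv w t \<le> conv w' t"
  unfolding conv_def using assms \<Phi>_nonneg
  by (intro set_integral_mono conv_set_integrable) (auto intro!: mult_left_mono)

lemma conv_add:
  assumes "set_integrable lborel {0..T} w" "set_integrable lborel {0..T} w'" "t \<in> {0..T}"
  shows "conv (\<lambda>s. w s + w' s) t = conv w t + conv w' t"
  unfolding conv_def using conv_set_integrable[OF assms(1,3)] conv_set_integrable[OF assms(2,3)]
  by (simp add: distrib_left set_integral_add)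

lemma conv_cong: "t \<in> {0..T} \<Longrightarrow> (\<And>s. s \<in> {0..T} \<Longrightarrow> w s = w' s) \<Longrightarrow> conv w t = conv w' t"
  unfolding conv_def by (intro set_lebesgue_integral_cong) auto

lemma conv_uminus: "conv (\<lambda>s. - w s) t = - conv w t"
  unfolding conv_def by (simp add: set_integral_uminus set_lebesgue_integral_def)

lemma conv_nonneg: "t \<in> {0..T} \<Longrightarrow> (\<And>s. s \<in> {0..T} \<Longrightarrow> 0 \<le> w s) \<Longrightarrow> 0 \<le> conv w t"
  unfolding conv_def set_lebesgue_integral_def using \<Phi>_nonneg
  by (intro integral_nonneg_AE AE_I2) (auto split: split_indicator)

text \<open>One convolution turns an integral bound into a pointwise one, because the kernel is
  bounded by \<open>\<Phi> 0\<close>.\<close>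

lemma conv_le:
  assumes w: "set_integrable lborel {0..T} w" and w0: "\<And>s. s \<in> {0..T} \<Longrightarrow> 0 \<le> w s" and t: "t \<in> {0..T}"
  shows "conv w t \<le> \<Phi> 0 * (LBINT s:{0..T}. w s)"
proof -
  have "conv w t \<le> (LBINT s:{0..T}. \<Phi> 0 * w s)"
    unfolding conv_def set_lebesgue_integral_def
  proof (rule integral_mono)
    show "integrable lborel (\<lambda>s. indicator {0..t} s *\<^sub>R (\<Phi> (t - s) * w s))"
      using conv_set_integrable[OF w t] by (simp add: set_integrable_def)
    show "integrable lborel (\<lambda>s. indicator {0..T} s *\<^sub>R (\<Phi> 0 * w s))"
    proof -
      have "set_integrable lborel {0..T} (\<lambda>s. \<Phi> 0 * w s)" using w by (intro set_integrable_mult_right)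
      then show ?thesis by (simp add: set_integrable_def)
    qed
    fix s
    show "indicator {0..t} s *\<^sub>R (\<Phi> (t - s) * w s) \<le> indicator {0..T} s *\<^sub>R (\<Phi> 0 * w s)"
    proof (cases "s \<in> {0..t}")
      case True
      then have "\<Phi> (t - s) * w s \<le> \<Phi> 0 * w s" using w0[of s] t by (intro mult_right_mono \<Phi>_anti) auto
      then show ?thesis using True t by simp
    next
      case False
      then show ?thesis using w0[of s] \<Phi>0 by (simp split: split_indicator)
    qed
  qed
  then show ?thesis by simp
qed

lemma conv_integrable:
  assumes w: "set_integrable lborel {0..T} w" and w0: "\<And>s. s \<in> {0..T} \<Longrightarrow> 0 \<le> w s"
  shows "set_integrable lborel {0..T} (conv w)"
proof -
  let ?w = "\<lambda>s. indicator {0..T} s * w s"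
  have i: "integrable lborel ?w" using w by (simp add: set_integrable_def)
  have [measurable]: "?w \<in> borel_measurable borel" using borel_measurable_integrable[OF i] by simp
  define c where "c t = (\<integral>s. (if s \<le> t then 1 else 0) * (\<Phi>' (t - s) * ?w s) \<partial>lborel)" for t
  have [measurable]: "c \<in> borel_measurable borel"
    unfolding c_def[abs_def] by (intro lborel.borel_measurable_lebesgue_integral) measurable
  have eq: "indicator {0..T} t *\<^sub>R conv w t = indicator {0..T} t * c t" for t
    unfolding c_def using conv_eq by (auto split: split_indicator)
  have "integrable lborel (\<lambda>t. indicator {0..T} t * c t)"
  proof (rule Bochner_Integration.integrable_bound)
    show "integrable lborel (\<lambda>t. indicator {0..T} t * (\<Phi> 0 * (LBINT s:{0..T}. w s)))"
      by (rule integrable_const_Icc)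
    show "AE t in lborel. norm (indicator {0..T} t * c t) \<le> norm (indicator {0..T} t * (\<Phi> 0 * (LBINT s:{0..T}. w s)))"
    proof (rule AE_I2)
      fix t
      show "norm (indicator {0..T} t * c t) \<le> norm (indicator {0..T} t * (\<Phi> 0 * (LBINT s:{0..T}. w s)))"
        unfolding eq[symmetric] using conv_le[OF w w0, of t] conv_nonneg[of t w] w0
        by (auto split: split_indicator)
    qed
  qed simp
  then show ?thesis unfolding set_integrable_def eq .
qed

text \<open>Young's inequality in L1, by Tonelli and translation invariance; it is an inequality
  because mass shifted beyond \<open>T\<close> is lost.\<close>

lemma conv_mass:
  assumes w: "set_integrable lborel {0..T} w" and w0: "\<And>s. s \<in> {0..T} \<Longrightarrow> 0 \<le> w s"
  shows "(LBINT t:{0..T}. conv w t) \<le> \<rho> * (LBINT t:{0..T}. w t)"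
proof -
  let ?w = "\<lambda>s. indicator {0..T} s * w s"
  have i: "integrable lborel ?w" using w by (simp add: set_integrable_def)
  have [measurable]: "?w \<in> borel_measurable borel" using borel_measurable_integrable[OF i] by simp
  have w'0: "0 \<le> ?w s" for s using w0 by (auto split: split_indicator)
  have 1: "ennreal (conv w t) = (\<integral>\<^sup>+s. ennreal ((if s \<le> t then 1 else 0) * (\<Phi>' (t - s) * ?w s)) \<partial>lborel)"
    if t: "t \<in> {0..T}" for t
  proof -
    have "integrable lborel (\<lambda>s. (if s \<le> t then 1 else 0) * (\<Phi>' (t - s) * ?w s))"
    proof -
      have "(\<lambda>s. (if s \<le> t then 1 else 0) * (\<Phi>' (t - s) * ?w s)) = (\<lambda>s. indicator {0..t} s *\<^sub>R (\<Phi> (t - s) * w s))"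
        using t by (auto simp: \<Phi>'_def fun_eq_iff split: split_indicator)
      then show ?thesis using conv_set_integrable[OF w t] by (simp add: set_integrable_def)
    qed
    then show ?thesis unfolding conv_eq[OF t]
      using \<Phi>'_bounds w'0 by (subst nn_integral_eq_integral) auto
  qed
  have "ennreal (LBINT t:{0..T}. conv w t) = (\<integral>\<^sup>+t. ennreal (indicator {0..T} t * conv w t) \<partial>lborel)"
  proof (subst nn_integral_eq_integral)
    show "integrable lborel (\<lambda>t. indicator {0..T} t * conv w t)"
      using conv_integrable[OF w w0] by (simp add: set_integrable_def)
    have "0 \<le> indicator {0..T} t * conv w t" for t
      using conv_nonneg[OF _ w0, of t] by (cases "t \<in> {0..T}") auto
    then show "AE t in lborel. 0 \<le> indicator {0..T} t * conv w t" by (rule AE_I2)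
  qed (simp add: set_lebesgue_integral_def)
  also have "\<dots> \<le> (\<integral>\<^sup>+t. (\<integral>\<^sup>+s. ennreal (\<Phi>' (t - s)) * ennreal (?w s) \<partial>lborel) \<partial>lborel)"
  proof (rule nn_integral_mono)
    fix t
    show "ennreal (indicator {0..T} t * conv w t) \<le> (\<integral>\<^sup>+s. ennreal (\<Phi>' (t - s)) * ennreal (?w s) \<partial>lborel)"
    proof (cases "t \<in> {0..T}")
      case True
      then show ?thesis using 1[OF True] w'0 \<Phi>'_bounds
        by (auto simp flip: ennreal_mult intro!: nn_integral_mono)
    qed simp
  qed
  also have "\<dots> = (\<integral>\<^sup>+s. (\<integral>\<^sup>+t. ennreal (\<Phi>' (t - s)) * ennreal (?w s) \<partial>lborel) \<partial>lborel)"
    by (rule lborel_pair.Fubini') measurable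
  also have "\<dots> = (\<integral>\<^sup>+s. ennreal \<rho> * ennreal (?w s) \<partial>lborel)"
  proof (rule nn_integral_cong)
    fix s :: real
    have "(\<integral>\<^sup>+t. ennreal (\<Phi>' (t - s)) \<partial>lborel) = (\<integral>\<^sup>+t. ennreal (\<Phi>' t) \<partial>lborel)"
      using nn_integral_real_affine[of "\<lambda>t. ennreal (\<Phi>' t)" 1 "- s"] by simp
    also have "\<dots> = ennreal \<rho>"
      unfolding \<rho>_eq using \<Phi>'_integrable \<Phi>'_bounds by (intro nn_integral_eq_integral) auto
    finally show "(\<integral>\<^sup>+t. ennreal (\<Phi>' (t - s)) * ennreal (?w s) \<partial>lborel) = ennreal \<rho> * ennreal (?w s)"
      by (subst nn_integral_multc) auto
  qed
  also have "\<dots> = ennreal \<rho> * (\<integral>\<^sup>+s. ennreal (?w s) \<partial>lborel)"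
    by (rule nn_integral_cmult) simp
  also have "(\<integral>\<^sup>+s. ennreal (?w s) \<partial>lborel) = ennreal (LBINT t:{0..T}. w t)"
    unfolding set_lebesgue_integral_def using i w'0 by (subst nn_integral_eq_integral) auto
  finally have "ennreal (LBINT t:{0..T}. conv w t) \<le> ennreal (\<rho> * (LBINT t:{0..T}. w t))"
    using \<rho>_bounds by (simp add: ennreal_mult')
  moreover have "0 \<le> (LBINT t:{0..T}. w t)"
    unfolding set_lebesgue_integral_def using w'0 by (intro integral_nonneg_AE) auto
  ultimately show ?thesis using \<rho>_bounds by (subst (asm) ennreal_le_iff) auto
qed

text \<open>Comparison principle for merely integrable solutions: the negative part \<open>z\<close>
  of \<open>y\<close> satisfies \<open>z \<le> conv z\<close>, and \<open>\<rho> < 1\<close> forces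
  its integral to vanish. \<open>conv_le\<close> upgrades this to every point, and nonnegativity of
  \<open>y\<close> gives the claim through the equation.\<close>

lemma renewal_ge:
  assumes y: "set_integrable lborel {0..T} y"
    and eq: "\<And>t. t \<in> {0..T} \<Longrightarrow> y t = a t + conv y t"
    and a: "\<And>t. t \<in> {0..T} \<Longrightarrow> 0 \<le> a t" and t: "t \<in> {0..T}"
  shows "a t \<le> y t"
proof -
  define z where "z s = max 0 (- y s)" for s
  have z: "set_integrable lborel {0..T} z"
  proof -
    have "integrable lborel (\<lambda>s. max 0 (- (indicator {0..T} s * y s)))"
      using y by (intro integrable_max) (auto simp: set_integrable_def)
    moreover have "max 0 (- (indicator {0..T} s * y s)) = indicator {0..T} s * z s" for s
      by (auto simp: z_def split: split_indicator)
    ultimately show ?thesis by (simp add: set_integrable_def)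
  qed
  have z0: "0 \<le> z s" for s by (simp add: z_def)
  have zc: "z s \<le> conv z s" if s: "s \<in> {0..T}" for s
  proof -
    have yn: "set_integrable lborel {0..T} (\<lambda>s. - y s)" using y by (simp add: set_integrable_def)
    have "- y s \<le> conv (\<lambda>s. - y s) s" using eq[OF s] a[OF s] by (simp add: conv_uminus)
    also have "\<dots> \<le> conv z s" using yn z s by (intro conv_mono) (auto simp: z_def)
    finally show ?thesis using conv_nonneg[of s z] s z0 by (simp add: z_def)
  qed
  have "(LBINT s:{0..T}. z s) \<le> (LBINT s:{0..T}. conv z s)"
    using z conv_integrable[OF z] z0 zc by (intro set_integral_mono) auto
  also have "\<dots> \<le> \<rho> * (LBINT s:{0..T}. z s)" using z z0 by (intro conv_mass)
  finally have "(1 - \<rho>) * (LBINT s:{0..T}. z s) \<le> 0" by (simp add: algebra_simps)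
  moreover have "0 \<le> (LBINT s:{0..T}. z s)"
    unfolding set_lebesgue_integral_def using z0 by (intro integral_nonneg_AE) auto
  ultimately have z_int: "(LBINT s:{0..T}. z s) = 0" using \<rho>_bounds by (simp add: mult_le_0_iff)
  have "y s \<ge> 0" if s: "s \<in> {0..T}" for s
  proof -
    have "z s \<le> 0" using conv_le[OF z z0 s] zc[OF s] unfolding z_int by simp
    then show ?thesis by (simp add: z_def)
  qed
  then have "0 \<le> conv y t" using t by (intro conv_nonneg) auto
  then show ?thesis using eq[OF t] by simp
qed

lemma renewal_bounded:
  assumes y: "set_integrable lborel {0..T} y" and y0: "\<And>t. t \<in> {0..T} \<Longrightarrow> 0 \<le> y t"
    and eq: "\<And>t. t \<in> {0..T} \<Longrightarrow> y t = a t + conv y t"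
    and a: "\<And>t. t \<in> {0..T} \<Longrightarrow> a t \<le> A" and t: "t \<in> {0..T}"
  shows "y t \<le> A + \<Phi> 0 * (LBINT s:{0..T}. y s)"
  using eq[OF t] a[OF t] conv_le[OF y y0 t] by simp

subsection \<open>Cell averages\<close>

definition cell :: "real \<Rightarrow> nat \<Rightarrow> real set" where
  "cell d k = {real k * d..<real (Suc k) * d}"

definition average :: "real \<Rightarrow> (real \<Rightarrow> real) \<Rightarrow> nat \<Rightarrow> real" where
  "average d y k = (LBINT s:cell d k. y s) / d"

lemma cell_subset: "0 < d \<Longrightarrow> real n * d = T \<Longrightarrow> k < n \<Longrightarrow> cell d k \<subseteq> {0..T}"
proof
  fix x assume *: "0 < d" "real n * d = T" "k < n" "x \<in> cell d k"
  have "real (Suc k) * d \<le> real n * d" using * by (intro mult_right_mono) auto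
  moreover have "0 \<le> real k * d" using * by simp
  moreover have "real k * d \<le> x" "x < real (Suc k) * d" using *(4) unfolding cell_def by auto
  ultimately have "0 \<le> x" "x \<le> T" using *(2) by linarith+
  then show "x \<in> {0..T}" by simp
qed

lemma cell_integrable:
  fixes y :: "real \<Rightarrow> real"
  assumes "0 < d" "real n * d = T" "k < n" "set_integrable lborel {0..T} y"
  shows "set_integrable lborel (cell d k) y"
  by (rule set_integrable_subset[OF assms(4)], simp add: cell_def, rule cell_subset[OF assms(1-3)])

lemma cell_const: "0 < d \<Longrightarrow> set_integrable lborel (cell d k) (\<lambda>_. c :: real)"
proof -
  assume "0 < d"
  then have "emeasure lborel (cell d k) = ennreal (real (Suc k) * d - real k * d)"
    unfolding cell_def by (intro emeasure_lborel_Ico mult_right_mono) auto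
  then have "integrable lborel (\<lambda>s. indicator (cell d k) s * c)"
    by (intro integrable_mult_left integrable_real_indicator) (auto simp: cell_def)
  then show ?thesis by (simp add: set_integrable_def)
qed

lemma measure_cell: "0 < d \<Longrightarrow> (LBINT s:cell d k. (c::real)) = d * c"
  unfolding cell_def by (simp add: set_lebesgue_integral_def algebra_simps)

lemma cell_disjoint:
  assumes "0 < d" "s \<in> cell d l" "s \<in> cell d l'" shows "l = l'"
proof (rule ccontr)
  have *: "False" if "l < l'" "s \<in> cell d l" "s \<in> cell d l'" for l l'
  proof -
    have "real (Suc l) * d \<le> real l' * d" using that assms(1) by (intro mult_right_mono) auto
    then show False using that by (auto simp: cell_def)
  qed
  assume "l \<noteq> l'"
  then show False using *[of l l'] *[of l' l] assms by (cases "l < l'") auto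
qed

lemma sum_average:
  assumes d: "0 < d" "real n * d = T" and y: "set_integrable lborel {0..T} y"
  shows "(\<Sum>k<n. d * average d y k) = (LBINT s:{0..T}. y s)"
proof -
  have "j \<le> n \<Longrightarrow> (\<Sum>k<j. LBINT s:cell d k. y s) = (LBINT s:{0..<real j * d}. y s)" for j
  proof (induction j)
    case (Suc j)
    have un: "{0..<real (Suc j) * d} = {0..<real j * d} \<union> cell d j"
    proof -
      have "0 \<le> real j * d" "real j * d \<le> real (Suc j) * d" using d by (auto intro: mult_right_mono)
      then show ?thesis unfolding cell_def by auto
    qed
    have le: "real j * d \<le> T"
    proof -
      have "real j * d \<le> real n * d" using d Suc.prems by (intro mult_right_mono) auto
      then show ?thesis using d by simp
    qed
    have "(LBINT s:{0..<real (Suc j) * d}. y s) = (LBINT s:{0..<real j * d}. y s) + (LBINT s:cell d j. y s)"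
      unfolding un
    proof (rule set_integral_Un)
      show "set_integrable lborel {0..<real j * d} y"
        using le by (intro set_integrable_subset[OF y]) auto
      show "set_integrable lborel (cell d j) y" using Suc.prems by (intro cell_integrable[OF d _ y]) auto
    qed (auto simp: cell_def)
    then show ?case using Suc by simp
  qed (simp add: set_lebesgue_integral_def)
  from this[of n] have "(\<Sum>k<n. d * average d y k) = (LBINT s:{0..<T}. y s)"
    using d by (simp add: average_def)
  also have "\<dots> = (LBINT s:{0..T}. y s)"
  proof -
    have "set_integrable lborel {0..<T} y" by (rule set_integrable_subset[OF y]) auto
    then show ?thesis
      unfolding set_lebesgue_integral_def using y AE_lborel_singleton[of T]
      by (intro integral_cong_AE)
        (auto simp: set_integrable_def elim!: eventually_mono split: split_indicator)
  qed
  finally show ?thesis .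
qed

text \<open>For \<open>t\<close> in cell \<open>k\<close> and \<open>s\<close> in cell
  \<open>l\<close> the lag is at most \<open>k + 1 - l\<close> cells, so the kernel is at least its
  value there. Only the cells before \<open>k\<close> are kept of the convolution, and the resulting
  pointwise inequality is averaged over \<open>t\<close>.\<close>

lemma average_supersolution:
  assumes d: "0 < d" "real n * d = T" and k: "k < n"
    and y: "set_integrable lborel {0..T} y" and y0: "\<And>t. t \<in> {0..T} \<Longrightarrow> 0 \<le> y t"
    and a: "set_integrable lborel {0..T} a"
    and eq: "\<And>t. t \<in> {0..T} \<Longrightarrow> y t = a t + conv y t"
  shows "average d a k + (\<Sum>l<k. d * \<Phi> (real (k + 1 - l) * d) * average d y l) \<le> average d y k"
proof -
  define S where "S = (\<Sum>l<k. \<Phi> (real (k + 1 - l) * d) * (LBINT s:cell d l. y s))"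
  have pt: "a t + S \<le> y t" if t: "t \<in> cell d k" for t
  proof -
    have tT: "t \<in> {0..T}" using cell_subset[OF d k] t by auto
    have int: "integrable lborel (\<lambda>s. \<Sum>l<k. \<Phi> (real (k + 1 - l) * d) * (indicator (cell d l) s * y s))"
      using cell_integrable[OF d _ y] k by (auto simp: set_integrable_def intro!: Bochner_Integration.integrable_sum)
    have "S = (\<integral>s. (\<Sum>l<k. \<Phi> (real (k + 1 - l) * d) * (indicator (cell d l) s * y s)) \<partial>lborel)"
      unfolding S_def using cell_integrable[OF d _ y] k
      by (subst Bochner_Integration.integral_sum) (auto simp: set_lebesgue_integral_def set_integrable_def)
    also have "\<dots> \<le> conv y t"
      unfolding conv_def set_lebesgue_integral_def
    proof (rule integral_mono[OF int])
      show "integrable lborel (\<lambda>s. indicator {0..t} s *\<^sub>R (\<Phi> (t - s) * y s))"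
        using conv_set_integrable[OF y tT] by (simp add: set_integrable_def)
      fix s
      show "(\<Sum>l<k. \<Phi> (real (k + 1 - l) * d) * (indicator (cell d l) s * y s)) \<le> indicator {0..t} s *\<^sub>R (\<Phi> (t - s) * y s)"
      proof (cases "\<exists>l<k. s \<in> cell d l")
        case True
        then obtain l where l: "l < k" "s \<in> cell d l" by blast
        have sT: "s \<in> {0..T}" using cell_subset[OF d, of l] l k by auto
        have "real (Suc l) * d \<le> real k * d" using l d by (intro mult_right_mono) auto
        then have st: "s \<le> t" using l t by (auto simp: cell_def)
        have "(\<Sum>l<k. \<Phi> (real (k + 1 - l) * d) * (indicator (cell d l) s * y s))
            = (\<Sum>j\<in>{l}. \<Phi> (real (k + 1 - j) * d) * (indicator (cell d j) s * y s))"
        proof (rule sum.mono_neutral_right)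
          show "\<forall>j\<in>{..<k} - {l}. \<Phi> (real (k + 1 - j) * d) * (indicator (cell d j) s * y s) = 0"
          proof
            fix j assume "j \<in> {..<k} - {l}"
            then have "s \<notin> cell d j" using cell_disjoint[OF d(1) l(2), of j] by blast
            then show "\<Phi> (real (k + 1 - j) * d) * (indicator (cell d j) s * y s) = 0" by simp
          qed
        qed (use l in auto)
        also have "\<dots> = \<Phi> (real (k + 1 - l) * d) * y s" using l by simp
        also have "\<dots> \<le> \<Phi> (t - s) * y s"
        proof (rule mult_right_mono[OF \<Phi>_anti])
          have e: "real (k + 1 - l) * d = real (Suc k) * d - real l * d"
            using l by (simp add: of_nat_diff algebra_simps)
          show "t - s \<le> real (k + 1 - l) * d" unfolding e using t l by (auto simp: cell_def)
          have "real (Suc k) * d \<le> real n * d" using k d by (intro mult_right_mono) auto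
          moreover have "0 \<le> real l * d" using d by simp
          ultimately show "real (k + 1 - l) * d \<le> T" unfolding e using d by linarith
        qed (use st y0 sT in auto)
        finally show ?thesis using st sT by simp
      next
        case False
        then have "(\<Sum>l<k. \<Phi> (real (k + 1 - l) * d) * (indicator (cell d l) s * y s)) = 0"
          by (intro sum.neutral) auto
        moreover have "0 \<le> indicator {0..t} s *\<^sub>R (\<Phi> (t - s) * y s)"
          using y0 \<Phi>_nonneg tT by (auto split: split_indicator)
        ultimately show ?thesis by simp
      qed
    qed
    finally show ?thesis using eq[OF tT] by simp
  qed
  have "(LBINT s:cell d k. a s) + d * S = (LBINT s:cell d k. a s + S)"
    using cell_integrable[OF d k a] measure_cell[OF d(1), of k S]
    by (subst set_integral_add) (auto intro: cell_const[OF d(1)])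
  also have "\<dots> \<le> (LBINT s:cell d k. y s)"
    using pt cell_integrable[OF d k a] cell_integrable[OF d k y]
    by (intro set_integral_mono set_integral_add) (auto intro: cell_const[OF d(1)])
  finally have "((LBINT s:cell d k. a s) + d * S) / d \<le> (LBINT s:cell d k. y s) / d"
    using d by (intro divide_right_mono) auto
  then show ?thesis
    using d by (simp add: average_def S_def add_divide_distrib)
qed

text \<open>Jensen's inequality, from the nonnegative variance over a cell; it makes the squared
  average admissible as forcing in the equation for \<Psi>2.\<close>

lemma average_square_le:
  assumes d: "0 < d" "real n * d = T" "k < n"
    and y: "set_integrable lborel {0..T} y" and y2: "set_integrable lborel {0..T} (\<lambda>s. (y s)\<^sup>2)"
  shows "(average d y k)\<^sup>2 \<le> average d (\<lambda>s. (y s)\<^sup>2) k"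
proof -
  let ?m = "average d y k"
  note i1 = cell_integrable[OF d y] and i2 = cell_integrable[OF d y2]
  have ic: "set_integrable lborel (cell d k) (\<lambda>s. c :: real)" for c
    by (rule cell_const[OF d(1)])
  have "0 \<le> (LBINT s:cell d k. (y s - ?m)\<^sup>2)"
    unfolding set_lebesgue_integral_def by (intro integral_nonneg_AE) auto
  also have "(LBINT s:cell d k. (y s - ?m)\<^sup>2) = (LBINT s:cell d k. (y s)\<^sup>2 - 2 * ?m * y s + ?m\<^sup>2)"
    by (simp add: power2_diff algebra_simps)
  also have "\<dots> = (LBINT s:cell d k. (y s)\<^sup>2) - 2 * ?m * (LBINT s:cell d k. y s) + d * ?m\<^sup>2"
    using i1 i2 ic measure_cell[OF d(1), of k "?m\<^sup>2"]
    by (subst set_integral_add, simp_all add: set_integral_diff)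
  also have "(LBINT s:cell d k. y s) = d * ?m" using d by (simp add: average_def)
  finally have "d * ?m\<^sup>2 \<le> (LBINT s:cell d k. (y s)\<^sup>2)" by (simp add: power2_eq_square algebra_simps)
  then have "?m\<^sup>2 \<le> (LBINT s:cell d k. (y s)\<^sup>2) / d" using d by (simp add: pos_le_divide_eq mult.commute)
  then show ?thesis by (simp add: average_def)
qed

subsection \<open>The Neumann series\<close>

text \<open>Iterated convolutions of the constant 1, the terms of the Neumann series of
  \<Psi>1.\<close>

fun neumann :: "nat \<Rightarrow> real \<Rightarrow> real" where
  "neumann 0 t = 1"
| "neumann (Suc n) t = conv (neumann n) t"

lemma neumann_Suc: "neumann (Suc n) = conv (neumann n)"
  by (rule ext) simp

text \<open>Keeping the upper limit \<open>v\<close> at the head of the list treats it as the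
  preceding variable, and the free constant \<open>c\<close> takes in the kernel factor of the
  outermost integration; the induction needs both generalisations.\<close>

lemma iter_simplex_neumann:
  "iter_simplex_integral n (\<lambda>vs. c * (\<Prod>i<n. \<Phi> ((v # vs) ! i - (v # vs) ! Suc i))) v = c * neumann n v"
proof (induction n arbitrary: c v)
  case (Suc n)
  have "iter_simplex_integral (Suc n) (\<lambda>vs. c * (\<Prod>i<Suc n. \<Phi> ((v # vs) ! i - (v # vs) ! Suc i))) v
     = (LBINT w:{0..v}. iter_simplex_integral n (\<lambda>vs. (c * \<Phi> (v - w)) * (\<Prod>i<n. \<Phi> ((w # vs) ! i - (w # vs) ! Suc i))) w)"
    by (simp add: prod.lessThan_Suc_shift mult.assoc del: prod.lessThan_Suc)
  also have "\<dots> = (LBINT w:{0..v}. c * (\<Phi> (v - w) * neumann n w))"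
    unfolding Suc by (simp add: mult.assoc)
  finally show ?case by (simp add: conv_def)
qed simp

text \<open>The outermost variable carries no kernel factor, so \<open>Suc n\<close> variables give
  only \<open>n\<close> convolutions.\<close>

lemma simplex_mass_eq: "simplex_mass T \<Phi> (Suc n) = (LBINT v:{0..T}. neumann n v)"
proof (cases "n = 0")
  case True
  then show ?thesis using T by (simp add: simplex_mass_def set_lebesgue_integral_def)
next
  case False
  \<comment> \<open>Shift by two: the product starts at \<open>i = 2\<close>, while list positions
    start at 0.\<close>
  have "(\<Prod>i=2..Suc n. \<Phi> ((v # vs) ! (i - 2) - (v # vs) ! (i - 1))) = (\<Prod>i<n. \<Phi> ((v # vs) ! i - (v # vs) ! Suc i))" for v vs
    by (rule prod.reindex_bij_witness[of _ "\<lambda>i. i + 2" "\<lambda>i. i - 2"]) (auto simp: Suc_diff_Suc numeral_2_eq_2)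
  then show ?thesis
    using False iter_simplex_neumann[of n 1] by (simp add: simplex_mass_def)
qed

lemma neumann_nonneg: "t \<in> {0..T} \<Longrightarrow> 0 \<le> neumann n t"
  by (induction n arbitrary: t) (auto intro: conv_nonneg)

lemma neumann_integrable: "set_integrable lborel {0..T} (neumann n)"
proof (induction n)
  case 0
  have "neumann 0 = (\<lambda>_. 1)" by (rule ext) simp
  then show ?case using integrable_const_Icc[of 1] by (simp add: set_integrable_def)
next
  case (Suc n)
  then show ?case unfolding neumann_Suc using neumann_nonneg by (intro conv_integrable)
qed

lemma simplex_mass_nonneg: "0 \<le> simplex_mass T \<Phi> (Suc n)"
  unfolding simplex_mass_eq set_lebesgue_integral_def using neumann_nonneg
  by (intro integral_nonneg_AE AE_I2) (auto split: split_indicator)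

text \<open>Each further variable costs a factor \<open>\<rho>\<close> by \<open>conv_mass\<close>.
  The geometric decay makes the final series converge against a quadratic bound on
  \<open>\<beta>\<close>.\<close>

lemma simplex_mass_le: "simplex_mass T \<Phi> (Suc n) \<le> T * \<rho> ^ n"
proof (induction n)
  case 0
  then show ?case by (simp add: simplex_mass_def)
next
  case (Suc n)
  have "simplex_mass T \<Phi> (Suc (Suc n)) \<le> \<rho> * simplex_mass T \<Phi> (Suc n)"
    unfolding simplex_mass_eq neumann_Suc using neumann_integrable neumann_nonneg by (intro conv_mass)
  also have "\<dots> \<le> \<rho> * (T * \<rho> ^ n)" using Suc \<rho>_bounds by (intro mult_left_mono)
  finally show ?case by (simp add: mult_ac)
qed

text \<open>Substituting the equation into itself \<open>N\<close> times leaves the remainder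
  \<open>conv ^^ N\<close> applied to \<open>y\<close>, whose mass is at most
  \<open>\<rho> ^ N\<close> times that of \<open>y\<close>.\<close>

lemma simplex_mass_sums:
  assumes y: "set_integrable lborel {0..T} y"
    and eq: "\<And>t. t \<in> {0..T} \<Longrightarrow> y t = 1 + conv y t"
  shows "(\<lambda>n. simplex_mass T \<Phi> (Suc n)) sums (LBINT t:{0..T}. y t)"
proof -
  define R where "R N = (conv ^^ N) y" for N
  have y0: "0 \<le> y t" if "t \<in> {0..T}" for t
    using renewal_ge[OF y, of "\<lambda>_. 1"] eq that by fastforce
  have R: "set_integrable lborel {0..T} (R N) \<and> (\<forall>t\<in>{0..T}. 0 \<le> R N t \<and> R N t = neumann N t + R (Suc N) t)
      \<and> (LBINT t:{0..T}. R N t) \<le> \<rho> ^ N * (LBINT t:{0..T}. y t)" for N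
  proof (induction N)
    case 0
    then show ?case using y y0 eq by (simp add: R_def)
  next
    case (Suc N)
    have RS: "R (Suc M) = conv (R M)" for M by (simp add: R_def)
    have RN: "set_integrable lborel {0..T} (R N)" "\<And>t. t \<in> {0..T} \<Longrightarrow> 0 \<le> R N t"
      "\<And>t. t \<in> {0..T} \<Longrightarrow> R N t = neumann N t + R (Suc N) t"
      "(LBINT t:{0..T}. R N t) \<le> \<rho> ^ N * (LBINT t:{0..T}. y t)"
      using Suc by blast+
    have i: "set_integrable lborel {0..T} (R (Suc N))" unfolding RS using RN(1,2) by (rule conv_integrable)
    have nn: "0 \<le> R (Suc N) t" if "t \<in> {0..T}" for t unfolding RS using that RN(2) by (rule conv_nonneg)
    have "R (Suc N) t = neumann (Suc N) t + R (Suc (Suc N)) t" if t: "t \<in> {0..T}" for t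
    proof -
      have "R (Suc N) t = conv (\<lambda>s. neumann N s + R (Suc N) s) t"
        unfolding RS[of N] using RN(3) t unfolding RS[of N] by (intro conv_cong)
      also have "\<dots> = conv (neumann N) t + conv (R (Suc N)) t"
        using neumann_integrable i t by (rule conv_add)
      finally show ?thesis by (simp add: RS)
    qed
    moreover have "(LBINT t:{0..T}. R (Suc N) t) \<le> \<rho> ^ Suc N * (LBINT t:{0..T}. y t)"
    proof -
      have "(LBINT t:{0..T}. R (Suc N) t) \<le> \<rho> * (LBINT t:{0..T}. R N t)"
        unfolding RS using RN(1,2) by (rule conv_mass)
      also have "\<dots> \<le> \<rho> * (\<rho> ^ N * (LBINT t:{0..T}. y t))" using RN(4) \<rho>_bounds(1) by (rule mult_left_mono)
      finally show ?thesis by simp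
    qed
    ultimately show ?case using i nn by blast
  qed
  have part: "(\<Sum>n<N. simplex_mass T \<Phi> (Suc n)) = (LBINT t:{0..T}. y t) - (LBINT t:{0..T}. R N t)" for N
  proof (induction N)
    case (Suc N)
    have "(LBINT t:{0..T}. R N t) = (LBINT t:{0..T}. neumann N t + R (Suc N) t)"
      using R[of N] by (intro set_lebesgue_integral_cong) auto
    also have "\<dots> = simplex_mass T \<Phi> (Suc N) + (LBINT t:{0..T}. R (Suc N) t)"
      unfolding simplex_mass_eq using neumann_integrable R by (intro set_integral_add) auto
    finally show ?case using Suc by simp
  qed (simp add: R_def)
  have "(\<lambda>N. LBINT t:{0..T}. R N t) \<longlonglongrightarrow> 0"
  proof (rule tendsto_sandwich[OF _ _ tendsto_const])
    show "\<forall>\<^sub>F N in sequentially. 0 \<le> (LBINT t:{0..T}. R N t)"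
    proof (intro always_eventually allI)
      fix N
      have "0 \<le> indicator {0..T} t *\<^sub>R R N t" for t using R[of N] by (cases "t \<in> {0..T}") fastforce+
      then show "0 \<le> (LBINT t:{0..T}. R N t)"
        unfolding set_lebesgue_integral_def by (intro integral_nonneg_AE AE_I2)
    qed
    show "\<forall>\<^sub>F N in sequentially. (LBINT t:{0..T}. R N t) \<le> \<rho> ^ N * (LBINT t:{0..T}. y t)"
      using R by (intro always_eventually allI) blast
    show "(\<lambda>N. \<rho> ^ N * (LBINT t:{0..T}. y t)) \<longlonglongrightarrow> 0"
      using \<rho>_bounds by (intro tendsto_mult_left_zero LIMSEQ_realpow_zero)
  qed
  then have "(\<lambda>N. (LBINT t:{0..T}. y t) - (LBINT t:{0..T}. R N t)) \<longlonglongrightarrow> (LBINT t:{0..T}. y t) - 0"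
    by (intro tendsto_diff tendsto_const)
  then show ?thesis unfolding sums_def part by simp
qed

end

subsection \<open>Convergence of the discrete solutions\<close>

context volterra_kernel begin

text \<open>The cell averages of \<open>y1\<close> and \<open>y2\<close> are supersolutions for the
  shifted kernel. A factor slightly above 1 creates the room that
  \<open>volterra_le_supersolution\<close> asks for, and it tends to 1 with \<open>d\<close>; the
  averages sum back to the integrals exactly.\<close>

lemma discrete_sums_le:
  assumes n: "0 < n" and d: "d = T / real n"
    and y1: "set_integrable lborel {0..T} y1" "\<And>t. t \<in> {0..T} \<Longrightarrow> y1 t = 1 + conv y1 t"
    and y2: "set_integrable lborel {0..T} y2" "\<And>t. t \<in> {0..T} \<Longrightarrow> y2 t = (y1 t)\<^sup>2 + conv y2 t"
  defines "\<phi> \<equiv> \<lambda>i. d * \<Phi> (real i * d)"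
  defines "B \<equiv> exp (T * \<Phi> 0)"
  defines "e \<equiv> 2 * B * (d * \<Phi> 0)"
  shows "d * (\<Sum>k<n. volterra \<phi> (\<lambda>_. 1) k) \<le> (1 + e) * (LBINT t:{0..T}. y1 t)"
    and "d * (\<Sum>k<n. volterra \<phi> (\<lambda>k. (volterra \<phi> (\<lambda>_. 1) k)\<^sup>2) k)
       \<le> ((1 + e)\<^sup>2 + 2 * B ^ 3 * (d * \<Phi> 0)) * (LBINT t:{0..T}. y2 t)"
proof -
  have dpos: "0 < d" and dn: "real n * d = T" using n T by (auto simp: d)
  have idT: "real i * d \<le> T" if "i \<le> n" for i
    using that dpos unfolding dn[symmetric] by (intro mult_right_mono) auto
  have \<phi>0: "0 \<le> \<phi> i" if "i \<le> n" for i
    unfolding \<phi>_def using dpos idT[OF that] by (intro mult_nonneg_nonneg \<Phi>_nonneg) auto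
  have \<phi>_anti: "\<phi> j \<le> \<phi> i" if "i \<le> j" "j \<le> n" for i j
    unfolding \<phi>_def using dpos idT that by (intro mult_left_mono \<Phi>_anti mult_right_mono) auto
  have \<phi>00: "\<phi> 0 = d * \<Phi> 0" by (simp add: \<phi>_def)
  have B1: "1 \<le> B" unfolding B_def using T \<Phi>0 by simp
  have B: "B = exp (real n * \<phi> 0)"
    unfolding B_def \<phi>00 dn[symmetric] by simp
  define v where "v = volterra \<phi> (\<lambda>_. 1)"
  define u where "u = volterra \<phi> (\<lambda>k. (v k)\<^sup>2)"
  have v1: "1 \<le> v k" if "k < n" for k
    using volterra_ge[of n \<phi> "\<lambda>_. 1" k] \<phi>0 that by (simp add: v_def)
  have vB: "v k \<le> B" if "k < n" for k
    unfolding v_def B using volterra_le_exp[of n \<phi> "\<phi> 0" "\<lambda>_. 1" 1 k] \<phi>0 \<phi>_anti that by simp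
  have u0: "0 \<le> u k" if "k < n" for k
    using volterra_ge[of n \<phi> "\<lambda>k. (v k)\<^sup>2" k] \<phi>0 that unfolding u_def
    by (intro order.trans[OF zero_le_power2[of "v k"]]) simp
  \<comment> \<open>The forcing is at most \<open>B\<^sup>2\<close>, and the resolvent adds one more
    factor \<open>B\<close>.\<close>
  have uB: "u k \<le> B ^ 3" if k: "k < n" for k
  proof -
    have "u k \<le> B\<^sup>2 * exp (real n * \<phi> 0)" unfolding u_def
    proof (rule volterra_le_exp[of n \<phi> "\<phi> 0"])
      show "(v i)\<^sup>2 \<le> B\<^sup>2" if "i < n" for i using v1[OF that] vB[OF that] by (intro power_mono) auto
    qed (use \<phi>0 \<phi>_anti k in auto)
    also have "\<dots> = B\<^sup>2 * B" by (simp add: B)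
    finally show ?thesis by (simp add: power3_eq_cube power2_eq_square)
  qed
  have e0: "0 \<le> e" unfolding e_def using B1 dpos \<Phi>0 by simp
  have y1_ge: "1 \<le> y1 t" if "t \<in> {0..T}" for t
    using renewal_ge[OF y1(1), of "\<lambda>_. 1"] y1(2) that by simp
  \<comment> \<open>Integrability alone would not give square integrability; the equation itself
    makes \<open>y1\<close> bounded.\<close>
  have y1sq: "set_integrable lborel {0..T} (\<lambda>t. (y1 t)\<^sup>2)"
  proof -
    define A where "A = 1 + \<Phi> 0 * (LBINT s:{0..T}. y1 s)"
    have yA: "y1 t \<le> A" if "t \<in> {0..T}" for t
      unfolding A_def using y1_ge that by (intro renewal_bounded[OF y1(1) _ y1(2)]) (auto intro: order.trans[OF zero_le_one])
    have i: "integrable lborel (\<lambda>t. indicator {0..T} t * y1 t)" using y1(1) by (simp add: set_integrable_def)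
    have [measurable]: "(\<lambda>t. indicator {0..T} t * y1 t) \<in> borel_measurable borel"
      using borel_measurable_integrable[OF i] by simp
    have "integrable lborel (\<lambda>t. (indicator {0..T} t * y1 t)\<^sup>2)"
    proof (rule Bochner_Integration.integrable_bound[OF integrable_mult_right[OF i, of A]])
      have "(indicator {0..T} t * y1 t)\<^sup>2 \<le> A * (indicator {0..T} t * y1 t)" for t
        using yA[of t] y1_ge[of t] by (auto simp: power2_eq_square split: split_indicator)
      then show "AE t in lborel. norm ((indicator {0..T} t * y1 t)\<^sup>2) \<le> norm (A * (indicator {0..T} t * y1 t))"
        by (intro AE_I2) (auto intro: order.trans[OF _ abs_ge_self])
    qed simp
    moreover have "(indicator {0..T} t * y1 t)\<^sup>2 = indicator {0..T} t * (y1 t)\<^sup>2" for t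
      by (auto split: split_indicator)
    ultimately show ?thesis by (simp add: set_integrable_def)
  qed
  have y2_ge: "0 \<le> y2 t" if "t \<in> {0..T}" for t
    using renewal_ge[OF y2(1), of "\<lambda>t. (y1 t)\<^sup>2"] y2(2) that by (meson order.trans zero_le_power2)
  define \<psi>1 where "\<psi>1 = average d y1"
  define \<psi>2 where "\<psi>2 = average d y2"
  have av1: "average d (\<lambda>_. 1) k = 1" if "k < n" for k
    using measure_cell[OF dpos, of k 1] dpos by (simp add: average_def)
  have i1: "set_integrable lborel {0..T} (\<lambda>_. 1)"
    using integrable_const_Icc[of 1] by (simp add: set_integrable_def)
  have s1: "1 + (\<Sum>l<k. \<phi> (k + 1 - l) * \<psi>1 l) \<le> \<psi>1 k" if k: "k < n" for k
    using average_supersolution[OF dpos dn k y1(1) _ i1 y1(2)] y1_ge av1[OF k]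
    unfolding \<psi>1_def \<phi>_def by (auto intro: order.trans[OF zero_le_one])
  have \<psi>0: "0 \<le> average d y l" if "l < n" "\<And>t. t \<in> {0..T} \<Longrightarrow> 0 \<le> y t" for y :: "real \<Rightarrow> real" and l
  proof -
    have "0 \<le> indicator (cell d l) s *\<^sub>R y s" for s
      using cell_subset[OF dpos dn that(1)] that(2)[of s] by (auto split: split_indicator)
    then have "0 \<le> (LBINT s:cell d l. y s)"
      unfolding set_lebesgue_integral_def by (intro integral_nonneg_AE AE_I2)
    then show ?thesis unfolding average_def using dpos by simp
  qed
  have \<psi>1_ge: "1 \<le> \<psi>1 k" if k: "k < n" for k
  proof -
    have "0 \<le> \<phi> (k + 1 - l) * \<psi>1 l" if "l < k" for l
    proof -
      have "0 \<le> average d y1 l"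
        using that k by (intro \<psi>0 order.trans[OF zero_le_one y1_ge]) auto
      then show ?thesis unfolding \<psi>1_def using that k by (intro mult_nonneg_nonneg \<phi>0) auto
    qed
    then have "0 \<le> (\<Sum>l<k. \<phi> (k + 1 - l) * \<psi>1 l)" by (intro sum_nonneg) auto
    then show ?thesis using s1[OF k] by linarith
  qed
  have v\<psi>: "v k \<le> (1 + e) * \<psi>1 k" if k: "k < n" for k
    unfolding v_def
  proof (rule volterra_le_supersolution[where b="\<lambda>_. 1 + e" and B=B, OF \<phi>0 \<phi>_anti _ _ _ _ k])
    fix k assume k: "k < n"
    show "0 \<le> volterra \<phi> (\<lambda>_. 1) k" "volterra \<phi> (\<lambda>_. 1) k \<le> B"
      using v1[OF k] vB[OF k] by (auto simp: v_def)
    show "1 + 2 * B * \<phi> 0 \<le> 1 + e" by (simp add: e_def \<phi>00)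
    have "(1 + e) * (1 + (\<Sum>l<k. \<phi> (k + 1 - l) * \<psi>1 l)) \<le> (1 + e) * \<psi>1 k"
      using s1[OF k] e0 by (intro mult_left_mono) auto
    then show "1 + e + (\<Sum>l<k. \<phi> (k + 1 - l) * ((1 + e) * \<psi>1 l)) \<le> (1 + e) * \<psi>1 k"
      by (simp only: distrib_left sum_distrib_left mult.left_commute mult_1_right)
  qed auto
  have "d * (\<Sum>k<n. v k) \<le> d * (\<Sum>k<n. (1 + e) * \<psi>1 k)"
    using v\<psi> dpos by (intro mult_left_mono sum_mono) auto
  also have "\<dots> = (1 + e) * (\<Sum>k<n. d * \<psi>1 k)" by (simp add: sum_distrib_left mult_ac)
  also have "(\<Sum>k<n. d * \<psi>1 k) = (LBINT t:{0..T}. y1 t)"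
    unfolding \<psi>1_def by (rule sum_average[OF dpos dn y1(1)])
  finally show "d * (\<Sum>k<n. volterra \<phi> (\<lambda>_. 1) k) \<le> (1 + e) * (LBINT t:{0..T}. y1 t)" by (simp add: v_def)
  \<comment> \<open>The first summand is the square of the factor in
    \<open>v \<le> (1 + e) * \<psi>1\<close>; the second pays for the kernel shift with the bound
    \<open>B ^ 3\<close> on \<open>u\<close>, and can be made multiplicative because
    \<open>\<psi>1 \<ge> 1\<close>.\<close>
  define c where "c = (1 + e)\<^sup>2 + 2 * B ^ 3 * (d * \<Phi> 0)"
  have c0: "0 \<le> c" unfolding c_def using B1 dpos \<Phi>0 by simp
  have s2: "(\<psi>1 k)\<^sup>2 + (\<Sum>l<k. \<phi> (k + 1 - l) * \<psi>2 l) \<le> \<psi>2 k" if k: "k < n" for k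
    using average_supersolution[OF dpos dn k y2(1) y2_ge y1sq y2(2)] average_square_le[OF dpos dn k y1(1) y1sq]
    unfolding \<psi>1_def \<psi>2_def \<phi>_def by simp
  have u\<psi>: "u k \<le> c * \<psi>2 k" if k: "k < n" for k
    unfolding u_def
  proof (rule volterra_le_supersolution[where b="\<lambda>k. c * (\<psi>1 k)\<^sup>2" and B="B ^ 3", OF \<phi>0 \<phi>_anti _ _ _ _ k])
    fix k assume k: "k < n"
    show "0 \<le> volterra \<phi> (\<lambda>k. (v k)\<^sup>2) k" "volterra \<phi> (\<lambda>k. (v k)\<^sup>2) k \<le> B ^ 3"
      using u0[OF k] uB[OF k] by (auto simp: u_def)
    have "(v k)\<^sup>2 \<le> ((1 + e) * \<psi>1 k)\<^sup>2" using v\<psi>[OF k] v1[OF k] by (intro power_mono) auto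
    then have "(v k)\<^sup>2 \<le> (1 + e)\<^sup>2 * (\<psi>1 k)\<^sup>2" by (simp only: power_mult_distrib)
    moreover have "2 * B ^ 3 * \<phi> 0 * 1 \<le> 2 * B ^ 3 * \<phi> 0 * (\<psi>1 k)\<^sup>2"
    proof (rule mult_left_mono)
      show "1 \<le> (\<psi>1 k)\<^sup>2" using \<psi>1_ge[OF k] by simp
      show "0 \<le> 2 * B ^ 3 * \<phi> 0" using B1 \<phi>0[of 0] by simp
    qed
    ultimately show "(v k)\<^sup>2 + 2 * B ^ 3 * \<phi> 0 \<le> c * (\<psi>1 k)\<^sup>2"
      unfolding c_def \<phi>00 distrib_right[of "(1 + e)\<^sup>2"] by simp
    have "c * ((\<psi>1 k)\<^sup>2 + (\<Sum>l<k. \<phi> (k + 1 - l) * \<psi>2 l)) \<le> c * \<psi>2 k"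
      using s2[OF k] c0 by (intro mult_left_mono) auto
    then show "c * (\<psi>1 k)\<^sup>2 + (\<Sum>l<k. \<phi> (k + 1 - l) * (c * \<psi>2 l)) \<le> c * \<psi>2 k"
      by (simp only: distrib_left sum_distrib_left mult.left_commute)
  qed auto
  have "d * (\<Sum>k<n. u k) \<le> d * (\<Sum>k<n. c * \<psi>2 k)"
    using u\<psi> dpos by (intro mult_left_mono sum_mono) auto
  also have "\<dots> = c * (\<Sum>k<n. d * \<psi>2 k)" by (simp add: sum_distrib_left mult_ac)
  also have "(\<Sum>k<n. d * \<psi>2 k) = (LBINT t:{0..T}. y2 t)"
    unfolding \<psi>2_def by (rule sum_average[OF dpos dn y2(1)])
  finally show "d * (\<Sum>k<n. volterra \<phi> (\<lambda>k. (volterra \<phi> (\<lambda>_. 1) k)\<^sup>2) k)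
       \<le> ((1 + e)\<^sup>2 + 2 * B ^ 3 * (d * \<Phi> 0)) * (LBINT t:{0..T}. y2 t)"
    by (simp add: u_def v_def c_def)
qed

end

section \<open>Independence of the past and of later strips\<close>

lemma (in prob_space) indep_var_subalgebras:
  assumes F: "subalgebra M F" and G: "subalgebra M G"
    and ind: "indep_set (sets F) (sets G)"
    and X: "X \<in> F \<rightarrow>\<^sub>M S" and Y: "Y \<in> G \<rightarrow>\<^sub>M R"
  shows "indep_var S X R Y"
  unfolding indep_var_eq
proof (intro conjI)
  show "random_variable S X" "random_variable R Y"
    using measurable_from_subalg[OF F X] measurable_from_subalg[OF G Y] by auto
  have sp: "space F = space M" "space G = space M" using F G by (auto simp: subalgebra_def)
  have 1: "sigma_sets (space M) {X -` A \<inter> space M |A. A \<in> sets S} \<subseteq> sets F"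
    using measurable_sets[OF X] sp by (subst sp(1)[symmetric], intro sets.sigma_sets_subset) auto
  have 2: "sigma_sets (space M) {Y -` A \<inter> space M |A. A \<in> sets R} \<subseteq> sets G"
    using measurable_sets[OF Y] sp by (subst sp(2)[symmetric], intro sets.sigma_sets_subset) auto
  show "indep_set (sigma_sets (space M) {X -` A \<inter> space M |A. A \<in> sets S})
     (sigma_sets (space M) {Y -` A \<inter> space M |A. A \<in> sets R})"
    using ind 1 2 unfolding indep_sets2_eq by blast
qed

text \<open>An atom is named by the members of the family that contain its points, so any of its
  points recovers \<open>U\<close>.\<close>

lemma disjoint_atoms:
  assumes "U \<subseteq> \<D>" "U' \<subseteq> \<D>" "U \<noteq> U'"
  shows "(\<Inter>U - \<Union>(\<D> - U)) \<inter> (\<Inter>U' - \<Union>(\<D> - U')) = {}"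
proof (rule ccontr)
  assume "\<not> ?thesis"
  then obtain x where x: "x \<in> \<Inter>U - \<Union>(\<D> - U)" "x \<in> \<Inter>U' - \<Union>(\<D> - U')" by blast
  have "U = {D \<in> \<D>. x \<in> D}" using x(1) assms by auto
  moreover have "U' = {D \<in> \<D>. x \<in> D}" using x(2) assms by auto
  ultimately show False using assms by simp
qed

lemma natural_filtration_sets:
  "sets (natural_filtration M T N t) = sigma_sets (space M)
       {(\<lambda>\<omega>. emeasure (N \<omega>) A) -` B \<inter> space M | A B.
          A \<in> sets (strip_intensity T) \<and> A \<subseteq> {0..t} \<times> {0..} \<and> B \<in> sets borel}"
  unfolding natural_filtration_def by (rule sets_measure_of) auto

lemma space_natural_filtration: "space (natural_filtration M T N t) = space M"
  unfolding natural_filtration_def by (rule space_measure_of) auto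

lemma natural_filtration_subalgebra:
  assumes "poisson_random_measure M (strip_intensity T) N"
  shows "subalgebra M (natural_filtration M T N t)"
  unfolding subalgebra_def space_natural_filtration natural_filtration_sets
proof (intro conjI sets.sigma_sets_subset refl)
  show "{(\<lambda>\<omega>. emeasure (N \<omega>) A) -` B \<inter> space M | A B.
          A \<in> sets (strip_intensity T) \<and> A \<subseteq> {0..t} \<times> {0..} \<and> B \<in> sets borel} \<subseteq> sets M"
    using assms unfolding poisson_random_measure_def by (auto intro!: measurable_sets)
qed

lemma natural_filtration_mono:
  assumes "s \<le> t"
  shows "subalgebra (natural_filtration M T N t) (natural_filtration M T N s)"
  unfolding subalgebra_def space_natural_filtration natural_filtration_sets
  using assms by (intro conjI refl sigma_sets_mono') fastforce

text \<open>The definition gives independence for disjoint sets only, whereas the sets in a cylinder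
  may overlap. They are cut into the atoms of the algebra they generate: the counts on the atoms and
  on \<open>B\<close> are independent, and each original count is a sum of atom counts.\<close>

lemma (in prob_space) prm_cylinder_indep:
  assumes N: "poisson_random_measure M (strip_intensity T) N"
    and \<C>: "finite \<C>" "\<And>A S. (A, S) \<in> \<C> \<Longrightarrow> A \<in> sets (strip_intensity T) \<and> A \<inter> B = {} \<and> S \<in> sets borel"
    and B: "B \<in> sets (strip_intensity T)" and R: "R \<in> sets (borel :: ennreal measure)"
  shows "prob ({\<omega> \<in> space M. \<forall>(A, S) \<in> \<C>. emeasure (N \<omega>) A \<in> S} \<inter> {\<omega> \<in> space M. emeasure (N \<omega>) B \<in> R})
       = prob {\<omega> \<in> space M. \<forall>(A, S) \<in> \<C>. emeasure (N \<omega>) A \<in> S} * prob {\<omega> \<in> space M. emeasure (N \<omega>) B \<in> R}"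
proof -
  define \<D> where "\<D> = fst ` \<C>"
  have fD: "finite \<D>" using \<C> by (simp add: \<D>_def)
  have D: "A \<in> sets (strip_intensity T)" "A \<inter> B = {}" if "A \<in> \<D>" for A
    using that \<C>(2) by (force simp: \<D>_def)+
  \<comment> \<open>The empty pattern is left out: its atom lies outside all the given sets and
    could meet \<open>B\<close>.\<close>
  define J where "J = {U. U \<subseteq> \<D> \<and> U \<noteq> {}}"
  have "finite J" unfolding J_def using fD by (auto intro: finite_subset[of _ "Pow \<D>"])
  then obtain e where e: "bij_betw e {..<card J} J"
    using ex_bij_betw_nat_finite[of J] by (auto simp: atLeast0LessThan)
  define c where "c = card J"
  define atom where "atom U = \<Inter>U - \<Union>(\<D> - U)" for U :: "(real \<times> real) set set"
  \<comment> \<open>The atoms occupy the indices below \<open>c\<close>, and \<open>B\<close> has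
    the index \<open>c\<close>.\<close>
  define A' where "A' i = (if i < c then atom (e i) else B)" for i
  have eJ: "e i \<in> J" if "i < c" for i using e that by (auto simp: bij_betw_def c_def)
  have at_sets: "atom U \<in> sets (strip_intensity T)" if "U \<in> J" for U
  proof -
    have "\<Inter>U \<in> sets (strip_intensity T)"
    proof -
      have "finite U" "U \<noteq> {}" "\<And>A. A \<in> U \<Longrightarrow> A \<in> sets (strip_intensity T)"
        using that fD D by (auto simp: J_def intro: finite_subset)
      then show ?thesis using sets.finite_INT[of U "\<lambda>A. A"] by simp
    qed
    moreover have "\<Union>(\<D> - U) \<in> sets (strip_intensity T)"
      using fD D by (intro sets.finite_Union) auto
    ultimately show ?thesis unfolding atom_def by auto
  qed
  have at_B: "atom U \<inter> B = {}" if "U \<in> J" for U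
  proof -
    obtain A where "A \<in> U" "A \<in> \<D>" using \<open>U \<in> J\<close> by (auto simp: J_def)
    then show ?thesis using D(2)[of A] by (auto simp: atom_def)
  qed
  have A'_sets: "A' i \<in> sets (strip_intensity T)" for i
    unfolding A'_def using at_sets eJ B by auto
  have disj: "disjoint_family_on A' {..c}"
    unfolding disjoint_family_on_def
  proof (intro ballI impI)
    fix i j assume ij: "i \<in> {..c}" "j \<in> {..c}" "i \<noteq> j"
    consider "i < c" "j < c" | "i < c" "j = c" | "i = c" "j < c" using ij by force
    then show "A' i \<inter> A' j = {}"
    proof cases
      case 1
      then have "e i \<noteq> e j" using e ij by (auto simp: bij_betw_def inj_on_def c_def)
      then show ?thesis using 1 disjoint_atoms[of "e i" \<D> "e j"] eJ[of i] eJ[of j]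
        by (auto simp: A'_def atom_def J_def)
    next
      case 2
      then show ?thesis using at_B[OF eJ[of i]] by (simp add: A'_def)
    next
      case 3
      then show ?thesis using at_B[OF eJ[of j]] by (simp add: A'_def Int_commute)
    qed
  qed
  have "indep_vars (\<lambda>_. borel) (\<lambda>i \<omega>. emeasure (N \<omega>) (A' i)) {..c}"
    using N A'_sets disj unfolding poisson_random_measure_def by simp
  then have ind: "indep_var (PiM {..<c} (\<lambda>_. borel)) (\<lambda>\<omega>. \<lambda>i\<in>{..<c}. emeasure (N \<omega>) (A' i))
      (PiM {c} (\<lambda>_. borel)) (\<lambda>\<omega>. \<lambda>i\<in>{c}. emeasure (N \<omega>) (A' i))"
    by (rule indep_var_restrict) auto
  define Ev where "Ev = {x \<in> space (PiM {..<c} (\<lambda>_. borel :: ennreal measure)).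
      \<forall>p \<in> \<C>. (\<Sum>i\<in>{i. i < c \<and> fst p \<in> e i}. x i) \<in> snd p}"
  have Ev: "Ev \<in> sets (PiM {..<c} (\<lambda>_. borel))"
    unfolding Ev_def
  proof (rule sets.sets_Collect_finite_All[OF _ \<C>(1)])
    fix p assume "p \<in> \<C>"
    then have [measurable]: "snd p \<in> sets borel" using \<C>(2)[of "fst p" "snd p"] by simp
    have [measurable]: "(\<lambda>x. \<Sum>i\<in>{i. i < c \<and> fst p \<in> e i}. x i) \<in> borel_measurable (PiM {..<c} (\<lambda>_. borel :: ennreal measure))"
      by (intro borel_measurable_sum measurable_component_singleton) auto
    show "{x \<in> space (PiM {..<c} (\<lambda>_. borel :: ennreal measure)). (\<Sum>i\<in>{i. i < c \<and> fst p \<in> e i}. x i) \<in> snd p} \<in> sets (PiM {..<c} (\<lambda>_. borel))"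
      by measurable
  qed
  define Ew where "Ew = {x \<in> space (PiM {c} (\<lambda>_. borel :: ennreal measure)). x c \<in> R}"
  have Ew: "Ew \<in> sets (PiM {c} (\<lambda>_. borel))"
    unfolding Ew_def using R by measurable
  have sum_atoms: "emeasure (N \<omega>) A = (\<Sum>i\<in>{i. i < c \<and> A \<in> e i}. emeasure (N \<omega>) (A' i))"
    if "A \<in> \<D>" "\<omega> \<in> space M" for A \<omega>
  proof -
    have sN: "sets (N \<omega>) = sets (strip_intensity T)" using N that by (simp add: poisson_random_measure_def)
    have "A = (\<Union>i\<in>{i. i < c \<and> A \<in> e i}. A' i)"
    proof (intro equalityI subsetI)
      fix x assume "x \<in> A"
      define U where "U = {D \<in> \<D>. x \<in> D}"
      have "A \<in> U" "U \<in> J" using \<open>x \<in> A\<close> that by (auto simp: U_def J_def)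
      then have "U \<in> e ` {..<card J}" using e by (simp add: bij_betw_def)
      then obtain i where i: "i < c" "e i = U" by (auto simp: c_def)
      have "x \<in> atom U" by (auto simp: U_def atom_def)
      then show "x \<in> (\<Union>i\<in>{i. i < c \<and> A \<in> e i}. A' i)"
        using i \<open>A \<in> U\<close> by (auto simp: A'_def)
    next
      fix x assume "x \<in> (\<Union>i\<in>{i. i < c \<and> A \<in> e i}. A' i)"
      then show "x \<in> A" by (auto simp: A'_def atom_def)
    qed
    then have "emeasure (N \<omega>) A = emeasure (N \<omega>) (\<Union>i\<in>{i. i < c \<and> A \<in> e i}. A' i)"
      by (rule arg_cong)
    also have "\<dots> = (\<Sum>i\<in>{i. i < c \<and> A \<in> e i}. emeasure (N \<omega>) (A' i))"
      using A'_sets by (intro sum_emeasure[symmetric] disjoint_family_on_mono[OF _ disj]) (auto simp: sN)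
    finally show ?thesis .
  qed
  have 1: "{\<omega> \<in> space M. \<forall>(A, S) \<in> \<C>. emeasure (N \<omega>) A \<in> S}
      = (\<lambda>\<omega>. \<lambda>i\<in>{..<c}. emeasure (N \<omega>) (A' i)) -` Ev \<inter> space M"
  proof -
    have "(\<forall>(A, S) \<in> \<C>. emeasure (N \<omega>) A \<in> S) \<longleftrightarrow> (\<lambda>i\<in>{..<c}. emeasure (N \<omega>) (A' i)) \<in> Ev"
      if \<omega>: "\<omega> \<in> space M" for \<omega>
    proof -
      have "emeasure (N \<omega>) (fst p) = (\<Sum>i\<in>{i. i < c \<and> fst p \<in> e i}. (\<lambda>i\<in>{..<c}. emeasure (N \<omega>) (A' i)) i)"
        if "p \<in> \<C>" for p
        using that \<omega> by (subst sum_atoms) (auto simp: \<D>_def)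
      then show ?thesis unfolding Ev_def by (auto simp: split_beta space_PiM)
    qed
    then show ?thesis by auto
  qed
  have 2: "{\<omega> \<in> space M. emeasure (N \<omega>) B \<in> R}
      = (\<lambda>\<omega>. \<lambda>i\<in>{c}. emeasure (N \<omega>) (A' i)) -` Ew \<inter> space M"
    unfolding Ew_def by (auto simp: space_PiM A'_def)
  have "(\<lambda>\<omega>. ((\<lambda>i\<in>{..<c}. emeasure (N \<omega>) (A' i)), (\<lambda>i\<in>{c}. emeasure (N \<omega>) (A' i)))) -` (Ev \<times> Ew) \<inter> space M
     = {\<omega> \<in> space M. \<forall>(A, S) \<in> \<C>. emeasure (N \<omega>) A \<in> S} \<inter> {\<omega> \<in> space M. emeasure (N \<omega>) B \<in> R}"
    unfolding 1 2 by auto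
  then show ?thesis using indep_varD[OF ind Ev Ew] unfolding 1 2 by simp
qed

text \<open>The finite cylinders generate the past and form a pi-system, since intersecting two of
  them amounts to uniting their sets of constraints. Independence therefore extends from
  \<open>prm_cylinder_indep\<close>.\<close>

lemma (in prob_space) prm_past_indep:
  assumes N: "poisson_random_measure M (strip_intensity T) N"
    and B: "B \<in> sets (strip_intensity T)" "B \<inter> ({0..t} \<times> {0..}) = {}"
  shows "indep_set (sets (natural_filtration M T N t))
     (sets (vimage_algebra (space M) (\<lambda>\<omega>. emeasure (N \<omega>) B) borel))"
proof -
  define \<A> where "\<A> = {{\<omega> \<in> space M. \<forall>(A, S) \<in> \<C>. emeasure (N \<omega>) A \<in> S} | \<C>. finite \<C> \<and>
      (\<forall>(A, S) \<in> \<C>. A \<in> sets (strip_intensity T) \<and> A \<subseteq> {0..t} \<times> {0..} \<and> S \<in> sets borel)}"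
  define \<B> where "\<B> = {(\<lambda>\<omega>. emeasure (N \<omega>) B) -` S \<inter> space M | S. S \<in> sets borel}"
  have meas: "(\<lambda>\<omega>. emeasure (N \<omega>) A) \<in> borel_measurable M" if "A \<in> sets (strip_intensity T)" for A
    using N that by (simp add: poisson_random_measure_def)
  have "indep_set \<A> \<B>"
    unfolding indep_sets2_eq
  proof (intro conjI ballI)
    show "\<A> \<subseteq> events"
    proof
      fix a assume "a \<in> \<A>"
      then obtain \<C> where \<C>: "a = {\<omega> \<in> space M. \<forall>p \<in> \<C>. emeasure (N \<omega>) (fst p) \<in> snd p}" "finite \<C>"
        "\<forall>p \<in> \<C>. fst p \<in> sets (strip_intensity T) \<and> snd p \<in> sets borel"
        unfolding \<A>_def by (force simp: split_beta)
      have "{\<omega> \<in> space M. emeasure (N \<omega>) (fst p) \<in> snd p} \<in> events" if "p \<in> \<C>" for p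
        using measurable_sets[OF meas, of "fst p" "snd p"] \<C>(3) that
        by (simp add: vimage_def Int_def conj_commute)
      then show "a \<in> events" unfolding \<C>(1) using \<C>(2) by (intro sets.sets_Collect_finite_All) auto
    qed
    show "\<B> \<subseteq> events" unfolding \<B>_def using meas[OF B(1)] by (auto intro: measurable_sets)
    fix a b assume a: "a \<in> \<A>" and b: "b \<in> \<B>"
    obtain \<C> where \<C>: "a = {\<omega> \<in> space M. \<forall>(A, S) \<in> \<C>. emeasure (N \<omega>) A \<in> S}" "finite \<C>"
      "\<forall>(A, S) \<in> \<C>. A \<in> sets (strip_intensity T) \<and> A \<subseteq> {0..t} \<times> {0..} \<and> S \<in> sets borel"
      using a unfolding \<A>_def by blast
    obtain S where S: "b = {\<omega> \<in> space M. emeasure (N \<omega>) B \<in> S}" "S \<in> sets borel"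
      using b unfolding \<B>_def by (auto simp: vimage_def Int_def conj_commute)
    show "prob (a \<inter> b) = prob a * prob b"
      unfolding \<C>(1) S(1) using \<C>(3) B
      by (intro prm_cylinder_indep[OF N \<C>(2) _ B(1) S(2)]) blast
  qed
  moreover have "Int_stable \<A>"
  proof (rule Int_stableI)
    fix a b assume "a \<in> \<A>" "b \<in> \<A>"
    then obtain \<C> \<C>' where
      "a = {\<omega> \<in> space M. \<forall>(A, S) \<in> \<C>. emeasure (N \<omega>) A \<in> S}" "finite \<C>"
      "\<forall>(A, S) \<in> \<C>. A \<in> sets (strip_intensity T) \<and> A \<subseteq> {0..t} \<times> {0..} \<and> S \<in> sets borel"
      "b = {\<omega> \<in> space M. \<forall>(A, S) \<in> \<C>'. emeasure (N \<omega>) A \<in> S}" "finite \<C>'"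
      "\<forall>(A, S) \<in> \<C>'. A \<in> sets (strip_intensity T) \<and> A \<subseteq> {0..t} \<times> {0..} \<and> S \<in> sets borel"
      unfolding \<A>_def by blast
    then show "a \<inter> b \<in> \<A>"
      unfolding \<A>_def by (intro CollectI exI[of _ "\<C> \<union> \<C>'"]) auto
  qed
  moreover have "Int_stable \<B>"
  proof (rule Int_stableI)
    fix a b assume "a \<in> \<B>" "b \<in> \<B>"
    then obtain S S' where "S \<in> sets borel" "S' \<in> sets borel"
      "a = (\<lambda>\<omega>. emeasure (N \<omega>) B) -` S \<inter> space M" "b = (\<lambda>\<omega>. emeasure (N \<omega>) B) -` S' \<inter> space M"
      unfolding \<B>_def by blast
    then show "a \<inter> b \<in> \<B>" unfolding \<B>_def by (intro CollectI exI[of _ "S \<inter> S'"]) auto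
  qed
  ultimately have ind: "indep_set (sigma_sets (space M) \<A>) (sigma_sets (space M) \<B>)"
    by (rule indep_set_sigma_sets)
  have "sets (natural_filtration M T N t) \<subseteq> sigma_sets (space M) \<A>"
    unfolding natural_filtration_sets
  proof (rule sigma_sets_mono', safe)
    fix A S assume "A \<in> sets (strip_intensity T)" "A \<subseteq> {0..t} \<times> {0..}" "S \<in> sets (borel :: ennreal measure)"
    then show "(\<lambda>\<omega>. emeasure (N \<omega>) A) -` S \<inter> space M \<in> \<A>"
      unfolding \<A>_def by (intro CollectI exI[of _ "{(A, S)}"]) auto
  qed
  then show ?thesis
    using ind unfolding indep_sets2_eq sets_vimage_algebra \<B>_def by blast
qed

lemma (in prob_space) expectation_past_times_indicator:
  assumes N: "poisson_random_measure M (strip_intensity T) N"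
    and B: "B \<in> sets (strip_intensity T)" "B \<inter> ({0..t} \<times> {0..}) = {}"
    and W: "W \<in> borel_measurable (natural_filtration M T N t)" "integrable M W"
    and S: "S \<in> sets borel"
  shows "(\<integral>\<omega>. W \<omega> * indicator S (emeasure (N \<omega>) B) \<partial>M)
     = (\<integral>\<omega>. W \<omega> \<partial>M) * prob {\<omega> \<in> space M. emeasure (N \<omega>) B \<in> S}"
proof -
  let ?G = "vimage_algebra (space M) (\<lambda>\<omega>. emeasure (N \<omega>) B) borel"
  have meas: "(\<lambda>\<omega>. emeasure (N \<omega>) B) \<in> borel_measurable M"
    using N B(1) by (simp add: poisson_random_measure_def)
  have G: "subalgebra M ?G"
    unfolding subalgebra_def using sets_vimage_algebra_space[of M] meas
    by (auto simp: sets_vimage_algebra2[of _ "space M" borel] measurable_sets)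
  have ind: "(\<lambda>\<omega>. indicator S (emeasure (N \<omega>) B) :: real) \<in> borel_measurable ?G"
    by (intro measurable_compose[OF measurable_vimage_algebra1 borel_measurable_indicator[OF S]]) auto
  have "indep_var borel W borel (\<lambda>\<omega>. indicator S (emeasure (N \<omega>) B) :: real)"
    using natural_filtration_subalgebra[OF N] G prm_past_indep[OF N B] W(1) ind
    by (rule indep_var_subalgebras)
  moreover have i2: "integrable M (\<lambda>\<omega>. indicator S (emeasure (N \<omega>) B) :: real)"
    using measurable_from_subalg[OF G ind] by (intro integrable_const_bound[of _ 1]) (auto split: split_indicator)
  ultimately have "(\<integral>\<omega>. W \<omega> * indicator S (emeasure (N \<omega>) B) \<partial>M)
     = (\<integral>\<omega>. W \<omega> \<partial>M) * (\<integral>\<omega>. indicator S (emeasure (N \<omega>) B) \<partial>M)"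
    using W(2) by (intro indep_var_lebesgue_integral)
  also have "(\<integral>\<omega>. indicator S (emeasure (N \<omega>) B) \<partial>M) = (\<integral>\<omega>. indicator {\<omega> \<in> space M. emeasure (N \<omega>) B \<in> S} \<omega> \<partial>M)"
    by (intro Bochner_Integration.integral_cong) (auto split: split_indicator)
  also have "\<dots> = prob {\<omega> \<in> space M. emeasure (N \<omega>) B \<in> S}"
    by (simp add: Int_def conj_commute)
  finally show ?thesis .
qed

section \<open>The first two moments of the Hawkes process\<close>

locale hawkes_model = prob_space M + volterra_kernel T \<Phi>
  for M :: "'a measure" and T :: real and \<Phi> :: "real \<Rightarrow> real" +
  fixes \<mu> :: real and N :: "'a \<Rightarrow> (real \<times> real) measure"
    and H :: "real \<Rightarrow> 'a \<Rightarrow> nat" and \<Lambda> :: "real \<Rightarrow> 'a \<Rightarrow> real"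
  assumes \<mu>: "0 < \<mu>"
    and N: "poisson_random_measure M (strip_intensity T) N"
    and H: "hawkes_solution M T \<mu> \<Phi> N H \<Lambda>"
begin

lemma paths: "AE \<omega> in M. hawkes_path T \<mu> \<Phi> (N \<omega>) (\<lambda>t. H t \<omega>) (\<lambda>t. \<Lambda> t \<omega>)"
proof -
  have "AE \<omega> in M. \<forall>t\<in>{0..T}.
        of_nat (H t \<omega>) = (\<integral>\<^sup>+ p \<in> {0<..t} \<times> {0..}. indicator {\<theta>. \<theta> \<le> \<Lambda> (fst p) \<omega>} (snd p) \<partial>N \<omega>) \<and>
        \<Lambda> t \<omega> = \<mu> + (LINT u:{0<..<t}|path_measure T (\<lambda>s. H s \<omega>). \<Phi> (t - u))"
    using H by (simp add: hawkes_solution_def)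
  then show ?thesis
    using AE_space
  proof eventually_elim
    case (elim \<omega>)
    show ?case
    proof
      show "sets (N \<omega>) = sets (strip_intensity T)" using N elim by (simp add: poisson_random_measure_def)
    qed (use T \<mu> \<Phi>_meas \<Phi>_nonneg \<Phi>_anti elim in auto)
  qed
qed

text \<open>Natural-number subtraction and truncation keep the value between 0 and \<open>K\<close>
  at every sample point, also on the null set where the path need not be monotone.\<close>

definition incr :: "nat \<Rightarrow> real \<Rightarrow> nat \<Rightarrow> 'a \<Rightarrow> nat" where
  "incr K d j \<omega> = min (H (real (Suc j) * d) \<omega>) K - min (H (real j * d) \<omega>) K"

text \<open>The upper intensity of the grid bound, with truncated increments; it is known at time
  \<open>i * d\<close>.\<close>

definition rate :: "nat \<Rightarrow> real \<Rightarrow> nat \<Rightarrow> 'a \<Rightarrow> real" where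
  "rate K d i \<omega> = \<mu> + (\<Sum>j<i. \<Phi> (real (i - 1 - j) * d) * real (incr K d j \<omega>))"

definition strip :: "real \<Rightarrow> nat \<Rightarrow> real \<Rightarrow> (real \<times> real) set" where
  "strip d i c = {real i * d<..real (Suc i) * d} \<times> {0..c}"

text \<open>Off \<open>multi\<close>, a jump of the truncated process in the \<open>i\<close>-th cell implies \<open>hit\<close>, whose strip is
  known at the beginning of the cell.\<close>

definition hit :: "nat \<Rightarrow> real \<Rightarrow> nat \<Rightarrow> 'a set" where
  "hit K d i = {\<omega> \<in> space M. 1 \<le> emeasure (N \<omega>) (strip d i (rate K d i \<omega>))}"

definition multi :: "nat \<Rightarrow> real \<Rightarrow> nat \<Rightarrow> 'a set" where
  "multi K d i = {\<omega> \<in> space M. 2 \<le> emeasure (N \<omega>) (strip d i (\<mu> + \<Phi> 0 * real K))}"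

section \<open>Point counts in the strips over the cells\<close>

lemma grid_le: "0 < d \<Longrightarrow> real n * d = T \<Longrightarrow> i \<le> n \<Longrightarrow> real i * d \<le> T"
proof -
  assume *: "0 < d" "real n * d = T" "i \<le> n"
  then have "real i * d \<le> real n * d" by (intro mult_right_mono) auto
  then show ?thesis using * by simp
qed

lemma strip_sets: "0 < d \<Longrightarrow> real n * d = T \<Longrightarrow> i < n \<Longrightarrow> strip d i c \<in> sets (strip_intensity T)"
  unfolding strip_def using grid_le[of d n "Suc i"] by (intro box_strip) auto

lemma measure_strip:
  assumes "0 < d" "real n * d = T" "i < n" "0 \<le> c"
  shows "measure (strip_intensity T) (strip d i c) = d * c" "emeasure (strip_intensity T) (strip d i c) < \<infinity>"
proof -
  have "emeasure (strip_intensity T) (strip d i c) = ennreal ((real (Suc i) * d - real i * d) * c)"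
    unfolding strip_def using grid_le[of d n "Suc i"] assms
    by (intro emeasure_box_strip) (auto intro: mult_right_mono)
  also have "(real (Suc i) * d - real i * d) * c = d * c" by (simp add: algebra_simps)
  finally have e: "emeasure (strip_intensity T) (strip d i c) = ennreal (d * c)" .
  show "measure (strip_intensity T) (strip d i c) = d * c" using assms by (simp add: measure_def e)
  show "emeasure (strip_intensity T) (strip d i c) < \<infinity>" by (simp add: e)
qed

lemma count_measurable: "A \<in> sets (strip_intensity T) \<Longrightarrow> (\<lambda>\<omega>. emeasure (N \<omega>) A) \<in> borel_measurable M"
  using N by (simp add: poisson_random_measure_def)

lemma prob_count_eq:
  assumes "0 < d" "real n * d = T" "i < n" "0 \<le> c"
  shows "prob {\<omega> \<in> space M. emeasure (N \<omega>) (strip d i c) = of_nat k} = exp (- (d * c)) * (d * c) ^ k / fact k"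
proof -
  have "\<forall>A\<in>sets (strip_intensity T). emeasure (strip_intensity T) A < \<infinity> \<longrightarrow>
        (\<forall>k::nat. prob {\<omega> \<in> space M. emeasure (N \<omega>) A = of_nat k}
                  = exp (- measure (strip_intensity T) A) * measure (strip_intensity T) A ^ k / fact k)"
    using N unfolding poisson_random_measure_def by (elim conjE)
  then have "prob {\<omega> \<in> space M. emeasure (N \<omega>) (strip d i c) = of_nat k}
      = exp (- measure (strip_intensity T) (strip d i c)) * measure (strip_intensity T) (strip d i c) ^ k / fact k"
    using strip_sets[OF assms(1-3)] measure_strip(2)[OF assms] by blast
  then show ?thesis unfolding measure_strip(1)[OF assms] .
qed

text \<open>Only the probabilities of natural-number counts are prescribed, hence the passage to the
  complement of the count 0; then \<open>1 - exp (- x) \<le> x\<close>.\<close>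

lemma prob_ge_1:
  assumes "0 < d" "real n * d = T" "i < n" "0 \<le> c"
  shows "prob {\<omega> \<in> space M. emeasure (N \<omega>) (strip d i c) \<in> {1..}} \<le> d * c"
proof -
  note [measurable] = count_measurable[OF strip_sets[OF assms(1-3), of c]]
  have "prob {\<omega> \<in> space M. emeasure (N \<omega>) (strip d i c) \<in> {1..}}
      \<le> prob (space M - {\<omega> \<in> space M. emeasure (N \<omega>) (strip d i c) = of_nat 0})"
    by (intro finite_measure_mono) auto
  also have "\<dots> = 1 - exp (- (d * c))"
    using prob_count_eq[OF assms, of 0] by (subst prob_compl) auto
  also have "\<dots> \<le> d * c" using exp_ge_add_one_self[of "- (d * c)"] by simp
  finally show ?thesis .
qed

lemma prob_ge_2:
  assumes "0 < d" "real n * d = T" "i < n" "0 \<le> c"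
  shows "prob {\<omega> \<in> space M. 2 \<le> emeasure (N \<omega>) (strip d i c)} \<le> (d * c)\<^sup>2"
proof -
  let ?X = "\<lambda>\<omega>. emeasure (N \<omega>) (strip d i c)" and ?x = "d * c"
  note [measurable] = count_measurable[OF strip_sets[OF assms(1-3), of c]]
  have "prob {\<omega> \<in> space M. 2 \<le> ?X \<omega>}
      \<le> prob (space M - ({\<omega> \<in> space M. ?X \<omega> = of_nat 0} \<union> {\<omega> \<in> space M. ?X \<omega> = of_nat 1}))"
    by (intro finite_measure_mono) auto
  also have "\<dots> = 1 - (prob {\<omega> \<in> space M. ?X \<omega> = of_nat 0} + prob {\<omega> \<in> space M. ?X \<omega> = of_nat 1})"
    by (subst prob_compl, measurable, subst finite_measure_Union) auto
  also have "\<dots> = 1 - exp (- ?x) * (1 + ?x)"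
    using prob_count_eq[OF assms, of 0] prob_count_eq[OF assms, of 1] by (simp add: algebra_simps)
  \<comment> \<open>From \<open>exp (- x) \<ge> 1 - x\<close> and
    \<open>(1 - x) * (1 + x) = 1 - x^2\<close>.\<close>
  also have "\<dots> \<le> ?x\<^sup>2"
  proof -
    have x0: "0 \<le> ?x" using assms by simp
    have "(1 - ?x) * (1 + ?x) \<le> exp (- ?x) * (1 + ?x)"
      using exp_ge_add_one_self[of "- ?x"] x0 by (intro mult_right_mono) auto
    then show ?thesis by (simp add: power2_eq_square algebra_simps)
  qed
  finally show ?thesis .
qed

section \<open>Adaptedness, and the probability of a jump given the past\<close>

lemma H_measurable:
  assumes "0 \<le> s" "s \<le> t" "t \<le> T"
  shows "(\<lambda>\<omega>. real (H s \<omega>)) \<in> borel_measurable (natural_filtration M T N t)"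
proof -
  have "H s \<in> natural_filtration M T N s \<rightarrow>\<^sub>M count_space UNIV"
  proof -
    have "\<forall>t\<in>{0..T}. H t \<in> natural_filtration M T N t \<rightarrow>\<^sub>M count_space UNIV"
      using H unfolding hawkes_solution_def by (elim conjE)
    then show ?thesis using assms by auto
  qed
  then have "H s \<in> natural_filtration M T N t \<rightarrow>\<^sub>M count_space UNIV"
    using natural_filtration_mono[OF assms(2)] by (rule measurable_from_subalg[rotated])
  then show ?thesis by (rule measurable_compose) simp
qed

lemma incr_measurable:
  assumes "0 < d" "real n * d = T" "j < i" "i \<le> n"
  shows "(\<lambda>\<omega>. real (incr K d j \<omega>)) \<in> borel_measurable (natural_filtration M T N (real i * d))"
proof -
  have "real (Suc j) * d \<le> real i * d" "real j * d \<le> real i * d" using assms by (auto intro!: mult_right_mono)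
  moreover have "0 \<le> real j * d" "0 \<le> real (Suc j) * d" using assms(1) by simp_all
  ultimately have [measurable]: "(\<lambda>\<omega>. real (H (real j * d) \<omega>)) \<in> borel_measurable (natural_filtration M T N (real i * d))"
    "(\<lambda>\<omega>. real (H (real (Suc j) * d) \<omega>)) \<in> borel_measurable (natural_filtration M T N (real i * d))"
    using grid_le[OF assms(1,2,4)] by (blast intro: H_measurable)+
  have eq: "real (incr K d j \<omega>) = max 0 (min (real (H (real (Suc j) * d) \<omega>)) (real K) - min (real (H (real j * d) \<omega>)) (real K))" for \<omega>
    unfolding incr_def by (auto simp: min_def max_def of_nat_diff)
  show ?thesis unfolding eq by measurable
qed

lemma rate_measurable:
  assumes "0 < d" "real n * d = T" "i \<le> n"
  shows "rate K d i \<in> borel_measurable (natural_filtration M T N (real i * d))"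
  unfolding rate_def[abs_def] using incr_measurable[OF assms(1,2) _ assms(3)]
  by (intro borel_measurable_add borel_measurable_sum borel_measurable_times borel_measurable_const) auto

text \<open>Finitely many values allow conditioning on the rate through a finite sum, each summand
  involving a strip of deterministic height.\<close>

lemma rate_finite: "finite (range (rate K d i))"
proof -
  let ?f = "\<lambda>x. \<mu> + (\<Sum>j<i. \<Phi> (real (i - 1 - j) * d) * real (x j))"
  have "range (rate K d i) \<subseteq> ?f ` PiE {..<i} (\<lambda>_. {0..K})"
  proof
    fix y assume "y \<in> range (rate K d i)"
    then obtain \<omega> where y: "y = rate K d i \<omega>" by blast
    have "y = ?f (\<lambda>j\<in>{..<i}. incr K d j \<omega>)" unfolding y rate_def by simp
    moreover have "(\<lambda>j\<in>{..<i}. incr K d j \<omega>) \<in> PiE {..<i} (\<lambda>_. {0..K})"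
      by (auto simp: incr_def)
    ultimately show "y \<in> ?f ` PiE {..<i} (\<lambda>_. {0..K})" by blast
  qed
  moreover have "finite (PiE {..<i} (\<lambda>_. {0..K}))" by (intro finite_PiE) auto
  ultimately show ?thesis by (meson finite_imageI finite_subset)
qed

lemma rate_ge: "0 < d \<Longrightarrow> real n * d = T \<Longrightarrow> i \<le> n \<Longrightarrow> \<mu> \<le> rate K d i \<omega>"
proof -
  assume *: "0 < d" "real n * d = T" "i \<le> n"
  have nn: "0 \<le> \<Phi> (real (i - 1 - j) * d)" for j
    using grid_le[OF *(1,2), of "i - 1 - j"] * by (intro \<Phi>_nonneg) auto
  have "0 \<le> (\<Sum>j<i. \<Phi> (real (i - 1 - j) * d) * real (incr K d j \<omega>))"
    by (intro sum_nonneg mult_nonneg_nonneg nn of_nat_0_le_iff)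
  then show ?thesis unfolding rate_def by linarith
qed

lemma hit_eq:
  "hit K d i = (\<Union>c\<in>range (rate K d i). {\<omega> \<in> space M. rate K d i \<omega> = c} \<inter> {\<omega> \<in> space M. emeasure (N \<omega>) (strip d i c) \<in> {1..}})"
  unfolding hit_def by auto

lemma filtration_subalgebra: "subalgebra M (natural_filtration M T N t)"
  by (rule natural_filtration_subalgebra[OF N])

lemma hit_event:
  assumes "0 < d" "real n * d = T" "i < n"
  shows "hit K d i \<in> events"
proof -
  have [measurable]: "rate K d i \<in> borel_measurable M"
    using measurable_from_subalg[OF filtration_subalgebra rate_measurable] assms by simp
  have "{\<omega> \<in> space M. emeasure (N \<omega>) (strip d i c) \<in> {1..}} \<in> events" for c
    using count_measurable[OF strip_sets[OF assms, of c]] by measurable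
  then show ?thesis unfolding hit_eq using rate_finite
    by (intro sets.finite_UN sets.Int) auto
qed

lemma multi_event:
  assumes "0 < d" "real n * d = T" "i < n"
  shows "multi K d i \<in> events"
  unfolding multi_def using count_measurable[OF strip_sets[OF assms, of "\<mu> + \<Phi> 0 * real K"]] by measurable

text \<open>On the event that the rate equals \<open>c\<close> the strip is deterministic and lies
  strictly after time \<open>i * d\<close>, so its count is independent of the past; the probability
  of a point in it is at most its area \<open>d * c\<close>.\<close>

lemma expectation_hit_le:
  assumes d: "0 < d" "real n * d = T" "i < n"
    and W: "W \<in> borel_measurable (natural_filtration M T N (real i * d))" "\<And>\<omega>. 0 \<le> W \<omega>" "\<And>\<omega>. W \<omega> \<le> b"
  shows "(\<integral>\<omega>. W \<omega> * indicator (hit K d i) \<omega> \<partial>M) \<le> (\<integral>\<omega>. W \<omega> * (d * rate K d i \<omega>) \<partial>M)"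
proof -
  let ?F = "natural_filtration M T N (real i * d)"
  let ?R = "range (rate K d i)"
  define Wc where "Wc c \<omega> = W \<omega> * indicator {c} (rate K d i \<omega>)" for c \<omega>
  have rm [measurable]: "rate K d i \<in> borel_measurable ?F" using d by (intro rate_measurable) auto
  note [measurable] = W(1)
  have Wc_meas: "Wc c \<in> borel_measurable ?F" for c
    unfolding Wc_def[abs_def] by measurable
  have Wc_int: "integrable M (Wc c)" for c
    using measurable_from_subalg[OF filtration_subalgebra Wc_meas] W(2,3)
    by (intro integrable_const_bound[of _ b])
      (auto simp: Wc_def split: split_indicator intro: order.trans[OF W(2) W(3)])
  have Wc_ind_int: "integrable M (\<lambda>\<omega>. Wc c \<omega> * indicator {1..} (emeasure (N \<omega>) (strip d i c)))" for c
  proof (rule Bochner_Integration.integrable_bound[OF Wc_int[of c]])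
    show "(\<lambda>\<omega>. Wc c \<omega> * indicator {1..} (emeasure (N \<omega>) (strip d i c))) \<in> borel_measurable M"
      using measurable_from_subalg[OF filtration_subalgebra Wc_meas] count_measurable[OF strip_sets[OF d, of c]]
      by measurable
  qed (auto split: split_indicator)
  have "(\<integral>\<omega>. W \<omega> * indicator (hit K d i) \<omega> \<partial>M)
      = (\<integral>\<omega>. (\<Sum>c\<in>?R. Wc c \<omega> * indicator {1..} (emeasure (N \<omega>) (strip d i c))) \<partial>M)"
  proof (rule Bochner_Integration.integral_cong[OF refl])
    fix \<omega> assume "\<omega> \<in> space M"
    have sing: "(\<Sum>c\<in>{x}. G c) = G x" for G :: "real \<Rightarrow> real" and x by simp
    have "(\<Sum>c\<in>?R. Wc c \<omega> * indicator {1..} (emeasure (N \<omega>) (strip d i c)))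
        = (\<Sum>c\<in>{rate K d i \<omega>}. Wc c \<omega> * indicator {1..} (emeasure (N \<omega>) (strip d i c)))"
      using rate_finite by (intro sum.mono_neutral_right) (auto simp: Wc_def)
    also have "\<dots> = W \<omega> * indicator (hit K d i) \<omega>"
      unfolding sing using \<open>\<omega> \<in> space M\<close> by (simp add: Wc_def hit_def split: split_indicator)
    finally show "W \<omega> * indicator (hit K d i) \<omega>
       = (\<Sum>c\<in>?R. Wc c \<omega> * indicator {1..} (emeasure (N \<omega>) (strip d i c)))" ..
  qed
  also have "\<dots> = (\<Sum>c\<in>?R. \<integral>\<omega>. Wc c \<omega> * indicator {1..} (emeasure (N \<omega>) (strip d i c)) \<partial>M)"
    by (rule Bochner_Integration.integral_sum[OF Wc_ind_int])
  also have "\<dots> \<le> (\<Sum>c\<in>?R. (\<integral>\<omega>. Wc c \<omega> * (d * rate K d i \<omega>) \<partial>M))"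
  proof (rule sum_mono)
    fix c assume "c \<in> ?R"
    then have c0: "0 \<le> c" using rate_ge[OF d(1,2), of i K] d \<mu> by (auto intro: order.trans[OF less_imp_le])
    have "(\<integral>\<omega>. Wc c \<omega> * indicator {1..} (emeasure (N \<omega>) (strip d i c)) \<partial>M)
       = expectation (Wc c) * prob {\<omega> \<in> space M. emeasure (N \<omega>) (strip d i c) \<in> {1..}}"
      using strip_sets[OF d, of c] by (intro expectation_past_times_indicator[OF N _ _ Wc_meas Wc_int]) (auto simp: strip_def)
    also have "\<dots> \<le> expectation (Wc c) * (d * c)"
      using W(2) by (intro mult_left_mono prob_ge_1[OF d c0] integral_nonneg_AE AE_I2) (auto simp: Wc_def)
    also have "\<dots> = (\<integral>\<omega>. Wc c \<omega> * (d * rate K d i \<omega>) \<partial>M)"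
      by (subst integral_mult_left_zero[symmetric], intro Bochner_Integration.integral_cong)
        (auto simp: Wc_def split: split_indicator)
    finally show "(\<integral>\<omega>. Wc c \<omega> * indicator {1..} (emeasure (N \<omega>) (strip d i c)) \<partial>M)
       \<le> (\<integral>\<omega>. Wc c \<omega> * (d * rate K d i \<omega>) \<partial>M)" .
  qed
  also have "\<dots> = (\<integral>\<omega>. (\<Sum>c\<in>?R. Wc c \<omega> * (d * rate K d i \<omega>)) \<partial>M)"
  proof (rule Bochner_Integration.integral_sum[symmetric])
    fix c
    have "(\<lambda>\<omega>. Wc c \<omega> * (d * rate K d i \<omega>)) = (\<lambda>\<omega>. Wc c \<omega> * (d * c))"
      by (auto simp: Wc_def fun_eq_iff split: split_indicator)
    then show "integrable M (\<lambda>\<omega>. Wc c \<omega> * (d * rate K d i \<omega>))" using Wc_int[of c] by simp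
  qed
  also have "\<dots> = (\<integral>\<omega>. W \<omega> * (d * rate K d i \<omega>) \<partial>M)"
  proof (rule Bochner_Integration.integral_cong[OF refl])
    fix \<omega>
    have "(\<Sum>c\<in>?R. Wc c \<omega> * (d * rate K d i \<omega>)) = (\<Sum>c\<in>{rate K d i \<omega>}. Wc c \<omega> * (d * rate K d i \<omega>))"
      using rate_finite by (intro sum.mono_neutral_right) (auto simp: Wc_def)
    then show "(\<Sum>c\<in>?R. Wc c \<omega> * (d * rate K d i \<omega>)) = W \<omega> * (d * rate K d i \<omega>)" by (simp add: Wc_def)
  qed
  finally show ?thesis .
qed

text \<open>The sum telescopes because almost every path is non-decreasing and starts at 0;
  elsewhere natural-number subtraction could break it.\<close>

lemma truncated_total:
  assumes d: "0 < d" "real n * d = T"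
  shows "AE \<omega> in M. \<forall>i\<le>n. (\<Sum>j<i. incr K d j \<omega>) = min (H (real i * d) \<omega>) K"
  using paths
proof eventually_elim
  case (elim \<omega>)
  interpret hawkes_path T \<mu> \<Phi> "N \<omega>" "\<lambda>t. H t \<omega>" "\<lambda>t. \<Lambda> t \<omega>" by (rule elim)
  show ?case
  proof (intro allI impI)
    fix i show "i \<le> n \<Longrightarrow> (\<Sum>j<i. incr K d j \<omega>) = min (H (real i * d) \<omega>) K"
    proof (induction i)
      case 0
      then show ?case using X_0 by simp
    next
      case (Suc i)
      have "H (real i * d) \<omega> \<le> H (real (Suc i) * d) \<omega>"
        using d grid_le[OF d Suc.prems] by (intro X_mono) (auto intro: mult_right_mono)
      then show ?case using Suc by (simp add: incr_def)
    qed
  qed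
qed

text \<open>\<open>C\<close> bounds the intensity below level \<open>K\<close>, so the strip of
  height \<open>C\<close> over a cell has area \<open>d * C\<close>. This number bounds the
  compensator of a cell, and its square the probability of two points in that strip.\<close>

lemma discrete:
  assumes n: "0 < n" and d: "d = T / real n" and K: "1 \<le> K"
  defines "C \<equiv> \<mu> + \<Phi> 0 * real K"
  shows "discrete_hawkes M n (real K) (\<mu> * d) ((d * C)\<^sup>2) (d * C) (\<lambda>i. d * \<Phi> (real i * d))
    (\<lambda>i. natural_filtration M T N (real i * d)) (\<lambda>i \<omega>. real (incr K d i \<omega>)) (hit K d) (multi K d)"
proof -
  have dT: "0 < d" "real n * d = T" using n T by (auto simp: d)
  have \<Phi>g: "0 \<le> \<Phi> (real i * d)" "\<Phi> (real i * d) \<le> \<Phi> 0" if "i \<le> n" for i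
    using grid_le[OF dT that] dT by (auto intro!: \<Phi>_nonneg \<Phi>_anti)
  have rate_eq: "\<mu> * d + (\<Sum>j<i. d * \<Phi> (real (i - 1 - j) * d) * real (incr K d j \<omega>)) = d * rate K d i \<omega>" for i \<omega>
    unfolding rate_def by (simp add: distrib_left sum_distrib_left mult_ac)
  note total = truncated_total[OF dT, of K]
  show ?thesis
  proof
    fix i j :: nat and \<omega>
    show "i \<le> n \<Longrightarrow> subalgebra M (natural_filtration M T N (real i * d))" by (rule filtration_subalgebra)
    show "j < i \<Longrightarrow> i \<le> n \<Longrightarrow> (\<lambda>\<omega>. real (incr K d j \<omega>)) \<in> borel_measurable (natural_filtration M T N (real i * d))"
      by (rule incr_measurable[OF dT])
    show "real (incr K d i \<omega>) \<le> real K" by (auto simp: incr_def)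
    show "i < n \<Longrightarrow> 0 \<le> d * \<Phi> (real i * d)" using \<Phi>g(1)[of i] dT by simp
    show "i < n \<Longrightarrow> d * \<Phi> (real i * d) \<le> d * \<Phi> (real 0 * d)" using \<Phi>g(2)[of i] dT by simp
    show "i < n \<Longrightarrow> hit K d i \<in> events" by (rule hit_event[OF dT])
    show "i < n \<Longrightarrow> multi K d i \<in> events" by (rule multi_event[OF dT])
    show "i < n \<Longrightarrow> prob (multi K d i) \<le> (d * C)\<^sup>2"
      unfolding multi_def C_def using \<mu> \<Phi>0 by (intro prob_ge_2[OF dT]) auto
  next
    show "AE \<omega> in M. \<forall>i\<le>n. (\<Sum>j<i. real (incr K d j \<omega>)) \<le> real K"
      using total by eventually_elim (simp flip: of_nat_sum)
    show "AE \<omega> in M. \<forall>i<n. \<mu> * d + (\<Sum>j<i. d * \<Phi> (real (i - 1 - j) * d) * real (incr K d j \<omega>)) \<le> d * C"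
      using total
    proof eventually_elim
      case (elim \<omega>)
      show ?case
      proof (intro allI impI)
        fix i assume i: "i < n"
        have "(\<Sum>j<i. \<Phi> (real (i - 1 - j) * d) * real (incr K d j \<omega>)) \<le> (\<Sum>j<i. \<Phi> 0 * real (incr K d j \<omega>))"
          using i by (intro sum_mono mult_right_mono \<Phi>g) auto
        also have "\<dots> = \<Phi> 0 * real (\<Sum>j<i. incr K d j \<omega>)" by (simp add: sum_distrib_left)
        also have "\<dots> \<le> \<Phi> 0 * real K" using elim i \<Phi>0 by (intro mult_left_mono) auto
        finally have "rate K d i \<omega> \<le> C" by (simp add: rate_def C_def)
        then show "\<mu> * d + (\<Sum>j<i. d * \<Phi> (real (i - 1 - j) * d) * real (incr K d j \<omega>)) \<le> d * C"
          unfolding rate_eq using dT by (intro mult_left_mono) auto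
      qed
    qed
    show "AE \<omega> in M. \<forall>i<n. \<omega> \<notin> multi K d i \<longrightarrow> real (incr K d i \<omega>) = 0 \<or>
        real (incr K d i \<omega>) = 1 \<and> \<omega> \<in> hit K d i \<and> (\<Sum>j<i. real (incr K d j \<omega>)) < real K"
      using total paths AE_space
    proof eventually_elim
      case (elim \<omega>)
      interpret hawkes_path T \<mu> \<Phi> "N \<omega>" "\<lambda>t. H t \<omega>" "\<lambda>t. \<Lambda> t \<omega>" by (rule elim(2))
      show ?case
      proof (intro allI impI)
        fix i assume i: "i < n" and nm: "\<omega> \<notin> multi K d i"
        show "real (incr K d i \<omega>) = 0 \<or>
          real (incr K d i \<omega>) = 1 \<and> \<omega> \<in> hit K d i \<and> (\<Sum>j<i. real (incr K d j \<omega>)) < real K"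
        proof (cases "incr K d i \<omega> = 0")
          case False
          then have "0 < incr K d i \<omega>" by simp
          then have pos: "0 < min (H (real (Suc i) * d) \<omega>) K - min (H (real i * d) \<omega>) K" unfolding incr_def .
          note step = truncated_step[OF dT(1) grid_le[OF dT Suc_leI[OF i]] pos, folded incr_def]
          have "\<not> 2 \<le> emeasure (N \<omega>) (strip d i (\<mu> + \<Phi> 0 * real K))"
            using nm elim(3) by (simp add: multi_def)
          then have "\<not> (2::ennreal) \<le> of_nat (incr K d i \<omega>)"
            using step(2) unfolding strip_def by (meson order.trans)
          then have "\<not> of_nat 2 \<le> (of_nat (incr K d i \<omega>) :: ennreal)" by simp
          then have "incr K d i \<omega> < 2" unfolding of_nat_le_iff by simp
          then have "incr K d i \<omega> = 1" using False by simp
          moreover have "\<omega> \<in> hit K d i"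
            using step(3) elim(3) by (simp add: hit_def strip_def rate_def)
          moreover have "(\<Sum>j<i. incr K d j \<omega>) < K" using elim(1) i step(1) by simp
          ultimately show ?thesis by (simp flip: of_nat_sum)
        qed simp
      qed
    qed
  next
    fix i :: nat and W :: "'a \<Rightarrow> real" and b :: real
    assume "i < n" "W \<in> borel_measurable (natural_filtration M T N (real i * d))"
      "\<And>\<omega>. 0 \<le> W \<omega>" "\<And>\<omega>. W \<omega> \<le> b"
    then show "(\<integral>\<omega>. W \<omega> * indicator (hit K d i) \<omega> \<partial>M)
       \<le> (\<integral>\<omega>. W \<omega> * (\<mu> * d + (\<Sum>j<i. d * \<Phi> (real (i - 1 - j) * d) * real (incr K d j \<omega>))) \<partial>M)"
      unfolding rate_eq by (rule expectation_hit_le[OF dT])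
  qed (use K \<mu> dT in auto)
qed


section \<open>Refinement of the grid and removal of the truncation\<close>

lemma truncated_moments_grid:
  assumes n: "0 < n" and d: "d = T / real n" and K: "1 \<le> K"
    and y1: "set_integrable lborel {0..T} y1" "\<And>t. t \<in> {0..T} \<Longrightarrow> y1 t = 1 + conv y1 t"
    and y2: "set_integrable lborel {0..T} y2" "\<And>t. t \<in> {0..T} \<Longrightarrow> y2 t = (y1 t)\<^sup>2 + conv y2 t"
  defines "C \<equiv> \<mu> + \<Phi> 0 * real K" and "B \<equiv> exp (T * \<Phi> 0)"
    and "I1 \<equiv> (LBINT t:{0..T}. y1 t)" and "C1 \<equiv> (LBINT t:{0..T}. y2 t)"
    and "X \<equiv> \<lambda>\<omega>. real (min (H T \<omega>) K)"
  shows "expectation X \<le> (\<mu> + T * \<Phi> 0 * real K * C\<^sup>2 * d) * ((1 + 2 * B * (d * \<Phi> 0)) * I1) + T * real K * C\<^sup>2 * d"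
    and "expectation (\<lambda>\<omega>. (X \<omega>)\<^sup>2 - X \<omega>) \<le> (\<mu> * ((1 + 2 * B * (d * \<Phi> 0)) * I1))\<^sup>2
      + (\<mu> * \<Phi> 0 * ((1 + 2 * B * (d * \<Phi> 0)) * I1) + T * \<Phi> 0 * real K * C\<^sup>2 * d) *
        (((1 + 2 * B * (d * \<Phi> 0))\<^sup>2 + 2 * B ^ 3 * (d * \<Phi> 0)) * C1)
      + T * d * (C\<^sup>2 * ((2 * (\<mu> * T * B + real K * B) + B) * (B * (real K)\<^sup>2) + B\<^sup>2))"
proof -
  have dT: "0 < d" "real n * d = T" using n T by (auto simp: d)
  interpret D: discrete_hawkes M n "real K" "\<mu> * d" "(d * C)\<^sup>2" "d * C" "\<lambda>i. d * \<Phi> (real i * d)"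
    "\<lambda>i. natural_filtration M T N (real i * d)" "\<lambda>i \<omega>. real (incr K d i \<omega>)" "hit K d" "multi K d"
    unfolding C_def by (rule discrete[OF n d K])
  define S where "S = (\<Sum>k<n. D.v k)"
  define U where "U = (\<Sum>k<n. D.u k)"
  have dS: "d * S \<le> (1 + 2 * B * (d * \<Phi> 0)) * I1"
    and dU: "d * U \<le> ((1 + 2 * B * (d * \<Phi> 0))\<^sup>2 + 2 * B ^ 3 * (d * \<Phi> 0)) * C1"
    unfolding S_def U_def D.v_def D.u_def B_def I1_def C1_def
    using discrete_sums_le[OF n d y1 y2] by auto
  have v0: "0 \<le> D.v k" if "k < n" for k using D.v_ge_1[OF that] by simp
  have S0: "0 \<le> d * S" unfolding S_def using v0 dT by (intro mult_nonneg_nonneg sum_nonneg) auto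
  have u0: "0 \<le> D.u k" if "k < n" for k
    using volterra_ge[of n "\<lambda>i. d * \<Phi> (real i * d)" "\<lambda>k. (D.v k)\<^sup>2" k] D.\<phi>_nonneg that
    unfolding D.u_def by (intro order.trans[OF zero_le_power2[of "D.v k"]]) simp
  have U0: "0 \<le> d * U" unfolding U_def using u0 dT by (intro mult_nonneg_nonneg sum_nonneg) auto
  have G: "AE \<omega> in M. D.G n \<omega> = X \<omega>"
    using truncated_total[OF dT, of K]
  proof eventually_elim
    case (elim \<omega>)
    then have "(\<Sum>j<n. incr K d j \<omega>) = min (H T \<omega>) K" using dT by auto
    then show ?case unfolding D.G_def X_def by (simp flip: of_nat_sum)
  qed
  have HT [measurable]: "(\<lambda>\<omega>. real (H T \<omega>)) \<in> borel_measurable M"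
    using measurable_from_subalg[OF filtration_subalgebra H_measurable[of T T]] T by simp
  have Xm [measurable]: "X \<in> borel_measurable M"
    unfolding X_def of_nat_min by measurable
  note [measurable] = D.G_measM[OF order.refl]
  have e1: "expectation X = expectation (D.G n)"
    using G by (intro integral_cong_AE) (auto elim: eventually_mono)
  have e2: "expectation (\<lambda>\<omega>. (X \<omega>)\<^sup>2 - X \<omega>) = expectation (\<lambda>\<omega>. (D.G n \<omega>)\<^sup>2 - D.G n \<omega>)"
    using G by (intro integral_cong_AE) (auto elim: eventually_mono)
  have C0: "0 \<le> C" unfolding C_def using \<mu> \<Phi>0 by simp
  have "expectation X \<le> (\<mu> * d + real n * (d * \<Phi> (real 0 * d) * (real K * (d * C)\<^sup>2))) * S + real n * (real K * (d * C)\<^sup>2)"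
    unfolding e1 S_def by (rule D.expectation_G_le)
  \<comment> \<open>Every factor \<open>n\<close> is paired with a \<open>d\<close> to give
    \<open>T\<close>, which exposes a spare factor \<open>d\<close> in each error term.\<close>
  also have "\<dots> = (\<mu> + (real n * d) * \<Phi> 0 * real K * C\<^sup>2 * d) * (d * S) + (real n * d) * real K * C\<^sup>2 * d"
    by (simp add: power2_eq_square algebra_simps)
  also have "\<dots> \<le> (\<mu> + (real n * d) * \<Phi> 0 * real K * C\<^sup>2 * d) * ((1 + 2 * B * (d * \<Phi> 0)) * I1) + (real n * d) * real K * C\<^sup>2 * d"
    using dS \<mu> \<Phi>0 dT by (intro add_right_mono mult_left_mono) auto
  finally show "expectation X \<le> (\<mu> + T * \<Phi> 0 * real K * C\<^sup>2 * d) * ((1 + 2 * B * (d * \<Phi> 0)) * I1) + T * real K * C\<^sup>2 * d"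
    unfolding dT(2) .
  have Vm: "D.Vmax = B" unfolding D.Vmax_def B_def by (simp add: dT(2)[symmetric] mult.assoc)
  have Zm: "D.Zmax = \<mu> * (real n * d) * B + real K * B" unfolding D.Zmax_def Vm by (simp add: mult_ac)
  have "expectation (\<lambda>\<omega>. (X \<omega>)\<^sup>2 - X \<omega>) \<le> (\<mu> * d * S)\<^sup>2 + \<mu> * d * (d * \<Phi> (real 0 * d)) * S * U
    + real n * (d * \<Phi> (real 0 * d) * (real K * (d * C)\<^sup>2)) * U + real n * D.R"
    unfolding e2 S_def U_def by (rule D.expectation_square_G_le)
  also have "\<dots> = (\<mu> * (d * S))\<^sup>2 + (\<mu> * \<Phi> 0 * (d * S) + (real n * d) * \<Phi> 0 * real K * C\<^sup>2 * d) * (d * U)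
     + (real n * d) * d * (C\<^sup>2 * ((2 * D.Zmax + D.Vmax) * (D.Vmax * (real K)\<^sup>2) + D.Vmax\<^sup>2))"
  proof -
    have "real n * ((2 * z + w) * (w * k\<^sup>2) * (d * C)\<^sup>2 + w\<^sup>2 * (d * C)\<^sup>2)
        = (real n * d) * d * (C\<^sup>2 * ((2 * z + w) * (w * k\<^sup>2) + w\<^sup>2))" for z w k
      by (simp add: power2_eq_square algebra_simps)
    then have R: "real n * D.R = (real n * d) * d * (C\<^sup>2 * ((2 * D.Zmax + D.Vmax) * (D.Vmax * (real K)\<^sup>2) + D.Vmax\<^sup>2))"
      unfolding D.R_def .
    have "(\<mu> * d * S)\<^sup>2 + \<mu> * d * (d * \<Phi> (real 0 * d)) * S * U
        + real n * (d * \<Phi> (real 0 * d) * (real K * (d * C)\<^sup>2)) * U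
      = (\<mu> * (d * S))\<^sup>2 + (\<mu> * \<Phi> 0 * (d * S) + (real n * d) * \<Phi> 0 * real K * C\<^sup>2 * d) * (d * U)"
      by (simp add: power2_eq_square algebra_simps)
    then show ?thesis unfolding R by (rule arg_cong)
  qed
  also have "\<dots> \<le> (\<mu> * ((1 + 2 * B * (d * \<Phi> 0)) * I1))\<^sup>2
      + (\<mu> * \<Phi> 0 * ((1 + 2 * B * (d * \<Phi> 0)) * I1) + (real n * d) * \<Phi> 0 * real K * C\<^sup>2 * d) *
        (((1 + 2 * B * (d * \<Phi> 0))\<^sup>2 + 2 * B ^ 3 * (d * \<Phi> 0)) * C1)
      + (real n * d) * d * (C\<^sup>2 * ((2 * D.Zmax + D.Vmax) * (D.Vmax * (real K)\<^sup>2) + D.Vmax\<^sup>2))"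
  proof (rule add_right_mono, rule add_mono)
    show "(\<mu> * (d * S))\<^sup>2 \<le> (\<mu> * ((1 + 2 * B * (d * \<Phi> 0)) * I1))\<^sup>2"
      using dS \<mu> S0 by (intro power_mono mult_left_mono[OF dS]) (auto simp: zero_le_mult_iff)
    have "\<mu> * \<Phi> 0 * (d * S) \<le> \<mu> * \<Phi> 0 * ((1 + 2 * B * (d * \<Phi> 0)) * I1)"
      using \<mu> \<Phi>0 by (intro mult_left_mono[OF dS]) simp
    then have lin: "\<mu> * \<Phi> 0 * (d * S) + real n * d * \<Phi> 0 * real K * C\<^sup>2 * d
        \<le> \<mu> * \<Phi> 0 * ((1 + 2 * B * (d * \<Phi> 0)) * I1) + real n * d * \<Phi> 0 * real K * C\<^sup>2 * d"
      by (rule add_right_mono)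
    have "0 \<le> \<mu> * \<Phi> 0" using \<mu> \<Phi>0 by simp
    moreover have "0 \<le> (1 + 2 * B * (d * \<Phi> 0)) * I1" using S0 dS by linarith
    ultimately have "0 \<le> \<mu> * \<Phi> 0 * ((1 + 2 * B * (d * \<Phi> 0)) * I1)" by (rule mult_nonneg_nonneg)
    moreover have "0 \<le> real n * d * \<Phi> 0 * real K * C\<^sup>2 * d" using \<Phi>0 dT(1) by simp
    ultimately have nn: "0 \<le> \<mu> * \<Phi> 0 * ((1 + 2 * B * (d * \<Phi> 0)) * I1) + real n * d * \<Phi> 0 * real K * C\<^sup>2 * d"
      by (rule add_nonneg_nonneg)
    show "(\<mu> * \<Phi> 0 * (d * S) + real n * d * \<Phi> 0 * real K * C\<^sup>2 * d) * (d * U)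
      \<le> (\<mu> * \<Phi> 0 * ((1 + 2 * B * (d * \<Phi> 0)) * I1) + real n * d * \<Phi> 0 * real K * C\<^sup>2 * d) *
        (((1 + 2 * B * (d * \<Phi> 0))\<^sup>2 + 2 * B ^ 3 * (d * \<Phi> 0)) * C1)"
      by (rule mult_mono[OF lin dU nn U0])
  qed
  finally show "expectation (\<lambda>\<omega>. (X \<omega>)\<^sup>2 - X \<omega>) \<le> (\<mu> * ((1 + 2 * B * (d * \<Phi> 0)) * I1))\<^sup>2
      + (\<mu> * \<Phi> 0 * ((1 + 2 * B * (d * \<Phi> 0)) * I1) + T * \<Phi> 0 * real K * C\<^sup>2 * d) *
        (((1 + 2 * B * (d * \<Phi> 0))\<^sup>2 + 2 * B ^ 3 * (d * \<Phi> 0)) * C1)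
      + T * d * (C\<^sup>2 * ((2 * (\<mu> * T * B + real K * B) + B) * (B * (real K)\<^sup>2) + B\<^sup>2))"
    unfolding Zm Vm dT(2) .
qed

text \<open>For fixed \<open>K\<close> the grid bounds are polynomials in \<open>d\<close>, hence
  continuous at 0, where the error terms vanish; the moments on the left do not depend on the
  grid.\<close>

lemma truncated_moments:
  assumes K: "1 \<le> K"
    and y1: "set_integrable lborel {0..T} y1" "\<And>t. t \<in> {0..T} \<Longrightarrow> y1 t = 1 + conv y1 t"
    and y2: "set_integrable lborel {0..T} y2" "\<And>t. t \<in> {0..T} \<Longrightarrow> y2 t = (y1 t)\<^sup>2 + conv y2 t"
  defines "I1 \<equiv> (LBINT t:{0..T}. y1 t)" and "C1 \<equiv> (LBINT t:{0..T}. y2 t)"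
    and "X \<equiv> \<lambda>\<omega>. real (min (H T \<omega>) K)"
  shows "expectation X \<le> \<mu> * I1"
    and "expectation (\<lambda>\<omega>. (X \<omega>)\<^sup>2 - X \<omega>) \<le> (\<mu> * I1)\<^sup>2 + \<mu> * \<Phi> 0 * I1 * C1"
proof -
  define C where "C = \<mu> + \<Phi> 0 * real K"
  define B where "B = exp (T * \<Phi> 0)"
  define f1 where "f1 d = (\<mu> + T * \<Phi> 0 * real K * C\<^sup>2 * d) * ((1 + 2 * B * (d * \<Phi> 0)) * I1) + T * real K * C\<^sup>2 * d" for d
  define f2 where "f2 d = (\<mu> * ((1 + 2 * B * (d * \<Phi> 0)) * I1))\<^sup>2
      + (\<mu> * \<Phi> 0 * ((1 + 2 * B * (d * \<Phi> 0)) * I1) + T * \<Phi> 0 * real K * C\<^sup>2 * d) *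
        (((1 + 2 * B * (d * \<Phi> 0))\<^sup>2 + 2 * B ^ 3 * (d * \<Phi> 0)) * C1)
      + T * d * (C\<^sup>2 * ((2 * (\<mu> * T * B + real K * B) + B) * (B * (real K)\<^sup>2) + B\<^sup>2))" for d
  have lim: "(\<lambda>n. T / real (Suc n)) \<longlonglongrightarrow> 0"
    using tendsto_mult[OF tendsto_const[of T] LIMSEQ_inverse_real_of_nat] by (simp add: divide_inverse)
  have "isCont f1 0" unfolding f1_def[abs_def] by (intro continuous_intros)
  then have l1: "(\<lambda>n. f1 (T / real (Suc n))) \<longlonglongrightarrow> f1 0" using lim by (rule isCont_tendsto_compose)
  have "isCont f2 0" unfolding f2_def[abs_def] by (intro continuous_intros)
  then have l2: "(\<lambda>n. f2 (T / real (Suc n))) \<longlonglongrightarrow> f2 0" using lim by (rule isCont_tendsto_compose)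
  have g: "expectation X \<le> f1 (T / real (Suc n))" "expectation (\<lambda>\<omega>. (X \<omega>)\<^sup>2 - X \<omega>) \<le> f2 (T / real (Suc n))" for n
    unfolding f1_def f2_def C_def B_def I1_def C1_def X_def
    using truncated_moments_grid[OF zero_less_Suc refl K y1 y2, of n] by blast+
  have "expectation X \<le> f1 0" using l1 g(1) by (intro LIMSEQ_le_const) blast+
  then show "expectation X \<le> \<mu> * I1" by (simp add: f1_def)
  have "expectation (\<lambda>\<omega>. (X \<omega>)\<^sup>2 - X \<omega>) \<le> f2 0" using l2 g(2) by (intro LIMSEQ_le_const) blast+
  then show "expectation (\<lambda>\<omega>. (X \<omega>)\<^sup>2 - X \<omega>) \<le> (\<mu> * I1)\<^sup>2 + \<mu> * \<Phi> 0 * I1 * C1" by (simp add: f2_def)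
qed

lemma H_T_measurable: "H T \<in> natural_filtration M T N T \<rightarrow>\<^sub>M count_space UNIV"
proof -
  have "\<forall>t\<in>{0..T}. H t \<in> natural_filtration M T N t \<rightarrow>\<^sub>M count_space UNIV"
    using H unfolding hawkes_solution_def by (elim conjE)
  then show ?thesis using T by auto
qed

text \<open>Monotone convergence in the truncation level, which runs over \<open>Suc K\<close>
  because the bounds are available from level 1 on.\<close>

lemma nn_integral_le_truncations:
  fixes \<psi> :: "nat \<Rightarrow> nat"
  assumes \<psi>: "mono \<psi>" and b: "\<And>K. 1 \<le> K \<Longrightarrow> expectation (\<lambda>\<omega>. real (\<psi> (min (H T \<omega>) K))) \<le> b"
  shows "(\<integral>\<^sup>+\<omega>. of_nat (\<psi> (H T \<omega>)) \<partial>M) \<le> ennreal b"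
proof -
  have [measurable]: "H T \<in> M \<rightarrow>\<^sub>M count_space UNIV"
    using measurable_from_subalg[OF filtration_subalgebra H_T_measurable] .
  have meas: "(\<lambda>\<omega>. real (\<psi> (min (H T \<omega>) K))) \<in> borel_measurable M" for K
    by (rule measurable_compose[OF \<open>H T \<in> M \<rightarrow>\<^sub>M count_space UNIV\<close>]) simp
  have 1: "(\<integral>\<^sup>+\<omega>. ennreal (real (\<psi> (min (H T \<omega>) (Suc K)))) \<partial>M) \<le> ennreal b" for K
  proof -
    have "integrable M (\<lambda>\<omega>. real (\<psi> (min (H T \<omega>) (Suc K))))"
      using meas \<psi> by (intro integrable_const_bound[of _ "real (\<psi> (Suc K))"]) (auto simp: mono_def intro!: AE_I2)
    then have "(\<integral>\<^sup>+\<omega>. ennreal (real (\<psi> (min (H T \<omega>) (Suc K)))) \<partial>M) = ennreal (expectation (\<lambda>\<omega>. real (\<psi> (min (H T \<omega>) (Suc K)))))"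
      by (intro nn_integral_eq_integral) auto
    then show ?thesis using b[of "Suc K"] by (simp add: ennreal_leI)
  qed
  have "of_nat (\<psi> (H T \<omega>)) = (SUP K. ennreal (real (\<psi> (min (H T \<omega>) (Suc K)))))" for \<omega>
  proof (rule antisym)
    have "of_nat (\<psi> (H T \<omega>)) = ennreal (real (\<psi> (min (H T \<omega>) (Suc (H T \<omega>)))))"
      by (simp add: ennreal_of_nat_eq_real_of_nat)
    also have "\<dots> \<le> (SUP K. ennreal (real (\<psi> (min (H T \<omega>) (Suc K)))))" by (rule SUP_upper) simp
    finally show "of_nat (\<psi> (H T \<omega>)) \<le> (SUP K. ennreal (real (\<psi> (min (H T \<omega>) (Suc K)))))" .
    show "(SUP K. ennreal (real (\<psi> (min (H T \<omega>) (Suc K))))) \<le> of_nat (\<psi> (H T \<omega>))"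
      using \<psi> by (intro SUP_least) (simp add: ennreal_of_nat_eq_real_of_nat mono_def ennreal_leI)
  qed
  then have "(\<integral>\<^sup>+\<omega>. of_nat (\<psi> (H T \<omega>)) \<partial>M) = (\<integral>\<^sup>+\<omega>. (SUP K. ennreal (real (\<psi> (min (H T \<omega>) (Suc K))))) \<partial>M)"
    by simp
  also have "\<dots> = (SUP K. \<integral>\<^sup>+\<omega>. ennreal (real (\<psi> (min (H T \<omega>) (Suc K)))) \<partial>M)"
  proof (rule nn_integral_monotone_convergence_SUP)
    show "incseq (\<lambda>K \<omega>. ennreal (real (\<psi> (min (H T \<omega>) (Suc K)))))"
      using \<psi> by (intro incseq_SucI le_funI ennreal_leI) (simp add: mono_def)
    show "(\<lambda>\<omega>. ennreal (real (\<psi> (min (H T \<omega>) (Suc K))))) \<in> borel_measurable M" for K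
      using meas by measurable
  qed
  also have "\<dots> \<le> ennreal b" using 1 by (intro SUP_least)
  finally show ?thesis .
qed

lemma moments:
  assumes y1: "set_integrable lborel {0..T} y1" "\<And>t. t \<in> {0..T} \<Longrightarrow> y1 t = 1 + conv y1 t"
    and y2: "set_integrable lborel {0..T} y2" "\<And>t. t \<in> {0..T} \<Longrightarrow> y2 t = (y1 t)\<^sup>2 + conv y2 t"
  defines "I1 \<equiv> (LBINT t:{0..T}. y1 t)" and "C1 \<equiv> (LBINT t:{0..T}. y2 t)"
  shows "(\<integral>\<^sup>+\<omega>. of_nat (H T \<omega>) \<partial>M) \<le> ennreal (\<mu> * I1)"
    and "(\<integral>\<^sup>+\<omega>. of_nat (H T \<omega> * (H T \<omega> - 1)) \<partial>M) \<le> ennreal ((\<mu> * I1)\<^sup>2 + \<mu> * \<Phi> 0 * I1 * C1)"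
proof -
  note t = truncated_moments[OF _ y1 y2, folded I1_def C1_def]
  show "(\<integral>\<^sup>+\<omega>. of_nat (H T \<omega>) \<partial>M) \<le> ennreal (\<mu> * I1)"
    using t(1) by (intro nn_integral_le_truncations[of "\<lambda>x. x"]) (auto simp: mono_def)
  have sq: "real (x * (x - 1)) = (real x)\<^sup>2 - real x" for x :: nat
    by (cases x) (auto simp: power2_eq_square algebra_simps)
  show "(\<integral>\<^sup>+\<omega>. of_nat (H T \<omega> * (H T \<omega> - 1)) \<partial>M) \<le> ennreal ((\<mu> * I1)\<^sup>2 + \<mu> * \<Phi> 0 * I1 * C1)"
  proof (rule nn_integral_le_truncations[of "\<lambda>x. x * (x - 1)"])
    show "mono (\<lambda>x::nat. x * (x - 1))" by (intro monoI mult_le_mono) auto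
    show "expectation (\<lambda>\<omega>. real (min (H T \<omega>) K * (min (H T \<omega>) K - 1))) \<le> (\<mu> * I1)\<^sup>2 + \<mu> * \<Phi> 0 * I1 * C1"
      if "1 \<le> K" for K
      unfolding sq using t(2)[OF that] by simp
  qed
qed

end

section \<open>Expectations of the claims\<close>

locale claims_model = prob_space M for M :: "'a measure" +
  fixes T :: real and N :: "'a \<Rightarrow> (real \<times> real) measure"
    and \<eta> \<theta> \<eta>b \<theta>b :: "nat \<Rightarrow> 'a \<Rightarrow> real"
    and f h :: "real \<Rightarrow> real" and g :: "real \<Rightarrow> real \<Rightarrow> real"
  assumes claims: "iid_claims M T N \<eta> \<theta> \<eta>b \<theta>b"
    and f_meas: "set_borel_measurable borel {0..} f"
    and f_nonneg: "\<And>x. x \<ge> 0 \<Longrightarrow> f x \<ge> 0"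
    and g_meas: "set_borel_measurable borel ({0..} \<times> {0..}) (\<lambda>(x, y). g x y)"
    and g_nonneg: "\<And>x y. x \<ge> 0 \<Longrightarrow> y \<ge> 0 \<Longrightarrow> g x y \<ge> 0"
    and g_bounded: "bounded ((\<lambda>(x, y). g x y) ` ({0..} \<times> {0..}))"
    and h_meas: "set_borel_measurable borel {0..} h"
    and h_nonneg: "\<And>x. x \<ge> 0 \<Longrightarrow> h x \<ge> 0"
    and h_bounded: "bounded (h ` {0..})"
    and h_mono: "mono_on {0..} h"
begin

definition Z :: "nat + nat \<Rightarrow> 'a \<Rightarrow> real \<times> real" where
  "Z = claim_family \<eta> \<theta> \<eta>b \<theta>b"

definition D :: "(real \<times> real) measure" where
  "D = distr M borel (Z (Inl 1))"

text \<open>Claims are nonnegative at every sample point, so the extensions by 0 in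
  \<open>f0\<close>, \<open>g0\<close> and \<open>h0\<close> change no value that occurs, and they
  are Borel on the whole space.\<close>

definition f0 :: "real \<times> real \<Rightarrow> real" where
  "f0 p = (if 0 \<le> fst p then f (fst p) else 0)"

definition g0 :: "real \<times> real \<Rightarrow> real" where
  "g0 p = (if 0 \<le> fst p \<and> 0 \<le> snd p then g (fst p) (snd p) else 0)"

definition h0 :: "real \<Rightarrow> real" where
  "h0 x = (if 0 \<le> x then h x else 0)"

lemma f0_measurable [measurable]: "f0 \<in> borel_measurable borel"
proof -
  have "(\<lambda>x. indicator {0..} x *\<^sub>R f x) \<in> borel_measurable borel"
    using f_meas by (simp add: set_borel_measurable_def)
  then have "(\<lambda>p::real \<times> real. indicator {0..} (fst p) *\<^sub>R f (fst p)) \<in> borel_measurable borel"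
    by (rule measurable_compose[rotated]) (simp add: borel_prod[symmetric])
  moreover have "f0 = (\<lambda>p. indicator {0..} (fst p) *\<^sub>R f (fst p))"
    by (auto simp: f0_def fun_eq_iff)
  ultimately show ?thesis by simp
qed

lemma g0_measurable [measurable]: "g0 \<in> borel_measurable borel"
proof -
  have "(\<lambda>p. indicator ({0..} \<times> {0..}) p *\<^sub>R (case p of (x, y) \<Rightarrow> g x y)) \<in> borel_measurable borel"
    using g_meas by (simp add: set_borel_measurable_def)
  moreover have "g0 = (\<lambda>p. indicator ({0..} \<times> {0..}) p *\<^sub>R (case p of (x, y) \<Rightarrow> g x y))"
    by (auto simp: g0_def fun_eq_iff split: split_indicator)
  ultimately show ?thesis by simp
qed

lemma h0_measurable [measurable]: "h0 \<in> borel_measurable borel"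
proof -
  have "(\<lambda>x. indicator {0..} x *\<^sub>R h x) \<in> borel_measurable borel"
    using h_meas by (simp add: set_borel_measurable_def)
  moreover have "h0 = (\<lambda>x. indicator {0..} x *\<^sub>R h x)" by (auto simp: h0_def fun_eq_iff)
  ultimately show ?thesis by simp
qed

lemma f0_nonneg: "0 \<le> f0 p"
  using f_nonneg by (simp add: f0_def)

definition bg :: real where "bg = (SOME b. 0 \<le> b \<and> (\<forall>p. g0 p \<le> b))"
definition bh :: real where "bh = (SOME b. 0 \<le> b \<and> (\<forall>x. h0 x \<le> b))"

lemma g0_bounds: "0 \<le> g0 p" "g0 p \<le> bg" "0 \<le> bg"
proof -
  obtain b where b: "\<And>x y. 0 \<le> x \<Longrightarrow> 0 \<le> y \<Longrightarrow> \<bar>g x y\<bar> \<le> b"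
    using g_bounded unfolding bounded_iff by fastforce
  have "0 \<le> b" using b[of 0 0] by simp
  moreover have "g0 p \<le> b" for p using b[of "fst p" "snd p"] \<open>0 \<le> b\<close> by (auto simp: g0_def)
  ultimately have "\<exists>b. 0 \<le> b \<and> (\<forall>p. g0 p \<le> b)" by blast
  from someI_ex[OF this] show "g0 p \<le> bg" "0 \<le> bg" unfolding bg_def by blast+
  show "0 \<le> g0 p" using g_nonneg by (simp add: g0_def)
qed

lemma h0_bounds: "0 \<le> h0 x" "h0 x \<le> bh" "0 \<le> bh"
proof -
  obtain b where b: "\<And>x. 0 \<le> x \<Longrightarrow> \<bar>h x\<bar> \<le> b"
    using h_bounded unfolding bounded_iff by fastforce
  have "0 \<le> b" using b[of 0] by simp
  moreover have "h0 x \<le> b" for x using b[of x] \<open>0 \<le> b\<close> by (auto simp: h0_def)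
  ultimately have "\<exists>b. 0 \<le> b \<and> (\<forall>x. h0 x \<le> b)" by blast
  from someI_ex[OF this] show "h0 x \<le> bh" "0 \<le> bh" unfolding bh_def by blast+
  show "0 \<le> h0 x" using h_nonneg by (simp add: h0_def)
qed

lemma h0_mono: "0 \<le> x \<Longrightarrow> x \<le> y \<Longrightarrow> h0 x \<le> h0 y"
  using h_mono by (auto simp: h0_def mono_on_def)

lemma gh_bounds: "0 \<le> g0 p * h0 x" "g0 p * h0 x \<le> bg * bh"
  by (rule mult_nonneg_nonneg[OF g0_bounds(1) h0_bounds(1)],
      rule mult_mono[OF g0_bounds(2) h0_bounds(2) g0_bounds(3) h0_bounds(1)])

lemma claims_conds:
  "\<forall>j\<in>claim_indices. \<forall>\<omega>\<in>space M. Z j \<omega> \<in> {0..} \<times> {0..}"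
  "\<forall>j\<in>claim_indices. distr M borel (Z j) = distr M borel (Z (Inl 1))"
  "indep_vars (\<lambda>_. borel) Z claim_indices"
  "indep_set (sets (natural_filtration M T N T))
         (sigma_sets (space M) (\<Union>j\<in>claim_indices. {Z j -` A \<inter> space M | A. A \<in> sets borel}))"
  using claims unfolding iid_claims_def Let_def Z_def by blast+

lemma Inl_index [simp]: "Inl i \<in> claim_indices \<longleftrightarrow> 1 \<le> i"
  and Inr_index [simp]: "Inr i \<in> claim_indices \<longleftrightarrow> 1 \<le> i"
  by (auto simp: claim_indices_def)

lemma Z_pos: "j \<in> claim_indices \<Longrightarrow> \<omega> \<in> space M \<Longrightarrow> 0 \<le> fst (Z j \<omega>) \<and> 0 \<le> snd (Z j \<omega>)"
  using claims_conds(1) by (auto simp: mem_Times_iff)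

lemma Z_meas: "j \<in> claim_indices \<Longrightarrow> Z j \<in> borel_measurable M"
  using claims_conds(3) by (simp add: indep_vars_def)

lemma Z_eval: "Z (Inl i) \<omega> = (\<eta> i \<omega>, \<theta> i \<omega>)" "Z (Inr i) \<omega> = (\<eta>b i \<omega>, \<theta>b i \<omega>)"
  by (simp_all add: Z_def claim_family_def)

text \<open>The sequence \<open>a\<close> of the overview, defined through the product law so that
  no particular claims are singled out.\<close>

definition mean :: "nat \<Rightarrow> real" where
  "mean m = (\<integral>x. g0 (x 1) * h0 (\<Sum>i=1..m. f0 (x i)) \<partial>PiM {1..m} (\<lambda>_. D))"

text \<open>Any \<open>m\<close> distinct claims, barred or not, have the \<open>m\<close>-fold
  product law: the law of the whole family is a product, and it is restricted along the injective
  selection \<open>\<sigma>\<close>.\<close>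

lemma mean_eq:
  assumes m: "1 \<le> m" and \<sigma>: "inj_on \<sigma> {1..m}" "\<sigma> ` {1..m} \<subseteq> claim_indices"
  shows "(\<integral>\<omega>. g0 (Z (\<sigma> 1) \<omega>) * h0 (\<Sum>i=1..m. f0 (Z (\<sigma> i) \<omega>)) \<partial>M) = mean m"
proof -
  have D: "prob_space D" unfolding D_def by (rule prob_space_distr[OF Z_meas]) simp
  have sD: "sets D = sets borel" by (simp add: D_def)
  have ne: "claim_indices \<noteq> {}" using Inl_index[of 1] by (metis empty_iff order_refl)
  have "distr M (PiM claim_indices (\<lambda>_. borel)) (\<lambda>\<omega>. \<lambda>j\<in>claim_indices. Z j \<omega>)
      = PiM claim_indices (\<lambda>j. distr M borel (Z j))"
    using indep_vars_iff_distr_eq_PiM'[where M'="\<lambda>_. borel" and X=Z, OF ne] Z_meas claims_conds(3) by simp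
  also have "\<dots> = PiM claim_indices (\<lambda>_. D)"
    unfolding D_def by (rule PiM_cong[OF refl]) (use claims_conds(2) in blast)
  finally have joint: "distr M (PiM claim_indices (\<lambda>_. borel)) (\<lambda>\<omega>. \<lambda>j\<in>claim_indices. Z j \<omega>) = PiM claim_indices (\<lambda>_. D)" .
  have [measurable]: "(\<lambda>\<omega>. \<lambda>j\<in>claim_indices. Z j \<omega>) \<in> M \<rightarrow>\<^sub>M PiM claim_indices (\<lambda>_. borel)"
    using Z_meas by (intro measurable_restrict)
  have sel [measurable]: "(\<lambda>x. \<lambda>i\<in>{1..m}. x (\<sigma> i)) \<in> PiM claim_indices (\<lambda>_. borel) \<rightarrow>\<^sub>M PiM {1..m} (\<lambda>_. borel :: (real \<times> real) measure)"
    using \<sigma>(2) by (intro measurable_restrict measurable_component_singleton) auto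
  have "distr M (PiM {1..m} (\<lambda>_. borel)) (\<lambda>\<omega>. \<lambda>i\<in>{1..m}. Z (\<sigma> i) \<omega>)
     = distr M (PiM {1..m} (\<lambda>_. borel)) ((\<lambda>x. \<lambda>i\<in>{1..m}. x (\<sigma> i)) \<circ> (\<lambda>\<omega>. \<lambda>j\<in>claim_indices. Z j \<omega>))"
  proof (rule arg_cong[of _ _ "distr M (PiM {1..m} (\<lambda>_. borel))"], rule ext)
    fix \<omega>
    show "(\<lambda>i\<in>{1..m}. Z (\<sigma> i) \<omega>) = ((\<lambda>x. \<lambda>i\<in>{1..m}. x (\<sigma> i)) \<circ> (\<lambda>\<omega>. \<lambda>j\<in>claim_indices. Z j \<omega>)) \<omega>"
      using \<sigma>(2) by (auto simp: fun_eq_iff image_subset_iff)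
  qed
  also have "\<dots> = distr (distr M (PiM claim_indices (\<lambda>_. borel)) (\<lambda>\<omega>. \<lambda>j\<in>claim_indices. Z j \<omega>))
       (PiM {1..m} (\<lambda>_. borel)) (\<lambda>x. \<lambda>i\<in>{1..m}. x (\<sigma> i))"
    by (rule distr_distr[symmetric]) measurable
  also have "\<dots> = distr (PiM claim_indices (\<lambda>_. D)) (PiM {1..m} (\<lambda>_. D)) (\<lambda>x. \<lambda>i\<in>{1..m}. x (\<sigma> i))"
    unfolding joint by (intro distr_cong refl sets_PiM_cong) (simp add: sD)
  also have "\<dots> = PiM {1..m} (\<lambda>_. D)"
    using distr_PiM_reindex[of claim_indices "\<lambda>_. D" \<sigma> "{1..m}"] D \<sigma> by (auto simp: image_subset_iff)
  finally have d: "distr M (PiM {1..m} (\<lambda>_. borel)) (\<lambda>\<omega>. \<lambda>i\<in>{1..m}. Z (\<sigma> i) \<omega>) = PiM {1..m} (\<lambda>_. D)" .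
  have comp: "(\<lambda>x. x i) \<in> PiM {1..m} (\<lambda>_. borel :: (real \<times> real) measure) \<rightarrow>\<^sub>M borel" if "i \<in> {1..m}" for i
    using that by (rule measurable_component_singleton)
  have "mean m = (\<integral>\<omega>. g0 ((\<lambda>i\<in>{1..m}. Z (\<sigma> i) \<omega>) 1) * h0 (\<Sum>i=1..m. f0 ((\<lambda>i\<in>{1..m}. Z (\<sigma> i) \<omega>) i)) \<partial>M)"
    unfolding mean_def d[symmetric]
  proof (rule integral_distr)
    show "(\<lambda>\<omega>. \<lambda>i\<in>{1..m}. Z (\<sigma> i) \<omega>) \<in> M \<rightarrow>\<^sub>M PiM {1..m} (\<lambda>_. borel)"
      using \<sigma>(2) by (intro measurable_restrict Z_meas) blast
    show "(\<lambda>x. g0 (x 1) * h0 (\<Sum>i=1..m. f0 (x i))) \<in> borel_measurable (PiM {1..m} (\<lambda>_. borel))"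
      using m by (intro borel_measurable_times measurable_compose[OF comp g0_measurable]
        measurable_compose[OF _ h0_measurable] borel_measurable_sum measurable_compose[OF comp f0_measurable]) auto
  qed
  also have "\<dots> = (\<integral>\<omega>. g0 (Z (\<sigma> 1) \<omega>) * h0 (\<Sum>i=1..m. f0 (Z (\<sigma> i) \<omega>)) \<partial>M)"
    using m by simp
  finally show ?thesis ..
qed

lemma gh_measurable:
  assumes "j \<in> claim_indices" "\<And>i. i \<in> A \<Longrightarrow> \<tau> i \<in> claim_indices"
  shows "(\<lambda>\<omega>. g0 (Z j \<omega>) * h0 (\<Sum>i\<in>A. f0 (Z (\<tau> i) \<omega>))) \<in> borel_measurable M"
  using assms Z_meas
  by (intro borel_measurable_times measurable_compose[OF _ g0_measurable]
        measurable_compose[OF _ h0_measurable] borel_measurable_sum measurable_compose[OF _ f0_measurable]) auto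

lemma gh_integrable:
  assumes "j \<in> claim_indices" "\<And>i. i \<in> A \<Longrightarrow> \<tau> i \<in> claim_indices"
  shows "integrable M (\<lambda>\<omega>. g0 (Z j \<omega>) * h0 (\<Sum>i\<in>A. f0 (Z (\<tau> i) \<omega>)))"
  using gh_measurable[of j A \<tau>] assms gh_bounds by (intro integrable_const_bound[of _ "bg * bh"]) auto

lemma mean_Inl: "1 \<le> m \<Longrightarrow> mean m = (\<integral>\<omega>. g0 (Z (Inl 1) \<omega>) * h0 (\<Sum>i=1..m. f0 (Z (Inl i) \<omega>)) \<partial>M)"
  by (intro mean_eq[symmetric]) (auto simp: inj_on_def)

lemma mean_nonneg: "0 \<le> mean m"
  unfolding mean_def using gh_bounds by (intro integral_nonneg_AE) auto

lemma mean_le: "1 \<le> m \<Longrightarrow> mean m \<le> bg * bh"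
  unfolding mean_Inl using gh_bounds gh_integrable[of "Inl 1" "{1..m}" Inl]
  by (intro integral_le_const) auto

lemma mean_mono: "1 \<le> m \<Longrightarrow> m \<le> m' \<Longrightarrow> mean m \<le> mean m'"
proof -
  assume m: "1 \<le> m" "m \<le> m'"
  have "(\<Sum>i=1..m. f0 (Z (Inl i) \<omega>)) \<le> (\<Sum>i=1..m'. f0 (Z (Inl i) \<omega>))" for \<omega>
    using m f0_nonneg by (intro sum_mono2) auto
  then show ?thesis
    unfolding mean_Inl[OF m(1)] mean_Inl[OF order.trans[OF m]]
    using gh_integrable[of "Inl 1" "{1..m}" Inl] gh_integrable[of "Inl 1" "{1..m'}" Inl] g0_bounds f0_nonneg
    by (intro integral_mono mult_left_mono h0_mono sum_nonneg) auto
qed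

text \<open>Exchanging 1 and \<open>i\<close> moves the factor \<open>g0\<close> to position
  \<open>i\<close> and leaves the sum unchanged.\<close>

lemma mean_transpose:
  assumes i: "i \<in> {1..m}"
  shows "(\<integral>\<omega>. g0 (Z (Inl i) \<omega>) * h0 (\<Sum>k=1..m. f0 (Z (Inl k) \<omega>)) \<partial>M) = mean m"
proof -
  let ?t = "\<lambda>k. if k = 1 then i else if k = i then 1 else k"
  have perm: "bij_betw ?t {1..m} {1..m}"
    using i by (intro bij_betw_byWitness[of _ ?t]) auto
  have "(\<Sum>k=1..m. f0 (Z (Inl (?t k)) \<omega>)) = (\<Sum>k=1..m. f0 (Z (Inl k) \<omega>))" for \<omega>
    using sum.reindex_bij_betw[OF perm, of "\<lambda>k. f0 (Z (Inl k) \<omega>)"] .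
  moreover have "(\<integral>\<omega>. g0 (Z (Inl (?t 1)) \<omega>) * h0 (\<Sum>k=1..m. f0 (Z (Inl (?t k)) \<omega>)) \<partial>M) = mean m"
    using i perm by (intro mean_eq) (auto simp: inj_on_def)
  ultimately show ?thesis by simp
qed

subsection \<open>The conditional expectation in the bound\<close>

text \<open>Fubini for an independent pair: \<open>R\<close> is integrated out with \<open>Y\<close>
  frozen.\<close>

lemma independent_integral:
  fixes Y R :: "'a \<Rightarrow> real \<times> real" and \<psi> :: "(real \<times> real) \<times> (real \<times> real) \<Rightarrow> real"
  assumes ind: "indep_var borel Y borel R"
    and \<psi> [measurable]: "\<psi> \<in> borel_measurable (borel \<Otimes>\<^sub>M borel)" and b: "\<And>x. \<bar>\<psi> x\<bar> \<le> b"
  shows "(\<integral>\<omega>. \<psi> (Y \<omega>, R \<omega>) \<partial>M) = (\<integral>\<omega>. (\<integral>r. \<psi> (Y \<omega>, r) \<partial>distr M borel R) \<partial>M)"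
proof -
  have rv [measurable]: "Y \<in> borel_measurable M" "R \<in> borel_measurable M"
    and joint: "distr M borel Y \<Otimes>\<^sub>M distr M borel R = distr M (borel \<Otimes>\<^sub>M borel) (\<lambda>\<omega>. (Y \<omega>, R \<omega>))"
    using ind unfolding indep_var_distribution_eq by blast+
  interpret Y: prob_space "distr M borel Y" by (rule prob_space_distr) simp
  interpret R: prob_space "distr M borel R" by (rule prob_space_distr) simp
  interpret YR: pair_prob_space "distr M borel Y" "distr M borel R" ..
  have [measurable_cong]: "sets (distr M borel Y \<Otimes>\<^sub>M distr M borel R) = sets (borel \<Otimes>\<^sub>M borel)"
    by (rule sets_pair_measure_cong) auto
  have int: "integrable (distr M borel Y \<Otimes>\<^sub>M distr M borel R) \<psi>"
    using b by (intro YR.integrable_const_bound[of _ b]) auto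
  have "(\<integral>\<omega>. \<psi> (Y \<omega>, R \<omega>) \<partial>M) = integral\<^sup>L (distr M (borel \<Otimes>\<^sub>M borel) (\<lambda>\<omega>. (Y \<omega>, R \<omega>))) \<psi>"
    by (subst integral_distr) auto
  also have "\<dots> = (\<integral>y. (\<integral>r. \<psi> (y, r) \<partial>distr M borel R) \<partial>distr M borel Y)"
    unfolding joint[symmetric] by (rule YR.integral_fst'[OF int, symmetric])
  also have "\<dots> = (\<integral>\<omega>. (\<integral>r. \<psi> (Y \<omega>, r) \<partial>distr M borel R) \<partial>M)"
    by (subst integral_distr) (auto intro!: R.borel_measurable_lebesgue_integral)
  finally show ?thesis .
qed

text \<open>Given \<open>\<eta>b 1\<close>, the conditional expectation integrates out all other
  claims and leaves a function of \<open>\<eta>b 1\<close>. Those claims are independent of the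
  whole first pair, not only of its first component, so after multiplication by \<open>g0\<close>
  the integration can be undone, and a mean over \<open>n + p\<close> distinct claims
  results.\<close>

lemma claim_term_eq:
  assumes n: "1 \<le> n"
  shows "claim_term M f g h \<eta> \<eta>b \<theta>b n p = mean (n + p)"
proof -
  define Y where "Y = Z (Inr 1)"
  \<comment> \<open>The claims that enter the sum apart from the first barred one.\<close>
  define B where "B = Inr ` {2..n} \<union> (Inl ` {1..p} :: (nat + nat) set)"
  define R where "R \<omega> = (\<Sum>j\<in>B. f0 (Z j \<omega>))" for \<omega>
  have BJ: "B \<subseteq> claim_indices" "Inr 1 \<notin> B" "finite B" by (auto simp: B_def)
  have Y [measurable]: "Y \<in> borel_measurable M" unfolding Y_def by (rule Z_meas) simp
  \<comment> \<open>\<open>indep_var\<close> requires both variables to have the same type, hence the dummy component.\<close>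
  define R2 where "R2 \<omega> = (R \<omega>, 0 :: real)" for \<omega>
  have ind: "indep_var borel Y borel R2"
  proof -
    have "indep_var (PiM {Inr 1} (\<lambda>_. borel)) (\<lambda>\<omega>. restrict (\<lambda>i. Z i \<omega>) {Inr 1})
        (PiM B (\<lambda>_. borel)) (\<lambda>\<omega>. restrict (\<lambda>i. Z i \<omega>) B)"
      by (rule indep_var_restrict[OF claims_conds(3)]) (use BJ in auto)
    moreover have "(\<lambda>x. x (Inr 1)) \<in> PiM {Inr 1} (\<lambda>_. borel :: (real \<times> real) measure) \<rightarrow>\<^sub>M borel"
      by (rule measurable_component_singleton) simp
    moreover have comp: "(\<lambda>x. x j) \<in> PiM B (\<lambda>_. borel :: (real \<times> real) measure) \<rightarrow>\<^sub>M borel" if "j \<in> B" for j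
      using that by (rule measurable_component_singleton)
    have "(\<lambda>x. (\<Sum>j\<in>B. f0 (x j), 0 :: real)) \<in> PiM B (\<lambda>_. borel :: (real \<times> real) measure) \<rightarrow>\<^sub>M borel"
      by (intro borel_measurable_Pair borel_measurable_sum borel_measurable_const
          measurable_compose[OF comp f0_measurable])
    ultimately have "indep_var borel ((\<lambda>x. x (Inr 1)) \<circ> (\<lambda>\<omega>. restrict (\<lambda>i. Z i \<omega>) {Inr 1}))
        borel ((\<lambda>x. (\<Sum>j\<in>B. f0 (x j), 0)) \<circ> (\<lambda>\<omega>. restrict (\<lambda>i. Z i \<omega>) B))"
      by (rule indep_var_compose)
    moreover have "(\<lambda>x. x (Inr 1)) \<circ> (\<lambda>\<omega>. restrict (\<lambda>i. Z i \<omega>) {Inr 1}) = Y"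
      by (simp add: Y_def fun_eq_iff)
    moreover have "(\<lambda>x. (\<Sum>j\<in>B. f0 (x j), 0)) \<circ> (\<lambda>\<omega>. restrict (\<lambda>i. Z i \<omega>) B) = R2"
      by (simp add: R_def R2_def fun_eq_iff)
    ultimately show ?thesis by simp
  qed
  have R [measurable]: "R2 \<in> borel_measurable M" using ind unfolding indep_var_distribution_eq by simp
  interpret DR: prob_space "distr M borel R2" by (rule prob_space_distr) simp
  have [measurable]: "fst \<in> borel_measurable (borel :: (real \<times> real) measure)"
    by (simp add: borel_prod[symmetric])
  define \<phi> where "\<phi> y = (\<integral>r. h0 (f0 y + fst r) \<partial>distr M borel R2)" for y
  have \<phi>_meas [measurable]: "\<phi> \<in> borel_measurable borel"
    unfolding \<phi>_def[abs_def] by (intro DR.borel_measurable_lebesgue_integral) measurable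
  have h_int: "integrable (distr M borel R2) (\<lambda>r. h0 (f0 y + fst r))" for y
    using h0_bounds by (intro DR.integrable_const_bound[of _ bh]) auto
  have \<phi>_bounds: "0 \<le> \<phi> y" "\<phi> y \<le> bh" for y
  proof -
    show "0 \<le> \<phi> y" unfolding \<phi>_def using h0_bounds by (intro integral_nonneg_AE) auto
    show "\<phi> y \<le> bh" unfolding \<phi>_def using h0_bounds h_int by (intro DR.integral_le_const) auto
  qed
  \<comment> \<open>That \<open>\<phi>\<close> ignores the second component makes
    \<open>\<phi> (Y \<omega>)\<close> measurable with respect to \<open>\<eta>b 1\<close>.\<close>
  have \<phi>_fst: "\<phi> (x, y) = \<phi> (x, 0)" for x y by (simp add: \<phi>_def f0_def)
  let ?S = "\<lambda>\<omega>. (\<Sum>k=1..n. f (\<eta>b k \<omega>)) + (\<Sum>i=1..p. f (\<eta> i \<omega>))"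
  have f0_Z: "f0 (Z (Inl i) \<omega>) = f (\<eta> i \<omega>)" "f0 (Z (Inr i) \<omega>) = f (\<eta>b i \<omega>)"
    if "1 \<le> i" "\<omega> \<in> space M" for i \<omega>
    using that Z_pos[of "Inl i" \<omega>] Z_pos[of "Inr i" \<omega>] by (auto simp: f0_def Z_eval)
  have S_pos: "0 \<le> f0 (Y \<omega>) + R \<omega>" for \<omega>
    unfolding R_def using f0_nonneg by (intro add_nonneg_nonneg sum_nonneg) auto
  have S: "h (?S \<omega>) = h0 (f0 (Y \<omega>) + R \<omega>)" if "\<omega> \<in> space M" for \<omega>
  proof -
    have "R \<omega> = (\<Sum>j\<in>Inr ` {2..n}. f0 (Z j \<omega>)) + (\<Sum>j\<in>Inl ` {1..p}. f0 (Z j \<omega>))"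
      unfolding R_def B_def by (rule sum.union_disjoint) auto
    also have "\<dots> = (\<Sum>k=2..n. f (\<eta>b k \<omega>)) + (\<Sum>i=1..p. f (\<eta> i \<omega>))"
      using that by (simp add: sum.reindex f0_Z)
    finally have "f0 (Y \<omega>) + R \<omega> = f (\<eta>b 1 \<omega>) + (\<Sum>k=2..n. f (\<eta>b k \<omega>)) + (\<Sum>i=1..p. f (\<eta> i \<omega>))"
      using that f0_Z(2)[of 1 \<omega>] by (simp add: Y_def)
    also have "f (\<eta>b 1 \<omega>) + (\<Sum>k=2..n. f (\<eta>b k \<omega>)) = (\<Sum>k=1..n. f (\<eta>b k \<omega>))"
      using n sum.atLeast_Suc_atMost[of 1 n "\<lambda>k. f (\<eta>b k \<omega>)"] by (simp add: numeral_2_eq_2)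
    finally show ?thesis using S_pos[of \<omega>] by (simp add: h0_def)
  qed
  let ?F = "vimage_algebra (space M) (\<eta>b 1) borel"
  have \<eta>Y: "\<eta>b 1 \<omega> = fst (Y \<omega>)" for \<omega> by (simp add: Y_def Z_eval)
  have \<eta>b_meas: "\<eta>b 1 \<in> borel_measurable M"
  proof -
    have "(\<lambda>\<omega>. fst (Y \<omega>)) \<in> borel_measurable M" using Y by (simp add: borel_prod[symmetric])
    moreover have "\<eta>b 1 = (\<lambda>\<omega>. fst (Y \<omega>))" by (rule ext) (rule \<eta>Y)
    ultimately show ?thesis by (simp only:)
  qed
  have sub: "subalgebra M ?F"
    unfolding subalgebra_def using \<eta>b_meas
    by (auto simp: sets_vimage_algebra2[of _ "space M" borel] measurable_sets)
  interpret F: finite_measure_subalgebra M ?F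
    by (intro finite_measure_subalgebra.intro finite_measure_axioms finite_measure_subalgebra_axioms.intro sub)
  have \<psi>1: "(\<lambda>x. indicator A (fst (fst x)) * h0 (f0 (fst x) + fst (snd x))) \<in> borel_measurable ((borel :: (real \<times> real) measure) \<Otimes>\<^sub>M (borel :: (real \<times> real) measure))"
    if "A \<in> sets borel" for A :: "real set"
  proof -
    have [measurable]: "(\<lambda>y::real \<times> real. indicator A (fst y) :: real) \<in> borel_measurable borel"
      using that by (simp add: borel_prod[symmetric])
    show ?thesis by measurable
  qed
  have AE: "AE \<omega> in M. real_cond_exp M ?F (\<lambda>\<omega>. h (?S \<omega>)) \<omega> = \<phi> (Y \<omega>)"
  proof (rule F.real_cond_exp_charact)
    have "(\<lambda>\<omega>. h0 (f0 (Y \<omega>) + fst (R2 \<omega>))) \<in> borel_measurable M" by measurable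
    then have hm: "(\<lambda>\<omega>. h0 (f0 (Y \<omega>) + R \<omega>)) \<in> borel_measurable M" by (simp add: R2_def)
    have hi: "integrable M (\<lambda>\<omega>. h0 (f0 (Y \<omega>) + R \<omega>))"
      using h0_bounds hm by (intro integrable_const_bound[of _ bh]) auto
    have "integrable M (\<lambda>\<omega>. h (?S \<omega>)) \<longleftrightarrow> integrable M (\<lambda>\<omega>. h0 (f0 (Y \<omega>) + R \<omega>))"
      by (intro Bochner_Integration.integrable_cong refl S)
    then show "integrable M (\<lambda>\<omega>. h (?S \<omega>))" using hi by blast
    show "integrable M (\<lambda>\<omega>. \<phi> (Y \<omega>))"
      using \<phi>_bounds by (intro integrable_const_bound[of _ bh]) auto
    have "(\<lambda>x. \<phi> (x, 0)) \<in> borel_measurable borel"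
      by (rule measurable_compose[OF _ \<phi>_meas]) (simp add: borel_prod[symmetric])
    then have "(\<lambda>\<omega>. \<phi> (\<eta>b 1 \<omega>, 0)) \<in> borel_measurable ?F"
      by (rule measurable_compose[rotated]) (rule measurable_vimage_algebra1, simp)
    moreover have "(\<lambda>\<omega>. \<phi> (\<eta>b 1 \<omega>, 0)) = (\<lambda>\<omega>. \<phi> (Y \<omega>))"
    proof (rule ext)
      fix \<omega>
      show "\<phi> (\<eta>b 1 \<omega>, 0) = \<phi> (Y \<omega>)"
        using \<phi>_fst[of "fst (Y \<omega>)" "snd (Y \<omega>)"] unfolding \<eta>Y by simp
    qed
    ultimately show "(\<lambda>\<omega>. \<phi> (Y \<omega>)) \<in> borel_measurable ?F" by simp
    fix E assume "E \<in> sets ?F"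
    then obtain A where A: "A \<in> sets borel" "E = \<eta>b 1 -` A \<inter> space M"
      by (auto simp: sets_vimage_algebra2)
    have "(LINT \<omega>:E|M. h (?S \<omega>)) = (\<integral>\<omega>. indicator A (fst (Y \<omega>)) * h0 (f0 (Y \<omega>) + R \<omega>) \<partial>M)"
      unfolding set_lebesgue_integral_def
      by (intro Bochner_Integration.integral_cong) (auto simp: A \<eta>Y S simp del: One_nat_def split: split_indicator)
    also have "\<dots> = (\<integral>\<omega>. (\<integral>r. indicator A (fst (Y \<omega>)) * h0 (f0 (Y \<omega>) + fst r) \<partial>distr M borel R2) \<partial>M)"
      using independent_integral[OF ind \<psi>1[OF A(1)], of bh] h0_bounds
      by (simp add: R2_def abs_mult indicator_def)
    also have "\<dots> = (LINT \<omega>:E|M. \<phi> (Y \<omega>))"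
      unfolding set_lebesgue_integral_def \<phi>_def
      by (intro Bochner_Integration.integral_cong) (auto simp: A \<eta>Y simp del: One_nat_def split: split_indicator)
    finally show "(LINT \<omega>:E|M. h (?S \<omega>)) = (LINT \<omega>:E|M. \<phi> (Y \<omega>))" .
  qed
  have gY: "g (\<eta>b 1 \<omega>) (\<theta>b 1 \<omega>) = g0 (Y \<omega>)" if "\<omega> \<in> space M" for \<omega>
    using Z_pos[of "Inr 1" \<omega>] that by (simp add: g0_def Y_def Z_eval del: One_nat_def)
  have "claim_term M f g h \<eta> \<eta>b \<theta>b n p
     = (\<integral>\<omega>. g0 (Y \<omega>) * real_cond_exp M ?F (\<lambda>\<omega>. h (?S \<omega>)) \<omega> \<partial>M)"
    unfolding claim_term_def by (intro Bochner_Integration.integral_cong) (auto simp: gY simp del: One_nat_def)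
  also have "\<dots> = (\<integral>\<omega>. g0 (Y \<omega>) * \<phi> (Y \<omega>) \<partial>M)"
    using AE measurable_compose[OF Y g0_measurable] measurable_compose[OF Y \<phi>_meas]
    by (intro integral_cong_AE borel_measurable_times) (auto elim: eventually_mono)
  also have "\<dots> = (\<integral>\<omega>. (\<integral>r. g0 (Y \<omega>) * h0 (f0 (Y \<omega>) + fst r) \<partial>distr M borel R2) \<partial>M)"
    by (simp add: \<phi>_def)
  also have "\<dots> = (\<integral>\<omega>. g0 (Y \<omega>) * h0 (f0 (Y \<omega>) + R \<omega>) \<partial>M)"
  proof -
    have m: "(\<lambda>x. g0 (fst x) * h0 (f0 (fst x) + fst (snd x))) \<in> borel_measurable ((borel :: (real \<times> real) measure) \<Otimes>\<^sub>M (borel :: (real \<times> real) measure))"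
      by measurable
    show ?thesis using independent_integral[OF ind m, of "bg * bh"] gh_bounds
      by (simp add: R2_def abs_of_nonneg)
  qed
  also have "\<dots> = mean (n + p)"
  proof -
    \<comment> \<open>Barred claims come first, so that position 1 is the claim on which
      \<open>g0\<close> is evaluated.\<close>
    define \<sigma> where "\<sigma> k = (if k \<le> n then Inr k else Inl (k - n) :: nat + nat)" for k
    have "{1..n + p} = insert 1 ({2..n} \<union> {n + 1..n + p})" using n by auto
    have img: "\<sigma> ` ({2..n} \<union> {n + 1..n + p}) = B"
    proof -
      have "\<sigma> ` {2..n} = Inr ` {2..n}" by (intro image_cong) (auto simp: \<sigma>_def)
      moreover have "\<sigma> ` {n + 1..n + p} = Inl ` ((\<lambda>k. k - n) ` {n + 1..n + p})"
        unfolding image_image by (intro image_cong) (auto simp: \<sigma>_def)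
      moreover have "(\<lambda>k. k - n) ` {n + 1..n + p} = {1..p}"
      proof (intro equalityI subsetI)
        fix x assume "x \<in> {1..p}"
        then show "x \<in> (\<lambda>k. k - n) ` {n + 1..n + p}" by (intro image_eqI[of _ _ "x + n"]) auto
      qed auto
      ultimately show ?thesis unfolding B_def image_Un by (simp only:)
    qed
    have inj: "inj_on \<sigma> {1..n + p}" by (auto simp: inj_on_def \<sigma>_def split: if_splits)
    have "(\<Sum>k=1..n + p. f0 (Z (\<sigma> k) \<omega>)) = f0 (Y \<omega>) + R \<omega>" for \<omega>
    proof -
      have "(\<Sum>k=1..n + p. f0 (Z (\<sigma> k) \<omega>)) = f0 (Z (\<sigma> 1) \<omega>) + (\<Sum>k\<in>{2..n} \<union> {n + 1..n + p}. f0 (Z (\<sigma> k) \<omega>))"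
        unfolding \<open>{1..n + p} = insert 1 ({2..n} \<union> {n + 1..n + p})\<close> using n by (subst sum.insert) auto
      also have "(\<Sum>k\<in>{2..n} \<union> {n + 1..n + p}. f0 (Z (\<sigma> k) \<omega>)) = R \<omega>"
        unfolding R_def img[symmetric]
        by (subst sum.reindex[OF inj_on_subset[OF inj]]) auto
      finally show ?thesis using n by (simp add: \<sigma>_def Y_def)
    qed
    moreover have "\<sigma> 1 = Inr 1" using n by (simp add: \<sigma>_def)
    moreover have "\<sigma> ` {1..n + p} \<subseteq> claim_indices" by (auto simp: \<sigma>_def)
    ultimately show ?thesis using mean_eq[OF _ inj] n by (simp add: Y_def)
  qed
  finally show ?thesis .
qed

end

section \<open>The bound\<close>

lemma inverse_squares_summable: "summable (\<lambda>p. 1 / (real (Suc p))\<^sup>2)"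
proof -
  have "summable (\<lambda>p. inverse ((real p)\<^sup>2))" by (rule inverse_power_summable) simp
  then have "summable (\<lambda>p. inverse ((real (Suc p))\<^sup>2))" by (subst summable_Suc_iff)
  then show ?thesis by (simp only: inverse_eq_divide)
qed

text \<open>Summation starts at 0, so \<open>p\<close> stands for \<open>p + 1\<close> of the
  overview: hence the argument \<open>p + 2\<close> and the denominator
  \<open>Suc p\<close>.\<close>

lemma increment_le_weighted_tail:
  fixes a :: "nat \<Rightarrow> real"
  assumes mono: "\<And>m m'. 1 \<le> m \<Longrightarrow> m \<le> m' \<Longrightarrow> a m \<le> a m'" and bdd: "\<And>m. 1 \<le> m \<Longrightarrow> a m \<le> b"
    and m: "1 \<le> m"
  shows "summable (\<lambda>p. (a (p + 2) - a 1) / (real (Suc p))\<^sup>2)"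
    and "a m - a 1 \<le> (real m - 1) * (\<Sum>p. (a (p + 2) - a 1) / (real (Suc p))\<^sup>2)"
proof -
  let ?t = "\<lambda>p. (a (p + 2) - a 1) / (real (Suc p))\<^sup>2"
  have t0: "0 \<le> ?t p" for p using mono[of 1 "p + 2"] by simp
  show sum: "summable ?t"
  proof (rule summable_comparison_test')
    show "summable (\<lambda>p. (b - a 1) * (1 / (real (Suc p))\<^sup>2))"
      by (intro summable_mult inverse_squares_summable)
    show "norm (?t p) \<le> (b - a 1) * (1 / (real (Suc p))\<^sup>2)" for p
      unfolding real_norm_def abs_of_nonneg[OF t0] using bdd[of "p + 2"] by (simp add: divide_right_mono)
  qed
  show "a m - a 1 \<le> (real m - 1) * (\<Sum>p. ?t p)"
  proof (cases "m = 1")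
    case False
    \<comment> \<open>The tail starts where the argument \<open>p + 2\<close> reaches
      \<open>m\<close>; its denominators begin with the square of
      \<open>m - 1 = q + 1\<close>.\<close>
    define q where "q = m - 2"
    have mq: "m = q + 2" using False m by (simp add: q_def)
    \<comment> \<open>Telescoping minorant of the tail, based on
      \<open>1 / r - 1 / (r + 1) \<le> 1 / r^2\<close>; its total is
      \<open>(a m - a 1) / (m - 1)\<close>.\<close>
    define y where "y i = (a m - a 1) * (1 / real (q + Suc i) - 1 / real (q + Suc (Suc i)))" for i
    have "(\<lambda>i. 1 / real (q + i + 1)) \<longlonglongrightarrow> 0"
    proof -
      have "(\<lambda>i. inverse (real (Suc (i + q)))) \<longlonglongrightarrow> 0"
        using LIMSEQ_ignore_initial_segment[OF LIMSEQ_inverse_real_of_nat, of q] .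
      then show ?thesis by (simp add: inverse_eq_divide add_ac)
    qed
    then have "(\<lambda>i. 1 / real (q + i + 1) - 1 / real (q + Suc i + 1)) sums (1 / real (q + 0 + 1) - 0)"
      by (rule telescope_sums')
    then have ys: "y sums ((a m - a 1) * (1 / real (q + 1)))"
      unfolding y_def[abs_def] by (intro sums_mult) simp
    have "(a m - a 1) * (1 / real (q + 1)) \<le> (\<Sum>i. ?t (i + q))"
    proof (rule sums_le[OF _ ys])
      show "(\<lambda>i. ?t (i + q)) sums (\<Sum>i. ?t (i + q))"
        using summable_ignore_initial_segment[OF sum, of q] by (rule summable_sums)
      fix i
      let ?r = "real (q + Suc i)"
      have "1 / ?r - 1 / (?r + 1) = 1 / (?r * (?r + 1))" by (simp add: field_simps)
      also have "\<dots> \<le> 1 / (?r * ?r)" by (intro divide_left_mono mult_left_mono) auto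
      finally have "1 / real (q + Suc i) - 1 / real (q + Suc (Suc i)) \<le> 1 / (real (Suc (i + q)))\<^sup>2"
        by (simp add: power2_eq_square add_ac)
      moreover have "0 \<le> a m - a 1" "a m - a 1 \<le> a (i + q + 2) - a 1"
        using mono[of 1 m] mono[of m "i + q + 2"] m mq by auto
      ultimately have "y i \<le> (a (i + q + 2) - a 1) * (1 / (real (Suc (i + q)))\<^sup>2)"
        unfolding y_def by (intro mult_mono') (auto simp: field_simps)
      then show "y i \<le> ?t (i + q)" by simp
    qed
    also have "\<dots> \<le> (\<Sum>p. ?t p)"
      using suminf_split_initial_segment[OF sum, of q] t0 by (simp add: sum_nonneg)
    finally have "(a m - a 1) / real (q + 1) \<le> (\<Sum>p. ?t p)" by simp
    then have "a m - a 1 \<le> (\<Sum>p. ?t p) * real (q + 1)" by (subst (asm) pos_divide_le_eq) auto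
    then show ?thesis using mq by (simp add: mult.commute)
  qed simp
qed

text \<open>The geometric series differentiated twice has the coefficients
  \<open>(n + 1) * (n + 2)\<close>, which dominate.\<close>

lemma summable_square_geometric:
  assumes "0 \<le> \<rho>" "\<rho> < (1::real)"
  shows "summable (\<lambda>n. \<rho> ^ n * (real (Suc n))\<^sup>2)"
proof -
  have 1: "summable (\<lambda>n. diffs (\<lambda>_. 1) n * x ^ n)" if "norm x < 1" for x :: real
    using that by (intro termdiff_converges[of x 1]) (auto intro: summable_geometric)
  have sm: "summable (\<lambda>n. diffs (diffs (\<lambda>_. 1)) n * \<rho> ^ n)"
    using assms 1 by (intro termdiff_converges[of \<rho> 1]) auto
  show ?thesis
  proof (rule summable_comparison_test'[OF sm, of 0])
    fix n :: nat
    have "real (Suc n) * real (Suc n) \<le> real (Suc n) * real (Suc (Suc n))" by (intro mult_left_mono) auto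
    then have "\<rho> ^ n * (real (Suc n))\<^sup>2 \<le> \<rho> ^ n * (real (Suc n) * real (Suc (Suc n)))"
      using assms by (intro mult_left_mono) (auto simp: power2_eq_square)
    then show "norm (\<rho> ^ n * (real (Suc n))\<^sup>2) \<le> diffs (diffs (\<lambda>_. 1)) n * \<rho> ^ n"
      using assms by (simp add: diffs_def mult_ac)
  qed
qed

locale hawkes_claims = hawkes_model M T \<Phi> \<mu> N H \<Lambda> + claims_model M T N \<eta> \<theta> \<eta>b \<theta>b f h g
  for M :: "'a measure" and T \<mu> \<Phi> N H \<Lambda> \<eta> \<theta> \<eta>b \<theta>b f h g
begin

text \<open>The number of claims is deterministic here; the random number is substituted later, so
  that independence can be used for each of its values separately.\<close>

definition payoff :: "nat \<Rightarrow> 'a \<Rightarrow> real" where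
  "payoff m \<omega> = (\<Sum>i=1..m. g0 (Z (Inl i) \<omega>)) * h0 (\<Sum>k=1..m. f0 (Z (Inl k) \<omega>))"

definition claim_algebra :: "'a measure" where
  "claim_algebra = sigma (space M) (\<Union>j\<in>claim_indices. {Z j -` A \<inter> space M | A. A \<in> sets borel})"

lemma claim_algebra_sets:
  "sets claim_algebra = sigma_sets (space M) (\<Union>j\<in>claim_indices. {Z j -` A \<inter> space M | A. A \<in> sets borel})"
  unfolding claim_algebra_def by (rule sets_measure_of) auto

lemma space_claim_algebra: "space claim_algebra = space M"
  unfolding claim_algebra_def by (rule space_measure_of) auto

lemma claim_subalgebra: "subalgebra M claim_algebra"
  unfolding subalgebra_def space_claim_algebra claim_algebra_sets
  using Z_meas by (intro conjI refl sets.sigma_sets_subset) (auto intro: measurable_sets)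

lemma Z_claim_algebra: "j \<in> claim_indices \<Longrightarrow> Z j \<in> borel_measurable claim_algebra"
  by (rule measurableI) (auto simp: claim_algebra_sets space_claim_algebra intro!: sigma_sets.Basic)

lemma payoff_measurable: "payoff m \<in> borel_measurable claim_algebra"
  unfolding payoff_def[abs_def]
  by (intro borel_measurable_times borel_measurable_sum measurable_compose[OF Z_claim_algebra g0_measurable]
      measurable_compose[OF _ h0_measurable] measurable_compose[OF Z_claim_algebra f0_measurable]) auto

lemma payoff_measurable_M: "payoff m \<in> borel_measurable M"
  by (rule measurable_from_subalg[OF claim_subalgebra payoff_measurable])

lemma payoff_nonneg: "0 \<le> payoff m \<omega>"
  unfolding payoff_def using g0_bounds h0_bounds by (intro mult_nonneg_nonneg sum_nonneg) auto

lemma payoff_eq: "payoff m \<omega> = (\<Sum>i=1..m. g0 (Z (Inl i) \<omega>) * h0 (\<Sum>k=1..m. f0 (Z (Inl k) \<omega>)))"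
  unfolding payoff_def by (simp add: sum_distrib_right)

lemma integrable_payoff: "integrable M (payoff m)"
  unfolding payoff_eq[abs_def]
  by (intro Bochner_Integration.integrable_sum gh_integrable) auto

lemma expectation_payoff: "expectation (payoff m) = real m * mean m"
proof -
  have "expectation (payoff m) = (\<Sum>i=1..m. \<integral>\<omega>. g0 (Z (Inl i) \<omega>) * h0 (\<Sum>k=1..m. f0 (Z (Inl k) \<omega>)) \<partial>M)"
    unfolding payoff_eq by (intro Bochner_Integration.integral_sum gh_integrable) auto
  also have "\<dots> = (\<Sum>i=1..m. mean m)" by (intro sum.cong refl mean_transpose)
  finally show ?thesis by simp
qed

lemma H_T_measurable_M [measurable]: "H T \<in> M \<rightarrow>\<^sub>M count_space UNIV"
  by (rule measurable_from_subalg[OF filtration_subalgebra H_T_measurable])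

lemma nn_integral_count_decomp:
  fixes c :: "nat \<Rightarrow> 'a \<Rightarrow> real"
  assumes [measurable]: "\<And>m. c m \<in> borel_measurable M"
  shows "(\<integral>\<^sup>+\<omega>. ennreal (c (H T \<omega>) \<omega>) \<partial>M)
     = (\<Sum>m. \<integral>\<^sup>+\<omega>. ennreal (c m \<omega> * indicator {m} (H T \<omega>)) \<partial>M)"
proof -
  have "ennreal (c (H T \<omega>) \<omega>) = (\<Sum>m. ennreal (c m \<omega> * indicator {m} (H T \<omega>)))" for \<omega>
    by (subst suminf_finite[of "{H T \<omega>}"]) auto
  moreover have [measurable]: "(\<lambda>\<omega>. indicator {m} (H T \<omega>) :: real) \<in> borel_measurable M" for m
    by (rule measurable_compose[OF H_T_measurable_M]) simp
  ultimately show ?thesis by (simp add: nn_integral_suminf)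
qed

text \<open>On each event \<open>H T = m\<close> the payoff depends on the claims only and may be
  replaced by its mean. The integrals are taken in the extended nonnegative reals, as integrability
  for the random number is not known yet.\<close>

lemma nn_integral_payoff:
  "(\<integral>\<^sup>+\<omega>. ennreal (payoff (H T \<omega>) \<omega>) \<partial>M) = (\<integral>\<^sup>+\<omega>. ennreal (real (H T \<omega>) * mean (H T \<omega>)) \<partial>M)"
proof -
  have "(\<integral>\<^sup>+\<omega>. ennreal (payoff m \<omega> * indicator {m} (H T \<omega>)) \<partial>M)
      = (\<integral>\<^sup>+\<omega>. ennreal (real m * mean m * indicator {m} (H T \<omega>)) \<partial>M)" for m
  proof -
    have im: "(\<lambda>\<omega>. indicator {m} (H T \<omega>) :: real) \<in> borel_measurable (natural_filtration M T N T)"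
      by (rule measurable_compose[OF H_T_measurable]) simp
    have iv: "indep_var borel (\<lambda>\<omega>. indicator {m} (H T \<omega>) :: real) borel (payoff m)"
      using claims_conds(4)
      by (intro indep_var_subalgebras[OF filtration_subalgebra claim_subalgebra _ im payoff_measurable])
        (simp add: claim_algebra_sets)
    have ii: "integrable M (\<lambda>\<omega>. indicator {m} (H T \<omega>) :: real)"
      using measurable_from_subalg[OF filtration_subalgebra im]
      by (intro integrable_const_bound[of _ 1]) (auto split: split_indicator)
    have e1: "(\<integral>\<omega>. indicator {m} (H T \<omega>) * payoff m \<omega> \<partial>M)
        = (\<integral>\<omega>. indicator {m} (H T \<omega>) \<partial>M) * expectation (payoff m)"
      by (rule indep_var_lebesgue_integral[OF iv ii integrable_payoff])
    have e2: "integrable M (\<lambda>\<omega>. indicator {m} (H T \<omega>) * payoff m \<omega>)"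
      by (rule indep_var_integrable[OF iv ii integrable_payoff])
    have "(\<integral>\<^sup>+\<omega>. ennreal (payoff m \<omega> * indicator {m} (H T \<omega>)) \<partial>M)
        = ennreal (\<integral>\<omega>. indicator {m} (H T \<omega>) * payoff m \<omega> \<partial>M)"
      using e2 payoff_nonneg by (subst nn_integral_eq_integral[symmetric]) (auto simp: mult.commute)
    also have "\<dots> = ennreal (\<integral>\<omega>. real m * mean m * indicator {m} (H T \<omega>) \<partial>M)"
      unfolding e1 expectation_payoff by (simp add: mult.commute)
    also have "\<dots> = (\<integral>\<^sup>+\<omega>. ennreal (real m * mean m * indicator {m} (H T \<omega>)) \<partial>M)"
      using ii mean_nonneg by (subst nn_integral_eq_integral) auto
    finally show ?thesis .
  qed
  then show ?thesis
    using nn_integral_count_decomp[of payoff, OF payoff_measurable_M]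
      nn_integral_count_decomp[of "\<lambda>m _. real m * mean m"] by simp
qed

text \<open>The number \<open>s\<close> of the overview.\<close>

definition excess :: real where
  "excess = (\<Sum>p. (mean (p + 2) - mean 1) / (real (Suc p))\<^sup>2)"

lemma excess_summable: "summable (\<lambda>p. (mean (p + 2) - mean 1) / (real (Suc p))\<^sup>2)"
  by (rule increment_le_weighted_tail(1)[where a=mean and b="bg * bh" and m=1, OF mean_mono mean_le]) auto

lemma excess_nonneg: "0 \<le> excess"
  unfolding excess_def using mean_mono[of 1] by (intro suminf_nonneg excess_summable) auto

lemma payoff_bound:
  assumes y1: "set_integrable lborel {0..T} y1" "\<And>t. t \<in> {0..T} \<Longrightarrow> y1 t = 1 + conv y1 t"
    and y2: "set_integrable lborel {0..T} y2" "\<And>t. t \<in> {0..T} \<Longrightarrow> y2 t = (y1 t)\<^sup>2 + conv y2 t"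
  defines "I1 \<equiv> (LBINT t:{0..T}. y1 t)" and "C1 \<equiv> (LBINT t:{0..T}. y2 t)"
  assumes I1: "0 \<le> I1" and C1: "0 \<le> C1"
  shows "(\<integral>\<^sup>+\<omega>. ennreal (payoff (H T \<omega>) \<omega>) \<partial>M)
     \<le> ennreal (mean 1 * (\<mu> * I1) + excess * ((\<mu> * I1)\<^sup>2 + \<mu> * \<Phi> 0 * I1 * C1))"
proof -
  have pt: "real m * mean m \<le> mean 1 * real m + excess * real (m * (m - 1))" for m
  proof (cases "m = 0")
    case False
    then have "mean m - mean 1 \<le> (real m - 1) * excess"
      unfolding excess_def using mean_mono mean_le by (intro increment_le_weighted_tail(2)) auto
    then have "real m * (mean m - mean 1) \<le> real m * ((real m - 1) * excess)" by (intro mult_left_mono) auto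
    then show ?thesis using False by (simp add: of_nat_diff algebra_simps)
  qed simp
  have "(\<integral>\<^sup>+\<omega>. ennreal (payoff (H T \<omega>) \<omega>) \<partial>M)
      \<le> (\<integral>\<^sup>+\<omega>. ennreal (mean 1) * of_nat (H T \<omega>) + ennreal excess * of_nat (H T \<omega> * (H T \<omega> - 1)) \<partial>M)"
    unfolding nn_integral_payoff
  proof (rule nn_integral_mono)
    fix \<omega>
    have "ennreal (real (H T \<omega>) * mean (H T \<omega>)) \<le> ennreal (mean 1 * real (H T \<omega>) + excess * real (H T \<omega> * (H T \<omega> - 1)))"
      by (intro ennreal_leI pt)
    also have "\<dots> = ennreal (mean 1) * of_nat (H T \<omega>) + ennreal excess * of_nat (H T \<omega> * (H T \<omega> - 1))"
      unfolding ennreal_of_nat_eq_real_of_nat using mean_nonneg excess_nonneg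
      by (simp only: ennreal_mult'' ennreal_plus mult_nonneg_nonneg of_nat_0_le_iff)
    finally show "ennreal (real (H T \<omega>) * mean (H T \<omega>))
        \<le> ennreal (mean 1) * of_nat (H T \<omega>) + ennreal excess * of_nat (H T \<omega> * (H T \<omega> - 1))" .
  qed
  also have "\<dots> = ennreal (mean 1) * (\<integral>\<^sup>+\<omega>. of_nat (H T \<omega>) \<partial>M) + ennreal excess * (\<integral>\<^sup>+\<omega>. of_nat (H T \<omega> * (H T \<omega> - 1)) \<partial>M)"
  proof -
    have [measurable]: "(\<lambda>\<omega>. of_nat (H T \<omega>) :: ennreal) \<in> borel_measurable M"
      "(\<lambda>\<omega>. of_nat (H T \<omega> * (H T \<omega> - 1)) :: ennreal) \<in> borel_measurable M"
      by (rule measurable_compose[OF H_T_measurable_M], simp)+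
    show ?thesis by (subst nn_integral_add) (auto simp: nn_integral_cmult simp del: of_nat_mult)
  qed
  also have "\<dots> \<le> ennreal (mean 1) * ennreal (\<mu> * I1) + ennreal excess * ennreal ((\<mu> * I1)\<^sup>2 + \<mu> * \<Phi> 0 * I1 * C1)"
    unfolding I1_def C1_def by (intro add_mono mult_left_mono moments[OF y1 y2]) auto
  also have "\<dots> = ennreal (mean 1 * (\<mu> * I1) + excess * ((\<mu> * I1)\<^sup>2 + \<mu> * \<Phi> 0 * I1 * C1))"
    using mean_nonneg excess_nonneg \<mu> \<Phi>0 I1 C1
    by (subst ennreal_plus) (auto simp: ennreal_mult)
  finally show ?thesis .
qed

end

theorem corollary4p9:
  fixes M :: "'a measure"
    and N :: "'a \<Rightarrow> (real \<times> real) measure"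
    and T \<mu> C1 C2 :: real
    and \<Phi> \<Psi>1 \<Psi>2 f h :: "real \<Rightarrow> real"
    and g :: "real \<Rightarrow> real \<Rightarrow> real"
    and H :: "real \<Rightarrow> 'a \<Rightarrow> nat"
    and \<Lambda> :: "real \<Rightarrow> 'a \<Rightarrow> real"
    and \<eta> \<theta> \<eta>b \<theta>b :: "nat \<Rightarrow> 'a \<Rightarrow> real"
    and L K :: "'a \<Rightarrow> real"
    and c \<beta> :: "nat \<Rightarrow> real"
  assumes "prob_space M"
    and "T > 0" and "\<mu> > 0"
    and \<Phi>_meas: "set_borel_measurable borel {0..T} \<Phi>"
    and \<Phi>_nonneg: "\<And>t. t \<in> {0..T} \<Longrightarrow> \<Phi> t \<ge> 0"
    and \<Phi>_bounded: "bounded (\<Phi> ` {0..T})"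
    and \<Phi>_stable: "(LBINT s:{0..T}. \<Phi> s) < 1"
    and poisson: "poisson_random_measure M (strip_intensity T) N"
    and hawkes: "hawkes_solution M T \<mu> \<Phi> N H \<Lambda>"
    and claims: "iid_claims M T N \<eta> \<theta> \<eta>b \<theta>b"
    and f_meas: "set_borel_measurable borel {0..} f"
    and f_nonneg: "\<And>x. x \<ge> 0 \<Longrightarrow> f x \<ge> 0"
    and f_bounded: "bounded (f ` {0..})"
    and g_meas: "set_borel_measurable borel ({0..} \<times> {0..}) (\<lambda>(x, y). g x y)"
    and g_nonneg: "\<And>x y. x \<ge> 0 \<Longrightarrow> y \<ge> 0 \<Longrightarrow> g x y \<ge> 0"
    and g_bounded: "bounded ((\<lambda>(x, y). g x y) ` ({0..} \<times> {0..}))"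
    and h_meas: "set_borel_measurable borel {0..} h"
    and h_nonneg: "\<And>x. x \<ge> 0 \<Longrightarrow> h x \<ge> 0"
    and h_bounded: "bounded (h ` {0..})"
    and h_mono: "mono_on {0..} h"
    and \<Phi>_antimono: "antimono_on {0..T} \<Phi>"
    and L: "\<And>\<omega>. \<omega> \<in> space M \<Longrightarrow> L \<omega> = (\<Sum>i=1..H T \<omega>. f (\<eta> i \<omega>))"
    and K: "\<And>\<omega>. \<omega> \<in> space M \<Longrightarrow> K \<omega> = (\<Sum>i=1..H T \<omega>. g (\<eta> i \<omega>) (\<theta> i \<omega>))"
    and \<Psi>1_int: "set_integrable lborel {0..T} \<Psi>1"
    and \<Psi>1: "\<And>t. t \<in> {0..T} \<Longrightarrow> \<Psi>1 t = 1 + (LBINT s:{0..t}. \<Phi> (t - s) * \<Psi>1 s)"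
    and \<Psi>2_int: "set_integrable lborel {0..T} \<Psi>2"
    and \<Psi>2: "\<And>t. t \<in> {0..T} \<Longrightarrow> \<Psi>2 t = (\<Psi>1 t)\<^sup>2 + (LBINT s:{0..t}. \<Phi> s * \<Psi>2 (t - s))"
    and C2: "C2 = (LBINT t:{0..T}. \<Psi>1 t)\<^sup>2"
    and C1: "C1 = (LBINT t:{0..T}. \<Psi>2 t)"
    and c: "\<And>n. n \<ge> 1 \<Longrightarrow>
              c n = (\<mu> + real n * \<Phi> 0) * C1 + (\<mu> + real n * \<Phi> 0)\<^sup>2 * C2"
    and \<beta>: "\<And>n. n \<ge> 1 \<Longrightarrow>
              \<beta> n = exp (- T * (\<mu> + real n * \<Phi> 0)) * claim_term M f g h \<eta> \<eta>b \<theta>b n 0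
                + (\<Sum>p. c n / (real (Suc p))\<^sup>2 * claim_term M f g h \<eta> \<eta>b \<theta>b n (Suc p))"
  shows "integrable M (\<lambda>\<omega>. K \<omega> * h (L \<omega>))
       \<and> (\<forall>n\<ge>1. summable (\<lambda>p. c n / (real (Suc p))\<^sup>2 * claim_term M f g h \<eta> \<eta>b \<theta>b n (Suc p)))
       \<and> summable (\<lambda>n. simplex_mass T \<Phi> (Suc n) * \<beta> (Suc n))
       \<and> (\<integral>\<omega>. K \<omega> * h (L \<omega>) \<partial>M) \<le> \<mu> * (\<Sum>n. simplex_mass T \<Phi> (Suc n) * \<beta> (Suc n))"
proof -
  have \<Phi>_meas': "(\<lambda>t. indicator {0..T} t * \<Phi> t) \<in> borel_measurable borel"
    using \<Phi>_meas by (simp add: set_borel_measurable_def)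
  have \<Phi>_anti: "\<Phi> t \<le> \<Phi> s" if "0 \<le> s" "s \<le> t" "t \<le> T" for s t
    using monotone_onD[OF \<Phi>_antimono, of s t] that by simp
  have "hawkes_model M T \<Phi> \<mu> N H \<Lambda>"
    by (intro hawkes_model.intro hawkes_model_axioms.intro volterra_kernel.intro \<open>prob_space M\<close>
        \<open>T > 0\<close> \<open>\<mu> > 0\<close> \<Phi>_meas' \<Phi>_nonneg \<Phi>_anti \<Phi>_stable poisson hawkes)
  moreover have "claims_model M T N \<eta> \<theta> \<eta>b \<theta>b f h g"
    by (intro claims_model.intro claims_model_axioms.intro \<open>prob_space M\<close> claims f_meas f_nonneg
        g_meas g_nonneg g_bounded h_meas h_nonneg h_bounded h_mono)
  ultimately interpret hawkes_claims M T \<mu> \<Phi> N H \<Lambda> \<eta> \<theta> \<eta>b \<theta>b f h g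
    by (rule hawkes_claims.intro)
  have y1: "\<Psi>1 t = 1 + conv \<Psi>1 t" if "t \<in> {0..T}" for t
    using \<Psi>1[OF that] by (simp add: conv_def)
  \<comment> \<open>Reflection of the integration variable: the equation for \<Psi>2 is stated with
    the kernel at \<open>s\<close>, whereas \<open>conv\<close> has it at
    \<open>t - s\<close>.\<close>
  have y2: "\<Psi>2 t = (\<Psi>1 t)\<^sup>2 + conv \<Psi>2 t" if "t \<in> {0..T}" for t
  proof -
    have "(LBINT s:{0..t}. \<Phi> s * \<Psi>2 (t - s)) = (\<integral>s. indicator {0..t} (t - s) *\<^sub>R (\<Phi> (t - s) * \<Psi>2 (t - (t - s))) \<partial>lborel)"
      unfolding set_lebesgue_integral_def
      using lborel_integral_real_affine[of "-1" "\<lambda>s. indicator {0..t} s *\<^sub>R (\<Phi> s * \<Psi>2 (t - s))" t] by simp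
    also have "\<dots> = conv \<Psi>2 t"
      unfolding conv_def set_lebesgue_integral_def
      by (intro Bochner_Integration.integral_cong) (auto split: split_indicator)
    finally show ?thesis using \<Psi>2[OF that] by simp
  qed
  define I1 where "I1 = (LBINT t:{0..T}. \<Psi>1 t)"
  have \<Psi>1_ge: "1 \<le> \<Psi>1 t" if "t \<in> {0..T}" for t
    using renewal_ge[OF \<Psi>1_int y1, of t] that by simp
  \<comment> \<open>This serves \<open>T \<le> I1 \<le> C1\<close>, by which \<open>C1\<close> may
    replace the smaller quantities below.\<close>
  have \<Psi>2_ge: "\<Psi>1 t \<le> \<Psi>2 t" if "t \<in> {0..T}" for t
  proof -
    have "\<Psi>1 t * 1 \<le> \<Psi>1 t * \<Psi>1 t" using \<Psi>1_ge[OF that] by (intro mult_left_mono) auto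
    moreover have "(\<Psi>1 t)\<^sup>2 \<le> \<Psi>2 t" using renewal_ge[OF \<Psi>2_int y2, of t] that by simp
    ultimately show ?thesis by (simp add: power2_eq_square)
  qed
  have TI1: "T \<le> I1"
  proof -
    have "set_integrable lborel {0..T} (\<lambda>_. 1 :: real)"
      using integrable_const_Icc[of 1] by (simp add: set_integrable_def)
    then have "(LBINT t:{0..T}. 1) \<le> I1"
      unfolding I1_def using \<Psi>1_int \<Psi>1_ge by (intro set_integral_mono) auto
    then show ?thesis using \<open>T > 0\<close> by (simp add: set_lebesgue_integral_def)
  qed
  have IC: "I1 \<le> C1"
    unfolding I1_def C1 using \<Psi>1_int \<Psi>2_int \<Psi>2_ge by (intro set_integral_mono) auto
  have I1_0: "0 \<le> I1" and C1_0: "0 \<le> C1" using TI1 IC \<open>T > 0\<close> by auto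
  have C2_0: "0 \<le> C2" by (simp add: C2)
  define a where "a = mean 1"
  have a0: "0 \<le> a" unfolding a_def by (rule mean_nonneg)
  \<comment> \<open>The common lower bound of all \<open>\<beta> n\<close>; as the simplex masses
    sum to \<open>I1\<close>, the series is then at least \<open>X * I1\<close>.\<close>
  define X where "X = a + (\<mu> + \<Phi> 0) * C1 * excess"
  have bound: "(\<integral>\<^sup>+\<omega>. ennreal (payoff (H T \<omega>) \<omega>) \<partial>M) \<le> ennreal (\<mu> * (X * I1))"
  proof -
    have "(\<integral>\<^sup>+\<omega>. ennreal (payoff (H T \<omega>) \<omega>) \<partial>M)
        \<le> ennreal (a * (\<mu> * I1) + excess * ((\<mu> * I1)\<^sup>2 + \<mu> * \<Phi> 0 * I1 * C1))"
      using payoff_bound[OF \<Psi>1_int y1 \<Psi>2_int y2] I1_0 C1_0 by (simp add: I1_def C1 a_def)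
    also have "\<dots> \<le> ennreal (\<mu> * (X * I1))"
    proof (rule ennreal_leI)
      \<comment> \<open>One factor \<open>I1\<close> is enlarged to \<open>C1\<close>, so that
        \<open>\<mu> * I1\<close> factors out and the coefficient
        \<open>(\<mu> + \<Phi> 0) * C1\<close> of \<open>excess\<close> appears.\<close>
      have "(\<mu> * I1) * (\<mu> * I1) \<le> (\<mu> * I1) * (\<mu> * C1)"
        using \<open>\<mu> > 0\<close> I1_0 IC by (intro mult_left_mono) auto
      then have "excess * ((\<mu> * I1)\<^sup>2 + \<mu> * \<Phi> 0 * I1 * C1) \<le> excess * (\<mu> * I1 * (\<mu> * C1) + \<mu> * \<Phi> 0 * I1 * C1)"
        using excess_nonneg by (intro mult_left_mono add_right_mono) (auto simp: power2_eq_square)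
      then show "a * (\<mu> * I1) + excess * ((\<mu> * I1)\<^sup>2 + \<mu> * \<Phi> 0 * I1 * C1) \<le> \<mu> * (X * I1)"
        by (simp add: X_def algebra_simps)
    qed
    finally show ?thesis .
  qed
  have payoff_KL: "payoff (H T \<omega>) \<omega> = K \<omega> * h (L \<omega>)" if \<omega>: "\<omega> \<in> space M" for \<omega>
  proof -
    have pos: "0 \<le> \<eta> i \<omega> \<and> 0 \<le> \<theta> i \<omega>" if "i \<in> {1..m}" for i m
      using Z_pos[of "Inl i" \<omega>] \<omega> that by (simp add: Z_eval)
    have "(\<Sum>i=1..m. g0 (Z (Inl i) \<omega>)) = (\<Sum>i=1..m. g (\<eta> i \<omega>) (\<theta> i \<omega>))" for m
      using pos by (intro sum.cong) (auto simp: g0_def Z_eval simp del: One_nat_def)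
    moreover have f: "(\<Sum>i=1..m. f0 (Z (Inl i) \<omega>)) = (\<Sum>i=1..m. f (\<eta> i \<omega>))" for m
      using pos by (intro sum.cong) (auto simp: f0_def Z_eval simp del: One_nat_def)
    moreover have "0 \<le> (\<Sum>i=1..m. f (\<eta> i \<omega>))" for m
      unfolding f[symmetric] by (intro sum_nonneg f0_nonneg)
    ultimately show ?thesis using K[OF \<omega>] L[OF \<omega>] by (simp add: payoff_def h0_def)
  qed
  have payoff_meas: "(\<lambda>\<omega>. payoff (H T \<omega>) \<omega>) \<in> borel_measurable M"
    using payoff_measurable_M H_T_measurable_M by (rule measurable_compose_countable)
  have payoff_int: "integrable M (\<lambda>\<omega>. payoff (H T \<omega>) \<omega>)"
  proof (rule integrableI_bounded[OF payoff_meas])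
    show "(\<integral>\<^sup>+\<omega>. ennreal (norm (payoff (H T \<omega>) \<omega>)) \<partial>M) < \<infinity>"
      using bound payoff_nonneg by (simp add: le_less_trans[OF _ ennreal_less_top])
  qed
  have X0: "0 \<le> X" unfolding X_def using a0 \<open>\<mu> > 0\<close> \<Phi>0 C1_0 excess_nonneg by simp
  have KL_int: "integrable M (\<lambda>\<omega>. K \<omega> * h (L \<omega>))"
    using payoff_int payoff_KL Bochner_Integration.integrable_cong[OF refl, of M "\<lambda>\<omega>. payoff (H T \<omega>) \<omega>" "\<lambda>\<omega>. K \<omega> * h (L \<omega>)"]
    by blast
  have KL_le: "(\<integral>\<omega>. K \<omega> * h (L \<omega>) \<partial>M) \<le> \<mu> * (X * I1)"
  proof -
    have "ennreal (\<integral>\<omega>. payoff (H T \<omega>) \<omega> \<partial>M) \<le> ennreal (\<mu> * (X * I1))"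
      using bound payoff_nonneg by (subst nn_integral_eq_integral[OF payoff_int, symmetric]) auto
    then have "(\<integral>\<omega>. payoff (H T \<omega>) \<omega> \<partial>M) \<le> \<mu> * (X * I1)"
      using X0 I1_0 \<open>\<mu> > 0\<close> by (subst (asm) ennreal_le_iff) auto
    also have "(\<integral>\<omega>. payoff (H T \<omega>) \<omega> \<partial>M) = (\<integral>\<omega>. K \<omega> * h (L \<omega>) \<partial>M)"
      by (intro Bochner_Integration.integral_cong refl payoff_KL)
    finally show ?thesis .
  qed
  \<comment> \<open>Quadratic growth constant of \<open>c\<close>, from
    \<open>\<mu> + n * \<Phi> 0 \<le> n * (\<mu> + \<Phi> 0)\<close>; it serves the convergence of
    the series.\<close>
  define A where "A = (\<mu> + \<Phi> 0) * C1 + (\<mu> + \<Phi> 0)\<^sup>2 * C2"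
  define b where "b = bg * bh"
  define \<zeta> where "\<zeta> = (\<Sum>p. 1 / (real (Suc p))\<^sup>2)"
  have \<zeta>1: "1 \<le> \<zeta>"
    unfolding \<zeta>_def using sum_le_suminf[OF inverse_squares_summable, of "{0}"] by simp
  have b0: "0 \<le> b" unfolding b_def using g0_bounds(3) h0_bounds(3) by simp
  \<comment> \<open>The first bound matches the coefficient of \<open>excess\<close> in
    \<open>X\<close>, the second compensates the exponential factor of
    \<open>\<beta> n\<close>.\<close>
  have c_ge: "(\<mu> + \<Phi> 0) * C1 \<le> c n" "(\<mu> + real n * \<Phi> 0) * T \<le> c n" if n: "1 \<le> n" for n
  proof -
    have "1 * \<Phi> 0 \<le> real n * \<Phi> 0" using n \<Phi>0 by (intro mult_right_mono) auto
    then have "(\<mu> + \<Phi> 0) * C1 \<le> (\<mu> + real n * \<Phi> 0) * C1" using C1_0 by (intro mult_right_mono) auto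
    moreover have "(\<mu> + real n * \<Phi> 0) * T \<le> (\<mu> + real n * \<Phi> 0) * C1"
      using \<open>\<mu> > 0\<close> \<Phi>0 TI1 IC by (intro mult_left_mono) auto
    moreover have "0 \<le> (\<mu> + real n * \<Phi> 0)\<^sup>2 * C2" using C2_0 by simp
    ultimately show "(\<mu> + \<Phi> 0) * C1 \<le> c n" "(\<mu> + real n * \<Phi> 0) * T \<le> c n" using c[OF n] by linarith+
  qed
  have c0: "0 \<le> c n" if "1 \<le> n" for n
    using c_ge(1)[OF that] \<open>\<mu> > 0\<close> \<Phi>0 C1_0 by (meson add_nonneg_nonneg less_imp_le mult_nonneg_nonneg order.trans)
  have c_le: "c n \<le> A * (real n)\<^sup>2" if n: "1 \<le> n" for n
  proof -
    have r: "\<mu> + real n * \<Phi> 0 \<le> real n * (\<mu> + \<Phi> 0)"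
    proof -
      have "1 * \<mu> \<le> real n * \<mu>" using n \<open>\<mu> > 0\<close> by (intro mult_right_mono) auto
      then show ?thesis by (simp add: algebra_simps)
    qed
    have r0: "0 \<le> \<mu> + real n * \<Phi> 0" using \<open>\<mu> > 0\<close> \<Phi>0 by simp
    have "real n * 1 \<le> real n * real n" using n by (intro mult_left_mono) auto
    then have "real n * (\<mu> + \<Phi> 0) \<le> (real n)\<^sup>2 * (\<mu> + \<Phi> 0)"
      using \<open>\<mu> > 0\<close> \<Phi>0 by (intro mult_right_mono) (auto simp: power2_eq_square)
    then have "(\<mu> + real n * \<Phi> 0) * C1 \<le> ((real n)\<^sup>2 * (\<mu> + \<Phi> 0)) * C1"
      using r C1_0 by (intro mult_right_mono) auto
    moreover have "(\<mu> + real n * \<Phi> 0)\<^sup>2 * C2 \<le> (real n * (\<mu> + \<Phi> 0))\<^sup>2 * C2"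
      using r r0 C2_0 by (intro mult_right_mono power_mono) auto
    then have "(\<mu> + real n * \<Phi> 0)\<^sup>2 * C2 \<le> ((real n)\<^sup>2 * (\<mu> + \<Phi> 0)\<^sup>2) * C2"
      by (simp only: power_mult_distrib)
    moreover have "A * (real n)\<^sup>2 = ((real n)\<^sup>2 * (\<mu> + \<Phi> 0)) * C1 + ((real n)\<^sup>2 * (\<mu> + \<Phi> 0)\<^sup>2) * C2"
      by (simp add: A_def algebra_simps)
    ultimately show ?thesis using c[OF n] by linarith
  qed
  have term_bounds: "0 \<le> claim_term M f g h \<eta> \<eta>b \<theta>b n p" "claim_term M f g h \<eta> \<eta>b \<theta>b n p \<le> b"
    if "1 \<le> n" for n p
    using claim_term_eq[OF that, of p] mean_nonneg[of "n + p"] mean_le[of "n + p"] that by (auto simp: b_def)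
  let ?s = "\<lambda>n p. c n / (real (Suc p))\<^sup>2 * claim_term M f g h \<eta> \<eta>b \<theta>b n (Suc p)"
  have s_le: "?s n p \<le> (c n * b) * (1 / (real (Suc p))\<^sup>2)" and s_0: "0 \<le> ?s n p" if n: "1 \<le> n" for n p
  proof -
    have q: "0 \<le> c n / (real (Suc p))\<^sup>2" using c0[OF n] by simp
    have "c n / (real (Suc p))\<^sup>2 * b = (c n * b) * (1 / (real (Suc p))\<^sup>2)" by simp
    then show "?s n p \<le> (c n * b) * (1 / (real (Suc p))\<^sup>2)"
      using mult_left_mono[OF term_bounds(2)[OF n] q] by metis
    show "0 \<le> ?s n p" by (rule mult_nonneg_nonneg[OF q term_bounds(1)[OF n]])
  qed
  have dom: "summable (\<lambda>p. (c n * b) * (1 / (real (Suc p))\<^sup>2))" for n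
    by (intro summable_mult inverse_squares_summable)
  have s_sum: "summable (?s n)" if n: "1 \<le> n" for n
    using s_le[OF n] s_0[OF n] by (intro summable_comparison_test'[OF dom[of n], of 0]) (simp only: real_norm_def abs_of_nonneg)
  have \<beta>_ge: "X \<le> \<beta> n" if n: "1 \<le> n" for n
  proof -
    have "a * exp (- T * (\<mu> + real n * \<Phi> 0)) \<le> exp (- T * (\<mu> + real n * \<Phi> 0)) * claim_term M f g h \<eta> \<eta>b \<theta>b n 0"
      using mean_mono[of 1 n] n claim_term_eq[OF n, of 0] by (simp add: a_def mult.commute)
    moreover have "a * c n + c n * excess \<le> (\<Sum>p. ?s n p)"
    proof -
      \<comment> \<open>\<open>mean (p + 2)\<close> is split into \<open>a\<close> and its
        increment, whose sums are governed by \<open>\<zeta>\<close> and \<open>excess\<close>;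
        monotonicity of \<open>mean\<close> reduces a general \<open>n\<close> to the case
        1.\<close>
      let ?r = "\<lambda>p. a * c n * (1 / (real (Suc p))\<^sup>2) + c n * ((mean (p + 2) - a) / (real (Suc p))\<^sup>2)"
      have r_sums: "?r sums (a * c n * \<zeta> + c n * excess)"
        unfolding \<zeta>_def excess_def a_def
        by (intro sums_add sums_mult summable_sums inverse_squares_summable excess_summable)
      have r_le: "?r p \<le> ?s n p" for p
      proof -
        have "?r p = c n / (real (Suc p))\<^sup>2 * mean (p + 2)" by (simp add: field_simps)
        also have "\<dots> \<le> c n / (real (Suc p))\<^sup>2 * mean (n + Suc p)"
          using n c0[OF n] by (intro mult_left_mono mean_mono) auto
        finally show ?thesis by (simp add: claim_term_eq[OF n])
      qed
      have "a * c n * \<zeta> + c n * excess \<le> (\<Sum>p. ?s n p)"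
        by (rule sums_le[OF r_le r_sums summable_sums[OF s_sum[OF n]]])
      moreover have "a * c n * 1 \<le> a * c n * \<zeta>" using a0 c0[OF n] \<zeta>1 by (intro mult_left_mono) auto
      ultimately show ?thesis by simp
    qed
    \<comment> \<open>By \<open>exp (- x) \<ge> 1 - x\<close> with
      \<open>x = T * (\<mu> + n * \<Phi> 0) \<le> c n\<close>: the inner series makes up for what
      the exponential factor loses.\<close>
    moreover have "a \<le> a * exp (- T * (\<mu> + real n * \<Phi> 0)) + a * c n"
      unfolding distrib_left[of a, symmetric]
    proof (rule mult_left_mono[OF _ a0, of 1, unfolded mult_1_right])
      have "1 + - T * (\<mu> + real n * \<Phi> 0) \<le> exp (- T * (\<mu> + real n * \<Phi> 0))" by (rule exp_ge_add_one_self)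
      then show "1 \<le> exp (- T * (\<mu> + real n * \<Phi> 0)) + c n" using c_ge(2)[OF n] by (simp add: mult.commute)
    qed
    moreover have "(\<mu> + \<Phi> 0) * C1 * excess \<le> c n * excess"
      using c_ge(1)[OF n] excess_nonneg by (rule mult_right_mono)
    ultimately show ?thesis unfolding \<beta>[OF n] X_def by linarith
  qed
  have \<beta>_le: "\<beta> n \<le> b * (1 + A * \<zeta>) * (real n)\<^sup>2" if n: "1 \<le> n" for n
  proof -
    have "exp (- T * (\<mu> + real n * \<Phi> 0)) * claim_term M f g h \<eta> \<eta>b \<theta>b n 0 \<le> 1 * b"
      using term_bounds[OF n, of 0] \<open>T > 0\<close> \<open>\<mu> > 0\<close> \<Phi>0 by (intro mult_mono) auto
    moreover have "(\<Sum>p. ?s n p) \<le> c n * b * \<zeta>"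
      unfolding \<zeta>_def suminf_mult[OF inverse_squares_summable, symmetric]
      using s_le[OF n] s_sum[OF n] dom[of n] by (rule suminf_le)
    moreover have "c n * b * \<zeta> \<le> A * (real n)\<^sup>2 * b * \<zeta>"
      using c_le[OF n] b0 \<zeta>1 by (intro mult_right_mono) auto
    moreover have "b * 1 \<le> b * (real n)\<^sup>2" using b0 n by (intro mult_left_mono) auto
    moreover have "b * (1 + A * \<zeta>) * (real n)\<^sup>2 = b * (real n)\<^sup>2 + A * (real n)\<^sup>2 * b * \<zeta>"
      by (simp add: algebra_simps)
    ultimately show ?thesis unfolding \<beta>[OF n] by linarith
  qed
  let ?m = "\<lambda>n. simplex_mass T \<Phi> (Suc n)"
  have sum_m: "?m sums I1" unfolding I1_def using \<Psi>1_int y1 by (rule simplex_mass_sums)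
  have sum_m\<beta>: "summable (\<lambda>n. ?m n * \<beta> (Suc n))"
  proof (rule summable_comparison_test'[of _ 0])
    show "summable (\<lambda>n. (T * (b * (1 + A * \<zeta>))) * (\<rho> ^ n * (real (Suc n))\<^sup>2))"
      using \<rho>_bounds by (intro summable_mult summable_square_geometric)
    fix n
    have "0 \<le> \<beta> (Suc n)" using \<beta>_ge[of "Suc n"] X0 by simp
    then have "norm (?m n * \<beta> (Suc n)) = ?m n * \<beta> (Suc n)" using simplex_mass_nonneg[of n] by simp
    also have "\<dots> \<le> (T * \<rho> ^ n) * (b * (1 + A * \<zeta>) * (real (Suc n))\<^sup>2)"
      using simplex_mass_le[of n] simplex_mass_nonneg[of n] \<beta>_le[of "Suc n"] \<open>0 \<le> \<beta> (Suc n)\<close>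
      by (intro mult_mono) (auto intro: order.trans)
    finally show "norm (?m n * \<beta> (Suc n)) \<le> (T * (b * (1 + A * \<zeta>))) * (\<rho> ^ n * (real (Suc n))\<^sup>2)"
      by (simp add: mult_ac)
  qed
  have "X * I1 \<le> (\<Sum>n. ?m n * \<beta> (Suc n))"
  proof (rule sums_le)
    show "(\<lambda>n. X * ?m n) sums (X * I1)" using sum_m by (rule sums_mult)
    show "(\<lambda>n. ?m n * \<beta> (Suc n)) sums (\<Sum>n. ?m n * \<beta> (Suc n))" using sum_m\<beta> by (rule summable_sums)
    show "X * ?m n \<le> ?m n * \<beta> (Suc n)" for n
      using mult_right_mono[OF \<beta>_ge[of "Suc n"] simplex_mass_nonneg[of n]] by (simp add: mult.commute)
  qed
  then have "\<mu> * (X * I1) \<le> \<mu> * (\<Sum>n. ?m n * \<beta> (Suc n))"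
    using \<open>\<mu> > 0\<close> by (intro mult_left_mono) auto
  then show ?thesis using KL_int KL_le s_sum sum_m\<beta> by auto
qed

end
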